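(* Let $G$ be a finite bipartite graph drawn in the plane, with $n$ white vertices, and let $P_G(t)=t^n+k_1t^{n-1}+\cdots+k_{n-1}t+k_n$ be the singular polynomial of $G$. Then, for each $1\le m\le n$, $$k_m=(-1)^m\sum_{|H|=2m}\delta(\mathbf{p}_{G,H},H),$$ where $H$ ranges over all balanced (induced) subgraphs of $G$ with $2m$ vertices.
   Context: Graphs are finite, simple, bipartite (vertices coloured white and black, edges joining white to black) and drawn in the plane; they are viewed as 1-dimensional CW-complexes. A subgraph is drawn in the plane with the inherited drawing. A subgraph is balanced if it has as many white as black vertices; subgraphs $H$ are taken to be induced (full), so they are determined by their vertex sets. Groups and characters. $\mathbb{S}^1$ denotes the additive group $\mathbb{R}/\mathbb{Z}$ and $\eta:\mathbb{S}^1\to\mathbb{C}$ is $\eta(x)=\exp(2\pi i x)$. The group $\mathbb{Z}/(2)$ is included in $\mathbb{S}^1$ by $m\mapsto m/2$, so $\eta(m)=(-1)^m$ on $\mathbb{Z}/(2)$; hence $H^1(G,\mathbb{Z}/(2))\subseteq H^1(G,\mathbb{S}^1)$. Cohomology classes are evaluated on closed 1-chains. Generalized Kasteleyn matrix. For $G$ with white vertices numbered $1,\dots,n$ and black vertices numbered $1,\dots,n'$, it is an $n\times n'$ complex matrix $A$ with $|a_{ij}|=1$ if the $i$-th white vertex and $j$-th black vertex are adjacent, and $a_{ij}=0$ otherwise. It defines a class $\mathbf{a}\in H^1(G,\mathbb{S}^1)$, represented by the 1-cochain $\mathbf{A}$ with $a_{ij}=\eta(\mathbf{A}(e_{ij}))$,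 where $e_{ij}$ is the edge oriented from the $j$-th black to the $i$-th white vertex. Kasteleyn class. $\mathbf{k}_G\in H^1(G,\mathbb{Z}/(2))$ is the unique class such that for every graph-theoretic cycle $C$ in $G$, $\mathbf{k}_G(C)\equiv m_C+l_C+1\pmod 2$, where $m_C$ is the number of vertices of $G$ in the interior of $C$ (in the plane) and $2l_C$ is the length of $C$. A Kasteleyn matrix $K$ for $G$ is a generalized Kasteleyn matrix whose class is $\mathbf{k}_G$. The singular polynomial $P_G$ of $G$ is $\det(tI-KK^\ast)$ for any Kasteleyn matrix $K$ of $G$ (it does not depend on the choice of $K$). The class $\mathbf{p}_{G,H}$. For $H\subseteq G$, $\mathbf{p}_{G,H}=\pi_{G,H}(\mathbf{k}_G)-\mathbf{k}_H\in H^1(H,\mathbb{Z}/(2))$, where $\pi_{G,H}$ is restriction from $G$ to $H$ and $\mathbf{k}_H$ is the Kasteleyn class of $H$ (computed with vertices of $H$ only). Matchings and $\delta$. Matchings are perfect matchings. A matching is regarded as the 1-chain equal to the sum of its edges oriented from black to white; the difference of two matchings is closed. For $\mathbf{b}\in H^1(H,\mathbb{S}^1)$, $\delta(\mathbf{b},H)=\sum_{\mu_1,\mu_2}\eta(\mathbf{b}(\mu_1-\mu_2))$, where $\mu_1,\mu_2$ range over all matchings of $H$ (and $\delta(\mathbf{b},H)=0$ if $H$ has no matchings). *)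

theory Defs
  imports
    "HOL-Analysis.Path_Connected"
    "HOL-Library.Z2"
    "Jordan_Normal_Form.Schur_Decomposition"
begin

section \<open>The group R/Z\<close>

quotient_type circle = real / "\<lambda>x y. x - y \<in> \<int>"
proof (rule equivpI)
  show "reflp (\<lambda>x y :: real. x - y \<in> \<int>)"
    by (rule reflpI) simp
  show "symp (\<lambda>x y :: real. x - y \<in> \<int>)"
    by (rule sympI) (metis Ints_minus minus_diff_eq)
  show "transp (\<lambda>x y :: real. x - y \<in> \<int>)"
    by (rule transpI) (metis Ints_add diff_add_cancel add_diff_eq)
qed

instantiation circle :: ab_group_add
begin

lift_definition zero_circle :: circle is 0 .

lift_definition plus_circle :: "circle \<Rightarrow> circle \<Rightarrow> circle" is "(+)"
  by (metis Ints_add add_diff_add)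

lift_definition uminus_circle :: "circle \<Rightarrow> circle" is uminus
  by (metis Ints_minus minus_diff_minus)

lift_definition minus_circle :: "circle \<Rightarrow> circle \<Rightarrow> circle" is "(-)"
  by (metis Ints_diff diff_diff_eq2 diff_add_eq add_diff_eq diff_diff_add)

instance
  by (standard; transfer; simp)

end

lift_definition eta :: "circle \<Rightarrow> complex" is "\<lambda>x. exp (2 * of_real pi * \<i> * of_real x)"
proof -
  fix x y :: real
  assume "x - y \<in> \<int>"
  then have "cis (2 * pi * (x - y)) = 1"
    by (rule cis_multiple_2pi)
  then have "cis (2 * pi * x) = cis (2 * pi * y)"
    using cis_mult[of "2 * pi * (x - y)" "2 * pi * y"] by (simp add: algebra_simps)
  then show "exp (2 * of_real pi * \<i> * of_real x) = exp (2 * of_real pi * \<i> * of_real y)"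
    by (simp add: cis_conv_exp mult_ac)
qed

text \<open>The inclusion \<open>m \<mapsto> m / 2\<close> of Z/2 (the type \<^typ>\<open>bit\<close>) into R/Z.\<close>

lift_definition half :: "bit \<Rightarrow> circle" is "\<lambda>m. if m = 1 then 1 / 2 else 0" .

definition int_scale :: "int \<Rightarrow> 'c::ab_group_add \<Rightarrow> 'c"
  where "int_scale k x = (\<Sum>i<nat k. x) - (\<Sum>i<nat (- k). x)"

section \<open>Bipartite graphs drawn in the plane\<close>

text \<open>An edge is a pair (black vertex, white vertex); this is also its reference orientation,
  and the curve that draws it runs in this direction.\<close>

record 'v drawn_graph =
  whites :: "'v set"
  blacks :: "'v set"
  edges :: "('v \<times> 'v) set"
  pos :: "'v \<Rightarrow> complex"
  curve :: "'v \<times> 'v \<Rightarrow> real \<Rightarrow> complex"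

definition verts :: "'v drawn_graph \<Rightarrow> 'v set"
  where "verts G = whites G \<union> blacks G"

definition plane_bipartite_graph :: "'v drawn_graph \<Rightarrow> bool"
  where "plane_bipartite_graph G \<longleftrightarrow>
    finite (whites G) \<and> finite (blacks G) \<and> whites G \<inter> blacks G = {} \<and>
    edges G \<subseteq> blacks G \<times> whites G \<and>
    inj_on (pos G) (verts G) \<and>
    (\<forall>e\<in>edges G.
      arc (curve G e) \<and>
      pathstart (curve G e) = pos G (fst e) \<and>
      pathfinish (curve G e) = pos G (snd e) \<and>
      path_image (curve G e) \<inter> pos G ` verts G = {pos G (fst e), pos G (snd e)}) \<and>
    (\<forall>e\<in>edges G. \<forall>e'\<in>edges G. e \<noteq> e' \<longrightarrow>
      path_image (curve G e) \<inter> path_image (curve G e') \<subseteq>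
        pos G ` ({fst e, snd e} \<inter> {fst e', snd e'}))"

definition induced :: "'v drawn_graph \<Rightarrow> 'v set \<Rightarrow> 'v drawn_graph"
  where "induced G S =
    G\<lparr>whites := whites G \<inter> S, blacks := blacks G \<inter> S, edges := edges G \<inter> S \<times> S\<rparr>"

definition balanced :: "'v drawn_graph \<Rightarrow> bool"
  where "balanced G \<longleftrightarrow> card (whites G) = card (blacks G)"

section \<open>Cohomology in degree one\<close>

text \<open>A 1-cochain with coefficients in \<open>'c\<close> is a function on edges, taken with the orientation
  from black to white, and every 1-cochain of a graph is closed. Cochains are total functions
  whose values off the edges of \<open>G\<close> are irrelevant: \<open>cohomologous\<close> ignores them, so that
  \<^term>\<open>H1 G\<close> is the group of functions on the edges modulo coboundaries.\<close>

type_synonym ('v, 'c) cochain = "'v \<times> 'v \<Rightarrow> 'c"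

definition cohomologous :: "'v drawn_graph \<Rightarrow> (('v, 'c::ab_group_add) cochain) rel"
  where "cohomologous G =
    {(A, A'). \<exists>f. \<forall>(b, w)\<in>edges G. A' (b, w) - A (b, w) = f w - f b}"

definition H1 :: "'v drawn_graph \<Rightarrow> ('v, 'c::ab_group_add) cochain set set"
  where "H1 G = UNIV // cohomologous G"

definition H1_diff ::
    "('v, 'c::ab_group_add) cochain set \<Rightarrow> ('v, 'c) cochain set \<Rightarrow> ('v, 'c) cochain set"
  where "H1_diff a b = {\<lambda>e. A e - B e | A B. A \<in> a \<and> B \<in> b}"

text \<open>The restriction of a class to a subgraph \<open>H\<close>.\<close>

definition H1_restrict ::
    "'v drawn_graph \<Rightarrow> ('v, 'c::ab_group_add) cochain set \<Rightarrow> ('v, 'c) cochain set"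
  where "H1_restrict H a = cohomologous H `` a"

text \<open>The map on cohomology induced by the inclusion \<^const>\<open>half\<close> of coefficients.\<close>

definition H1_half :: "'v drawn_graph \<Rightarrow> ('v, bit) cochain set \<Rightarrow> ('v, circle) cochain set"
  where "H1_half G a = cohomologous G `` ((\<lambda>A. half \<circ> A) ` a)"

text \<open>A 1-chain assigns an integer to every edge oriented from black to white. On a closed chain
  the value below does not depend on the representative of the class.\<close>

type_synonym 'v chain = "'v \<times> 'v \<Rightarrow> int"

definition H1_eval ::
    "'v drawn_graph \<Rightarrow> ('v, 'c::ab_group_add) cochain set \<Rightarrow> 'v chain \<Rightarrow> 'c"
  where "H1_eval G a z = (THE x. \<forall>A\<in>a. x = (\<Sum>e\<in>edges G. int_scale (z e) (A e)))"

section \<open>Cycles and the Kasteleyn class\<close>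

definition cyclic_steps :: "'v list \<Rightarrow> ('v \<times> 'v) set"
  where "cyclic_steps vs = {(vs ! i, vs ! (Suc i mod length vs)) | i. i < length vs}"

definition is_cycle :: "'v drawn_graph \<Rightarrow> 'v list \<Rightarrow> bool"
  where "is_cycle G vs \<longleftrightarrow>
    3 \<le> length vs \<and> distinct vs \<and> cyclic_steps vs \<subseteq> edges G \<union> (edges G)\<inverse>"

definition cycle_chain :: "'v list \<Rightarrow> 'v chain"
  where "cycle_chain vs =
    (\<lambda>(b, w). of_bool ((b, w) \<in> cyclic_steps vs) - of_bool ((w, b) \<in> cyclic_steps vs))"

definition cycle_image :: "'v drawn_graph \<Rightarrow> 'v list \<Rightarrow> complex set"
  where "cycle_image G vs =
    (\<Union>e \<in> edges G \<inter> (cyclic_steps vs \<union> (cyclic_steps vs)\<inverse>). path_image (curve G e))"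

definition interior_count :: "'v drawn_graph \<Rightarrow> 'v list \<Rightarrow> nat"
  where "interior_count G vs = card {v \<in> verts G. pos G v \<in> inside (cycle_image G vs)}"

definition kasteleyn_class :: "'v drawn_graph \<Rightarrow> ('v, bit) cochain set"
  where "kasteleyn_class G =
    (THE k. k \<in> H1 G \<and>
      (\<forall>vs. is_cycle G vs \<longrightarrow>
        H1_eval G k (cycle_chain vs) = of_nat (interior_count G vs + length vs div 2 + 1)))"

definition p_class :: "'v drawn_graph \<Rightarrow> 'v drawn_graph \<Rightarrow> ('v, bit) cochain set"
  where "p_class G H = H1_diff (H1_restrict H (kasteleyn_class G)) (kasteleyn_class H)"

section \<open>Kasteleyn matrices and the singular polynomial\<close>

text \<open>A numbering of a finite set of vertices is a list enumerating it without repetition;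
  indices start at 0.\<close>

definition numbering :: "'v list \<Rightarrow> 'v set \<Rightarrow> bool"
  where "numbering vs V \<longleftrightarrow> distinct vs \<and> set vs = V"

definition gen_kasteleyn_matrix ::
    "'v drawn_graph \<Rightarrow> 'v list \<Rightarrow> 'v list \<Rightarrow> complex mat \<Rightarrow> bool"
  where "gen_kasteleyn_matrix G ws bs A \<longleftrightarrow>
    A \<in> carrier_mat (length ws) (length bs) \<and>
    (\<forall>i<length ws. \<forall>j<length bs.
      (if (bs ! j, ws ! i) \<in> edges G then cmod (A $$ (i, j)) = 1 else A $$ (i, j) = 0))"

definition matrix_class ::
    "'v drawn_graph \<Rightarrow> 'v list \<Rightarrow> 'v list \<Rightarrow> complex mat \<Rightarrow> ('v, circle) cochain set"
  where "matrix_class G ws bs A = cohomologous G ``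
    {a. \<forall>i<length ws. \<forall>j<length bs.
      (bs ! j, ws ! i) \<in> edges G \<longrightarrow> A $$ (i, j) = eta (a (bs ! j, ws ! i))}"

definition kasteleyn_matrix ::
    "'v drawn_graph \<Rightarrow> 'v list \<Rightarrow> 'v list \<Rightarrow> complex mat \<Rightarrow> bool"
  where "kasteleyn_matrix G ws bs K \<longleftrightarrow>
    gen_kasteleyn_matrix G ws bs K \<and> matrix_class G ws bs K = H1_half G (kasteleyn_class G)"

definition singular_polynomial :: "'v drawn_graph \<Rightarrow> complex poly"
  where "singular_polynomial G =
    (THE P. \<exists>ws bs K. numbering ws (whites G) \<and> numbering bs (blacks G) \<and>
      kasteleyn_matrix G ws bs K \<and> P = char_poly (K * mat_adjoint K))"

section \<open>Matchings\<close>

definition matchings :: "'v drawn_graph \<Rightarrow> ('v \<times> 'v) set set"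
  where "matchings G =
    {M. M \<subseteq> edges G \<and> (\<forall>v\<in>verts G. \<exists>!e. e \<in> M \<and> (v = fst e \<or> v = snd e))}"

definition matching_chain :: "('v \<times> 'v) set \<Rightarrow> 'v chain"
  where "matching_chain M = (\<lambda>e. of_bool (e \<in> M))"

definition delta :: "('v, circle) cochain set \<Rightarrow> 'v drawn_graph \<Rightarrow> complex"
  where "delta b H =
    (\<Sum>M1\<in>matchings H. \<Sum>M2\<in>matchings H.
      eta (H1_eval H b (\<lambda>e. matching_chain M1 e - matching_chain M2 e)))"

end

theory Submission
  imports Defs
    "HOL-Complex_Analysis.Winding_Numbers"
    "HOL-Combinatorics.Cycles"
begin

text \<open>The proof has an algebraic half and a planar half.

Algebra: the coefficient of \<open>t\<^bsup>n-m\<^esup>\<close> in \<open>det(t I - K K\<^sup>*)\<close> is \<open>(-1)\<^sup>m\<close> times the sum of the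
principal minors of size \<open>m\<close> of \<open>K K\<^sup>*\<close> (\<open>char_poly_coeff\<close>). Expanding each minor as in the
Cauchy--Binet formula (\<open>gram_principal_minor\<close>) gives a sum over triples \<open>(S, f, p)\<close> of a set \<open>S\<close>
of white vertices, an injection \<open>f\<close> of \<open>S\<close> into the black vertices and a permutation \<open>p\<close> of \<open>S\<close>.
The term vanishes unless \<open>v \<mapsto> f v\<close> and \<open>p v \<mapsto> f v\<close> are both matchings of the subgraph \<open>H\<close>
induced on \<open>S \<union> f ` S\<close>, so the triples are the pairs of matchings of the balanced induced
subgraphs (\<open>delta_eq\<close>, \<open>sum_over_balanced_subsets\<close>). If \<open>A\<close> represents the Kasteleyn class of \<open>G\<close>,
the entries of \<open>K\<close> are the signs \<open>(-1)\<^bsup>A(e)\<^esup>\<close> up to a coboundary, which cancels because both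
matchings cover the same vertices. Each term is therefore \<open>sign p\<close> times the value of the Kasteleyn
class of \<open>G\<close> on the difference of the two matchings. The formula follows once \<open>sign p\<close> is known to be
the value of the Kasteleyn class of \<open>H\<close> itself on that difference.

Kasteleyn's theorem (\<open>matchings_sign\<close>): the difference of the matchings is a sum of cycles, one for
each nontrivial cycle of \<open>p\<close>. A cycle of \<open>p\<close> of length \<open>l > 1\<close> has sign \<open>(-1)\<^bsup>l-1\<^esup>\<close> and yields a graph cycle of
length \<open>2 l\<close>. The vertices inside it are matched among themselves, since an edge that avoids the
cycle cannot cross it, so their number is even, and the Kasteleyn class has the value \<open>l + 1\<close>.

Existence of the Kasteleyn class: the prescribed values on cycles must extend to a homomorphism. A
function on the cycles of a graph comes from a cochain as soon as it is additive on theta graphs,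
that is, on the three cycles formed by three paths with common ends that are otherwise disjoint
(\<open>cycle_function_cochain\<close>, by induction on the edges). For the Kasteleyn values this is a count of
vertices inside the three cycles modulo 2 (\<open>theta_interior_parity\<close>). A point off the theta curve is
inside an even number of the three loops, by additivity of winding numbers (\<open>parity\<close>), and exactly
one of the three open arcs is inside the loop formed by the other two (\<open>exactly_one_inside\<close>).
Uniqueness of the class is the fact that a cochain that vanishes on all cycles is a coboundary
(\<open>zero_on_cycles_potential\<close>).\<close>

section \<open>Theta curves\<close>

lemma connected_Un_disjoint_open:
  assumes "connected S" "open U" "open V" "U \<inter> V = {}" "S \<subseteq> U \<union> V" "x \<in> S" "x \<in> U"
  shows "S \<subseteq> U"
  using connectedD[OF assms(1-3)] assms(4-7) by blast

text \<open>Three arcs with common ends that meet nowhere else. Any two of them form a Jordan curve.\<close>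

locale theta =
  fixes c1 c2 c3 :: "real \<Rightarrow> complex" and a b :: complex
  assumes arcs: "arc c1" "arc c2" "arc c3"
    and starts: "pathstart c1 = a" "pathstart c2 = a" "pathstart c3 = a"
    and finishes: "pathfinish c1 = b" "pathfinish c2 = b" "pathfinish c3 = b"
    and meets: "path_image c1 \<inter> path_image c2 \<subseteq> {a, b}"
      "path_image c1 \<inter> path_image c3 \<subseteq> {a, b}"
      "path_image c2 \<inter> path_image c3 \<subseteq> {a, b}"

lemma two_arcs_simple_loop:
  assumes "arc c1" "arc c2" "pathstart c1 = a" "pathstart c2 = a" "pathfinish c1 = b" "pathfinish c2 = b"
    and "path_image c1 \<inter> path_image c2 \<subseteq> {a, b}"
  shows "simple_path (c1 +++ reversepath c2)"
    and "pathfinish (c1 +++ reversepath c2) = pathstart (c1 +++ reversepath c2)"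
    and "path_image (c1 +++ reversepath c2) = path_image c1 \<union> path_image c2"
proof -
  show "simple_path (c1 +++ reversepath c2)"
    using assms by (intro simple_path_join_loop) (auto simp: arc_reversepath)
qed (use assms in \<open>auto simp: path_image_join\<close>)

text \<open>The winding number of the loop is the difference of two quantities, one for each arc; the three
differences of a theta curve then satisfy a linear relation, although the arcs are not closed and
their winding numbers need not be integers.\<close>

lemma two_arcs_winding_number:
  assumes "arc c1" "arc c2" "pathstart c1 = a" "pathstart c2 = a" "pathfinish c1 = b" "pathfinish c2 = b"
    and "path_image c1 \<inter> path_image c2 \<subseteq> {a, b}"
    and z: "z \<notin> path_image c1" "z \<notin> path_image c2"
  shows "winding_number c1 z - winding_number c2 z
    \<in> (if z \<in> inside (path_image c1 \<union> path_image c2) then {1, -1} else {0})"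
proof -
  let ?c = "c1 +++ reversepath c2"
  note loop = two_arcs_simple_loop[OF assms(1-7)]
  have wn: "winding_number ?c z = winding_number c1 z - winding_number c2 z"
    using assms by (subst winding_number_join) (auto simp: winding_number_reversepath arc_imp_path)
  show ?thesis
  proof (cases "z \<in> inside (path_image ?c)")
    case True
    then show ?thesis
      using simple_closed_path_winding_number_inside[OF loop(1)] wn loop(3) by (metis insertI1 insertI2)
  next
    case False
    then have "z \<in> outside (path_image ?c)"
      using z loop(3) inside_Un_outside[of "path_image ?c"] by blast
    then show ?thesis
      using winding_number_zero_in_outside[OF _ loop(2)] loop wn False by (simp add: simple_path_imp_path)
  qed
qed

context theta
begin

text \<open>With \<open>d\<^sub>i\<^sub>j\<close> the difference of the winding numbers of \<open>c\<^sub>i\<close> and \<open>c\<^sub>j\<close>, one has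
\<open>d\<^sub>1\<^sub>3 = d\<^sub>1\<^sub>2 + d\<^sub>2\<^sub>3\<close>. All three lie in \<open>{-1, 0, 1}\<close>, so an even number of them is nonzero.\<close>

lemma parity:
  assumes "z \<notin> path_image c1" "z \<notin> path_image c2" "z \<notin> path_image c3"
  shows "z \<in> inside (path_image c1 \<union> path_image c2) \<longleftrightarrow>
    (z \<in> inside (path_image c1 \<union> path_image c3) \<longleftrightarrow> z \<notin> inside (path_image c2 \<union> path_image c3))"
proof -
  define d12 d13 d23 where d: "d12 = winding_number c1 z - winding_number c2 z"
    "d13 = winding_number c1 z - winding_number c3 z" "d23 = winding_number c2 z - winding_number c3 z"
  have sum: "d13 = d12 + d23" by (simp add: d)
  have "d12 \<in> (if z \<in> inside (path_image c1 \<union> path_image c2) then {1, -1} else {0})"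
    "d13 \<in> (if z \<in> inside (path_image c1 \<union> path_image c3) then {1, -1} else {0})"
    "d23 \<in> (if z \<in> inside (path_image c2 \<union> path_image c3) then {1, -1} else {0})"
    unfolding d by (rule two_arcs_winding_number; use arcs starts finishes meets assms in simp)+
  then show ?thesis using sum by (auto split: if_splits)
qed

lemma swap12: "theta c2 c1 c3 a b"
  using arcs starts finishes meets by unfold_locales auto

lemma swap13: "theta c3 c2 c1 a b"
  using arcs starts finishes meets by unfold_locales auto

lemma inside_open_connected:
  shows "open (inside (path_image c1 \<union> path_image c2))" "open (outside (path_image c1 \<union> path_image c2))"
    "connected (inside (path_image c1 \<union> path_image c2))"
    "inside (path_image c1 \<union> path_image c2) \<noteq> {}"
    "frontier (inside (path_image c1 \<union> path_image c2)) = path_image c1 \<union> path_image c2"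
  using Jordan_inside_outside[of "c1 +++ reversepath c2"]
    two_arcs_simple_loop[of c1 c2 a b] arcs starts finishes meets by auto

lemma open_arc_side:
  assumes "z \<in> path_image c3 - {a, b}" "z \<in> inside (path_image c1 \<union> path_image c2)"
  shows "path_image c3 - {a, b} \<subseteq> inside (path_image c1 \<union> path_image c2)"
proof (rule connected_Un_disjoint_open)
  show "connected (path_image c3 - {a, b})"
    using connected_simple_path_endless[of c3] arcs starts finishes by (simp add: arc_imp_simple_path)
  show "path_image c3 - {a, b} \<subseteq> inside (path_image c1 \<union> path_image c2) \<union> outside (path_image c1 \<union> path_image c2)"
    using inside_Un_outside[of "path_image c1 \<union> path_image c2"] meets by blast
qed (use assms inside_open_connected inside_Int_outside in auto)

text \<open>Suppose that no open arc is inside the loop of the other two. The inside of \<open>c1 \<union> c2\<close> then avoids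
the whole theta curve, so by \<open>parity\<close> and connectedness it is contained in the inside of
\<open>c1 \<union> c3\<close> or of \<open>c2 \<union> c3\<close>. In the first case its frontier, which contains \<open>c2\<close>, lies in the
closure of the inside of \<open>c1 \<union> c3\<close>; this puts the open arc \<open>c2\<close> inside \<open>c1 \<union> c3\<close>. The second case
is symmetric.\<close>

lemma some_arc_inside:
  assumes "x1 \<in> path_image c1 - {a, b}" "x2 \<in> path_image c2 - {a, b}"
    and out1: "x1 \<notin> inside (path_image c2 \<union> path_image c3)"
    and out2: "x2 \<notin> inside (path_image c1 \<union> path_image c3)"
    and out3: "path_image c3 \<inter> inside (path_image c1 \<union> path_image c2) = {}"
  shows False
proof -
  interpret t13: theta c1 c3 c2 a b using theta.swap12[OF theta.swap13[OF swap12]] .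
  interpret t23: theta c2 c3 c1 a b using theta.swap12[OF swap13] .
  let ?I12 = "inside (path_image c1 \<union> path_image c2)"
  let ?I13 = "inside (path_image c1 \<union> path_image c3)"
  let ?I23 = "inside (path_image c2 \<union> path_image c3)"
  have off: "z \<notin> path_image c1 \<union> path_image c2 \<union> path_image c3" if "z \<in> ?I12" for z
    using that out3 inside_no_overlap[of "path_image c1 \<union> path_image c2"] by blast
  obtain z where z: "z \<in> ?I12" using inside_open_connected by blast
  have *: False if I: "z \<in> inside (path_image d \<union> path_image c3)"
    and d: "theta d c3 e a b" and e: "path_image d \<union> path_image e = path_image c1 \<union> path_image c2"
    and x: "x \<in> path_image e - {a, b}" "x \<notin> inside (path_image d \<union> path_image c3)" for d e x
  proof -
    interpret t: theta d c3 e a b by fact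
    have "?I12 \<subseteq> inside (path_image d \<union> path_image c3)"
    proof (rule connected_Un_disjoint_open)
      show "?I12 \<subseteq> inside (path_image d \<union> path_image c3) \<union> outside (path_image d \<union> path_image c3)"
        using off inside_Un_outside[of "path_image d \<union> path_image c3"] e by blast
    qed (use z I inside_open_connected t.inside_open_connected inside_Int_outside in auto)
    then have "closure ?I12 \<subseteq> closure (inside (path_image d \<union> path_image c3))"
      by (rule closure_mono)
    then have "path_image e \<subseteq> inside (path_image d \<union> path_image c3) \<union> (path_image d \<union> path_image c3)"
      using closure_Un_frontier[of ?I12] closure_Un_frontier[of "inside (path_image d \<union> path_image c3)"]
        inside_open_connected(5) t.inside_open_connected(5) e by blast
    then show False using x t.meets by blast
  qed
  have "z \<in> ?I13 \<or> z \<in> ?I23"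
    using parity[of z] off z by blast
  then show False
  proof
    assume "z \<in> ?I13"
    then show False using *[of c1 c2 x2] assms t13.theta_axioms by blast
  next
    assume "z \<in> ?I23"
    then show False using *[of c2 c1 x1] assms t23.theta_axioms by blast
  qed
qed

text \<open>If \<open>c3\<close> runs inside \<open>c1 \<union> c2\<close>, it splits the inside into two parts, one of which is the inside of
\<open>c2 \<union> c3\<close>. That part is disjoint from \<open>c1\<close>.\<close>

lemma only_one_inside:
  assumes x: "x3 \<in> path_image c3 - {a, b}" "x3 \<in> inside (path_image c1 \<union> path_image c2)"
    and y: "x1 \<in> path_image c1 - {a, b}"
  shows "x1 \<notin> inside (path_image c2 \<union> path_image c3)"
proof -
  have "a \<noteq> b" using arcs(1) starts finishes arc_distinct_ends by metis
  moreover have ab: "{a, b} \<subseteq> path_image c1" "{a, b} \<subseteq> path_image c2" "{a, b} \<subseteq> path_image c3"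
    using starts finishes pathstart_in_path_image pathfinish_in_path_image by (metis empty_subsetI insert_subset)+
  ultimately have "inside (path_image c2 \<union> path_image c3) \<subseteq> inside (path_image c1 \<union> path_image c2)"
    using split_inside_simple_closed_curve[of c1 a b c2 c3] arcs starts finishes meets x
    by (smt (verit) Diff_iff Int_iff Un_iff empty_iff equalityI inf.bounded_iff subset_iff arc_imp_simple_path)
  then show ?thesis
    using y inside_no_overlap[of "path_image c1 \<union> path_image c2"] by blast
qed

text \<open>Since at most one of the three memberships holds, the equivalence says that exactly one does. As the
points are arbitrary, it also shows that each open arc lies entirely on one side.\<close>

theorem exactly_one_inside:
  assumes "x1 \<in> path_image c1 - {a, b}" "x2 \<in> path_image c2 - {a, b}" "x3 \<in> path_image c3 - {a, b}"
  shows "x3 \<in> inside (path_image c1 \<union> path_image c2) \<longleftrightarrow>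
    (x1 \<in> inside (path_image c2 \<union> path_image c3) \<longleftrightarrow> x2 \<in> inside (path_image c1 \<union> path_image c3))"
proof -
  interpret t12: theta c2 c1 c3 a b by (rule swap12)
  interpret t32: theta c3 c2 c1 a b by (rule swap13)
  have "x3 \<in> inside (path_image c1 \<union> path_image c2) \<Longrightarrow> x1 \<notin> inside (path_image c2 \<union> path_image c3)"
    using only_one_inside assms by blast
  moreover have "x3 \<in> inside (path_image c1 \<union> path_image c2) \<Longrightarrow> x2 \<notin> inside (path_image c1 \<union> path_image c3)"
    using t12.only_one_inside assms by (metis Un_commute)
  moreover have "x1 \<in> inside (path_image c2 \<union> path_image c3) \<Longrightarrow> x2 \<notin> inside (path_image c1 \<union> path_image c3)"
    using theta.only_one_inside[OF t32.swap12, of x1 x2] assms by (metis Un_commute)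
  moreover have "x3 \<notin> inside (path_image c1 \<union> path_image c2) \<Longrightarrow>
    path_image c3 \<inter> inside (path_image c1 \<union> path_image c2) = {}"
  proof -
    assume x3: "x3 \<notin> inside (path_image c1 \<union> path_image c2)"
    have "{a, b} \<subseteq> path_image c1"
      using starts finishes pathstart_in_path_image pathfinish_in_path_image by (metis empty_subsetI insert_subset)
    then have "{a, b} \<inter> inside (path_image c1 \<union> path_image c2) = {}"
      using inside_no_overlap[of "path_image c1 \<union> path_image c2"] by blast
    then show ?thesis using open_arc_side x3 assms(3) by blast
  qed
  ultimately show ?thesis
    using some_arc_inside assms by blast
qed

end

section \<open>Functions on the cycles of a graph\<close>

text \<open>Cochains on a symmetric relation are represented as antisymmetric functions of two adjacent
vertices. Cycles are lists of at least three distinct vertices whose last vertex is adjacent to the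
first one, so that a cycle through a given edge is a path between the ends of that edge.\<close>

fun walk_sum :: "('v \<Rightarrow> 'v \<Rightarrow> 'c::ab_group_add) \<Rightarrow> 'v list \<Rightarrow> 'c" where
  "walk_sum a (x # y # zs) = a x y + walk_sum a (y # zs)"
| "walk_sum a zs = 0"

definition loop_sum :: "('v \<Rightarrow> 'v \<Rightarrow> 'c::ab_group_add) \<Rightarrow> 'v list \<Rightarrow> 'c"
  where "loop_sum a vs = walk_sum a vs + a (last vs) (hd vs)"

definition cycle_in :: "('v \<Rightarrow> 'v \<Rightarrow> bool) \<Rightarrow> 'v list \<Rightarrow> bool"
  where "cycle_in R vs \<longleftrightarrow>
    3 \<le> length vs \<and> distinct vs \<and> successively R vs \<and> R (last vs) (hd vs)"

definition antisymmetric :: "('v \<Rightarrow> 'v \<Rightarrow> 'c::ab_group_add) \<Rightarrow> bool"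
  where "antisymmetric a \<longleftrightarrow> (\<forall>x y. a x y = - a y x)"

lemma walk_sum_append:
  assumes "xs \<noteq> []" "ys \<noteq> []"
  shows "walk_sum a (xs @ ys) = walk_sum a xs + a (last xs) (hd ys) + walk_sum a ys"
  using assms
proof (induction a xs rule: walk_sum.induct)
  case ("2_2" a v)
  then show ?case by (cases ys) auto
qed (auto simp: algebra_simps)

lemma walk_sum_split: "walk_sum a (xs @ x # ys) = walk_sum a (xs @ [x]) + walk_sum a (x # ys)"
  by (cases "xs = []") (simp_all add: walk_sum_append)

lemma walk_sum_rev: "antisymmetric a \<Longrightarrow> walk_sum a (rev xs) = - walk_sum a xs"
proof (induction a xs rule: walk_sum.induct)
  case (1 a x y zs)
  have "a y x = - a x y" using 1(2) by (metis antisymmetric_def)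
  then show ?case using 1 walk_sum_append[of "rev (y # zs)" "[x]" a] by (simp add: last_rev)
qed auto

lemma walk_sum_cong:
  "successively R xs \<Longrightarrow> (\<And>x y. R x y \<Longrightarrow> a x y = b x y) \<Longrightarrow> walk_sum a xs = walk_sum b xs"
  by (induction a xs rule: walk_sum.induct) auto

lemma walk_sum_diff: "walk_sum (\<lambda>x y. f y - f x) xs = f (last xs) - f (hd xs)" if "xs \<noteq> []"
  using that by (induction "\<lambda>x y. f y - f x" xs rule: walk_sum.induct) auto

lemma loop_sum_rotate: "loop_sum a (xs @ ys) = loop_sum a (ys @ xs)"
  by (cases "xs = [] \<or> ys = []") (auto simp: loop_sum_def walk_sum_append)

lemma cycle_in_rotate: "cycle_in R (xs @ ys) \<Longrightarrow> cycle_in R (ys @ xs)"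
  by (cases "xs = [] \<or> ys = []") (auto simp: cycle_in_def successively_append_iff)

lemma loop_sum_rev:
  assumes "antisymmetric a" "vs \<noteq> []" shows "loop_sum a (rev vs) = - loop_sum a vs"
proof -
  have "a (hd vs) (last vs) = - a (last vs) (hd vs)" using assms(1) by (metis antisymmetric_def)
  then show ?thesis using assms by (simp add: loop_sum_def walk_sum_rev hd_rev last_rev)
qed

lemma successively_rev_sym: "symp R \<Longrightarrow> successively R (rev xs) \<longleftrightarrow> successively R xs"
  by (simp add: successively_rev) (metis (full_types) successively_mono sympE)

lemma cycle_in_mono: "cycle_in R vs \<Longrightarrow> (\<And>x y. R x y \<Longrightarrow> R' x y) \<Longrightarrow> cycle_in R' vs"
  unfolding cycle_in_def by (metis successively_mono)

lemma successively_split: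
  "successively R (xs @ x # ys) \<longleftrightarrow> successively R (xs @ [x]) \<and> successively R (x # ys)"
  by (auto simp: successively_append_iff)

lemma cycle_of_two_paths:
  assumes "symp R" "successively R (x # p @ [y])" "successively R (x # q @ [y])"
    and "distinct (x # y # p @ q)" "p \<noteq> [] \<or> q \<noteq> []"
  shows "cycle_in R (x # p @ y # rev q)"
proof -
  have "successively R (rev (x # q @ [y]))" using assms by (simp only: successively_rev_sym)
  then have "successively R ((x # p @ y # rev q) @ [x])"
    using assms(2) successively_split[of R "x # p" y "rev q @ [x]"] by simp
  then have "successively R (x # p @ y # rev q)" "R (last (x # p @ y # rev q)) x"
    unfolding successively_append_iff by simp_all
  then show ?thesis using assms(4,5) by (auto simp: cycle_in_def Suc_le_eq eval_nat_numeral)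
qed

lemma long_path:
  assumes "P \<noteq> []" "successively R P" "hd P \<noteq> last P" "\<not> R (hd P) (last P)"
  shows "3 \<le> length P"
proof (rule ccontr)
  assume "\<not> 3 \<le> length P"
  then obtain s where "P = [s] \<or> (\<exists>t. P = [s, t])" using assms(1)
    by (cases P rule: remdups_adj.cases) (auto simp: not_le length_Suc_conv less_Suc_eq eval_nat_numeral)
  then show False using assms by auto
qed

lemma not_successively_split:
  assumes "\<not> successively R w"
  obtains xs ys where "w = xs @ ys" "xs \<noteq> []" "ys \<noteq> []" "\<not> R (last xs) (hd ys)"
  using assms
proof (induction w arbitrary: thesis rule: induct_list012)
  case (3 x y zs)
  show ?case
  proof (cases "R x y")
    case True
    with 3 obtain xs ys where "y # zs = xs @ ys" "xs \<noteq> []" "ys \<noteq> []" "\<not> R (last xs) (hd ys)"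
      by auto
    then show ?thesis using 3(3)[of "x # xs" ys] by simp
  next
    case False
    then show ?thesis using 3(3)[of "[x]" "y # zs"] by simp
  qed
qed auto

definition remove_edge :: "('v \<Rightarrow> 'v \<Rightarrow> bool) \<Rightarrow> 'v \<Rightarrow> 'v \<Rightarrow> 'v \<Rightarrow> 'v \<Rightarrow> bool"
  where "remove_edge R u v x y \<longleftrightarrow> R x y \<and> {x, y} \<noteq> {u, v}"

lemma symp_remove_edge: "symp R \<Longrightarrow> symp (remove_edge R u v)"
  by (auto simp: symp_def remove_edge_def)

text \<open>A cycle that uses the edge \<open>uv\<close> uses it once, so it can be rotated to make \<open>uv\<close> the closing step.\<close>

lemma cycle_through_edge:
  assumes "symp R" "cycle_in R w" "\<not> cycle_in (remove_edge R u v) w"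
  obtains xs ys where "w = xs @ ys" "{last (ys @ xs), hd (ys @ xs)} = {u, v}"
    "successively (remove_edge R u v) (ys @ xs)"
proof -
  let ?R' = "remove_edge R u v"
  have rest: "successively ?R' z" if z: "cycle_in R z" "{last z, hd z} = {u, v}" for z
  proof (rule ccontr)
    assume "\<not> successively ?R' z"
    then obtain xs ys where d: "z = xs @ ys" "xs \<noteq> []" "ys \<noteq> []" "\<not> ?R' (last xs) (hd ys)"
      by (rule not_successively_split)
    then have "R (last xs) (hd ys)" using z by (auto simp: cycle_in_def successively_append_iff)
    then have "{last xs, hd ys} = {u, v}" using d by (auto simp: remove_edge_def)
    then have e: "{last xs, hd ys} = {last ys, hd xs}" using z d by auto
    have "distinct xs" "distinct ys" "set xs \<inter> set ys = {}" using z d by (auto simp: cycle_in_def)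
    moreover have "last xs \<in> set xs" "hd xs \<in> set xs" "last ys \<in> set ys" "hd ys \<in> set ys" using d by auto
    ultimately have "last xs = hd xs" "last ys = hd ys" using e by (auto simp: doubleton_eq_iff)
    then have "length xs = 1" "length ys = 1"
      using \<open>distinct xs\<close> \<open>distinct ys\<close> d(2,3)
      by (metis One_nat_def distinct.simps(2) last_ConsR last_in_set length_0_conv length_Suc_conv list.exhaust_sel list.sel(1))+
    then show False using z d by (simp add: cycle_in_def)
  qed
  have "\<exists>xs ys. w = xs @ ys \<and> {last (ys @ xs), hd (ys @ xs)} = {u, v}"
  proof (cases "successively ?R' w")
    case True
    then have "{last w, hd w} = {u, v}" using assms by (auto simp: cycle_in_def remove_edge_def)
    then have "w = [] @ w \<and> {last (w @ []), hd (w @ [])} = {u, v}" by simp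
    then show ?thesis by blast
  next
    case False
    then obtain xs ys where d: "w = xs @ ys" "xs \<noteq> []" "ys \<noteq> []" "\<not> ?R' (last xs) (hd ys)"
      by (rule not_successively_split)
    then have "R (last xs) (hd ys)" using assms by (auto simp: cycle_in_def successively_append_iff)
    then have "{last xs, hd ys} = {u, v}" using d by (auto simp: remove_edge_def)
    moreover have "last (ys @ xs) = last xs" "hd (ys @ xs) = hd ys" using d by simp_all
    ultimately show ?thesis using d(1) by metis
  qed
  then show thesis using that rest cycle_in_rotate assms(2) by metis
qed

text \<open>The last assumption concerns the theta graph formed by three paths from \<open>x\<close> to \<open>y\<close> with interior
vertices \<open>p\<close>, \<open>q\<close> and \<open>r\<close>. At most one of the paths may be a single edge, as otherwise two of them
would coincide.\<close>

locale cycle_function =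
  fixes R :: "'v \<Rightarrow> 'v \<Rightarrow> bool" and g :: "'v list \<Rightarrow> 'c::ab_group_add"
  assumes sym: "symp R" and irrefl: "\<not> R x x"
    and rotate: "cycle_in R (xs @ ys) \<Longrightarrow> g (xs @ ys) = g (ys @ xs)"
    and reverse: "cycle_in R vs \<Longrightarrow> g (rev vs) = - g vs"
    and theta: "\<lbrakk>distinct (x # y # p @ q @ r); successively R (x # p @ [y]);
      successively R (x # q @ [y]); successively R (x # r @ [y]);
      p \<noteq> [] \<or> q \<noteq> []; p \<noteq> [] \<or> r \<noteq> []; q \<noteq> [] \<or> r \<noteq> []\<rbrakk> \<Longrightarrow>
      g (x # p @ y # rev q) + g (x # q @ y # rev r) = g (x # p @ y # rev r)"
begin

lemma remove_edge: "cycle_function (remove_edge R u v) g"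
proof
  show "symp (remove_edge R u v)" by (rule symp_remove_edge[OF sym])
  fix x show "\<not> remove_edge R u v x x" using irrefl by (auto simp: remove_edge_def)
next
  fix xs ys :: "'v list"
  assume "cycle_in (remove_edge R u v) (xs @ ys)"
  then show "g (xs @ ys) = g (ys @ xs)" 
    by (intro rotate) (erule cycle_in_mono, simp add: remove_edge_def)
next
  fix vs :: "'v list"
  assume "cycle_in (remove_edge R u v) vs"
  then show "g (rev vs) = - g vs" by (intro reverse) (erule cycle_in_mono, simp add: remove_edge_def)
next
  fix x y and p q r :: "'v list"
  have *: "successively (remove_edge R u v) zs \<Longrightarrow> successively R zs" for zs
    by (erule successively_mono) (simp add: remove_edge_def)
  assume "distinct (x # y # p @ q @ r)" "successively (remove_edge R u v) (x # p @ [y])"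
    "successively (remove_edge R u v) (x # q @ [y])" "successively (remove_edge R u v) (x # r @ [y])"
    "p \<noteq> [] \<or> q \<noteq> []" "p \<noteq> [] \<or> r \<noteq> []" "q \<noteq> [] \<or> r \<noteq> []"
  then show "g (x # p @ y # rev q) + g (x # q @ y # rev r) = g (x # p @ y # rev r)"
    by (intro theta *)
qed

text \<open>Let \<open>g\<close> be given by the cochain \<open>a\<close> on the cycles that avoid the edge \<open>uv\<close>. Closing a path from \<open>u\<close>
to \<open>v\<close> by this edge makes it a cycle, and the value that \<open>a\<close> must take on the edge does not depend
on the path. To see this, let two such paths share the initial part \<open>\<alpha> @ [x]\<close>, and let the first
one next meet the second one at \<open>z\<close>. Replacing the section of the second path between \<open>x\<close> and \<open>z\<close>
by that of the first lengthens the common part. The two sections and the rest of the second cycle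
form a theta graph, and the cycle formed by the two sections avoids \<open>uv\<close>, so the replacement changes
\<open>g\<close> and the sum of \<open>a\<close> by the same amount.\<close>

lemma reroute:
  assumes R: "R u v"
    and anti: "antisymmetric a"
    and a: "\<And>vs. cycle_in (remove_edge R u v) vs \<Longrightarrow> loop_sum a vs = g vs"
    and "successively (remove_edge R u v) (\<alpha> @ x # p)" "distinct (\<alpha> @ x # p)"
      "hd (\<alpha> @ x # p) = u" "last (\<alpha> @ x # p) = v"
    and "successively (remove_edge R u v) (\<alpha> @ x # q)" "distinct (\<alpha> @ x # q)"
      "hd (\<alpha> @ x # q) = u" "last (\<alpha> @ x # q) = v"
  shows "g (\<alpha> @ x # p) - walk_sum a (\<alpha> @ x # p) = g (\<alpha> @ x # q) - walk_sum a (\<alpha> @ x # q)"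
  using assms(4-)
proof (induction "length p" arbitrary: \<alpha> x p q rule: less_induct)
  case less
  let ?R' = "remove_edge R u v"
  have sub: "?R' s t \<Longrightarrow> R s t" for s t by (simp add: remove_edge_def)
  have sym': "symp ?R'" by (rule symp_remove_edge[OF sym])
  have uv: "\<not> ?R' u v" "\<not> ?R' v u" by (auto simp: remove_edge_def)
  show ?case
  proof (cases "p = []")
    case True
    then have "q = []" using less.prems by (metis append_is_Nil_conv distinct.simps(2) distinct_append last_ConsL last_ConsR last_appendR last_in_set list.distinct(1))
    then show ?thesis using True by simp
  next
    case p: False
    have q: "q \<noteq> []"
    proof
      assume "q = []"
      then have "x = last p" using less.prems p by simp
      then show False using p less.prems by auto
    qed
    have "last p \<in> set q" using p q less.prems by (metis last_ConsR last_appendR last_in_set list.distinct(1))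
    then have "\<exists>z\<in>set p. z \<in> set q" using p by auto
    then obtain p1 z p2 where p12: "p = p1 @ z # p2" "z \<in> set q" "\<forall>w\<in>set p1. w \<notin> set q"
      using split_list_first_propE[of p "\<lambda>z. z \<in> set q"] by metis
    obtain q1 q2 where q12: "q = q1 @ z # q2" using split_list[OF p12(2)] by blast
    define Q' where "Q' = \<alpha> @ x # p1 @ z # q2"
    have sP: "successively ?R' (\<alpha> @ [x])" "successively ?R' (x # p1 @ [z])" "successively ?R' (z # p2)"
      using less.prems(1) successively_split[of ?R' \<alpha> x p] successively_split[of ?R' "x # p1" z p2]
      by (simp_all add: p12(1))
    have sQ: "successively ?R' (x # q1 @ [z])" "successively ?R' (z # q2)"
      using less.prems(5) successively_split[of ?R' \<alpha> x q] successively_split[of ?R' "x # q1" z q2]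
      by (simp_all add: q12)
    have disj: "distinct (x # z # p1 @ q1 @ q2 @ \<alpha>)"
      using less.prems(2,6) p12 q12 by auto
    have ends: "hd (\<alpha> @ [x]) = u" "last (z # q2) = v"
      using less.prems(3,8) unfolding q12 by (auto simp: hd_append split: if_splits)
    have "successively ?R' Q'"
      using sP sQ successively_split[of ?R' \<alpha> x "p1 @ z # q2"] successively_split[of ?R' "x # p1" z q2]
      by (simp add: Q'_def)
    moreover have "distinct Q'" "hd Q' = u" "last Q' = v"
      using disj ends unfolding Q'_def by (auto simp: hd_append split: if_splits)
    ultimately have Q'path: "successively ?R' Q'" "distinct Q'" "hd Q' = u" "last Q' = v"
      by blast+
    have "g (\<alpha> @ x # p) - walk_sum a (\<alpha> @ x # p) = g Q' - walk_sum a Q'"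
      using less.hyps[of p2 "\<alpha> @ x # p1" z q2] less.prems Q'path by (simp add: p12(1) Q'_def)
    also have "\<dots> = g (\<alpha> @ x # q) - walk_sum a (\<alpha> @ x # q)"
    proof (cases "p1 = [] \<and> q1 = []")
      case True
      then show ?thesis by (simp add: q12 Q'_def)
    next
      case False
      \<comment> \<open>The third path runs from \<open>x\<close> back to \<open>u\<close>, across the edge \<open>uv\<close>, and back from \<open>v\<close> to \<open>z\<close>.\<close>
      define r where "r = rev \<alpha> @ rev q2"
      have cyc: "cycle_in R (\<alpha> @ w)" if "successively ?R' (\<alpha> @ w)" "distinct (\<alpha> @ w)"
        "hd (\<alpha> @ w) = u" "last (\<alpha> @ w) = v" "w \<noteq> []" for w
      proof -
        have ne: "u \<noteq> v" using R irrefl by metis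
        have "3 \<le> length (\<alpha> @ w)"
          using that ne uv by (intro long_path[of _ ?R']) auto
        then show ?thesis using that sub sym R unfolding cycle_in_def by (metis successively_mono sympD)
      qed
      have ne_short: "r \<noteq> [] \<or> p1 \<noteq> []" "r \<noteq> [] \<or> q1 \<noteq> []"
        using sP(2) sQ(1) ends uv by (auto simp: r_def)
      have sr: "successively R (x # r @ [z])"
      proof -
        have "successively ?R' (rev (\<alpha> @ [x]))" "successively ?R' (rev (z # q2))"
          using sP sQ by (metis successively_rev_sym sym')+
        moreover have "x # r @ [z] = rev (\<alpha> @ [x]) @ rev (z # q2)" by (simp add: r_def)
        moreover have "last (rev (\<alpha> @ [x])) = u" "hd (rev (z # q2)) = v"
          using ends by (simp_all only: last_rev hd_rev)
        ultimately show ?thesis using R sub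
          by (metis successively_append_iff successively_mono)
      qed
      have "g (x # p1 @ z # rev q1) + g (x # q1 @ z # rev r) = g (x # p1 @ z # rev r)"
        using disj sP sQ sr False ne_short
        by (intro theta) (auto simp: r_def intro: successively_mono[OF _ sub])
      moreover have "g (x # q1 @ z # rev r) = g (\<alpha> @ x # q)"
        using rotate[OF cyc[of "x # q"]] less.prems by (simp add: r_def q12)
      moreover have "g (x # p1 @ z # rev r) = g Q'"
        using rotate[OF cyc[of "x # p1 @ z # q2"]] Q'path by (simp add: r_def Q'_def)
      moreover have "g (x # p1 @ z # rev q1) = walk_sum a (x # p1 @ [z]) - walk_sum a (x # q1 @ [z])"
      proof -
        have "cycle_in ?R' (x # p1 @ z # rev q1)"
          using disj False sP(2) sQ(1) by (intro cycle_of_two_paths sym') auto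
        then have "g (x # p1 @ z # rev q1) = loop_sum a (x # p1 @ z # rev q1)" using a by simp
        also have "\<dots> = walk_sum a ((x # p1 @ z # rev q1) @ [x])"
          by (subst walk_sum_append) (auto simp: loop_sum_def)
        also have "\<dots> = walk_sum a (x # p1 @ [z]) + walk_sum a (rev (x # q1 @ [z]))"
          using walk_sum_split[of a "x # p1" z "rev q1 @ [x]"] by simp
        also have "\<dots> = walk_sum a (x # p1 @ [z]) - walk_sum a (x # q1 @ [z])"
          by (simp only: walk_sum_rev[OF anti]) simp
        finally show ?thesis .
      qed
      moreover have "walk_sum a (\<alpha> @ x # s @ z # q2) = walk_sum a (\<alpha> @ [x]) + walk_sum a (x # s @ [z]) + walk_sum a (z # q2)" for s
        using walk_sum_split[of a \<alpha> x "s @ z # q2"] walk_sum_split[of a "x # s" z q2] by (simp add: add.assoc)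
      ultimately show ?thesis
        by (simp add: Q'_def q12 algebra_simps)
    qed
    finally show ?thesis .
  qed
qed

end

text \<open>Induction on the number of edges: a cochain for the graph without the edge \<open>uv\<close> extends to the whole
graph, the value on \<open>uv\<close> being dictated by any cycle through it; by \<open>reroute\<close> all of these cycles
agree.\<close>

theorem cycle_function_cochain:
  assumes "cycle_function R g" "finite {(x, y). R x y}"
  shows "\<exists>a. antisymmetric a \<and> (\<forall>vs. cycle_in R vs \<longrightarrow> loop_sum a vs = g vs)"
  using assms
proof (induction "card {(x, y). R x y}" arbitrary: R rule: less_induct)
  case less
  interpret cycle_function R g by fact
  show ?case
  proof (cases "\<exists>u v. R u v")
    case False
    then show ?thesis by (intro exI[of _ "\<lambda>_ _. 0"]) (auto simp: cycle_in_def antisymmetric_def)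
  next
    case True
    then obtain u v where uv: "R u v" by blast
    then have ne: "u \<noteq> v" using irrefl by metis
    let ?R' = "remove_edge R u v"
    have sub: "{(x, y). ?R' x y} \<subset> {(x, y). R x y}"
      using uv by (auto simp: remove_edge_def)
    then obtain a where a: "antisymmetric a" "\<And>vs. cycle_in ?R' vs \<Longrightarrow> loop_sum a vs = g vs"
      using less.hyps[of ?R'] psubset_card_mono[OF less.prems(2) sub] remove_edge
        finite_subset[OF _ less.prems(2)] by blast
    define path where "path P \<longleftrightarrow> successively ?R' P \<and> distinct P \<and> hd P = u \<and> last P = v \<and> P \<noteq> []" for P
    have const: "g P - walk_sum a P = g Q - walk_sum a Q" if "path P" "path Q" for P Q
      using reroute[OF uv a, of "[]" u "tl P" "tl Q"] that
      by (cases P; cases Q) (auto simp: path_def)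
    \<comment> \<open>If no path joins \<open>u\<close> to \<open>v\<close>, then \<open>uv\<close> lies on no cycle and the value of \<open>c\<close> is arbitrary.\<close>
    define c where "c = (let P = SOME P. path P in g P - walk_sum a P)"
    have c: "g P - walk_sum a P = c" if "path P" for P
      unfolding c_def Let_def by (rule const[OF that someI[of path, OF that]])
    define a' where "a' x y = (if (x, y) = (v, u) then c else if (x, y) = (u, v) then - c else a x y)" for x y
    have "a x y + a y x = 0" for x y using a(1) by (metis antisymmetric_def eq_neg_iff_add_eq_0)
    then have "a' x y + a' y x = 0" for x y using ne by (simp add: a'_def)
    then have anti: "antisymmetric a'" unfolding antisymmetric_def eq_neg_iff_add_eq_0 by blast
    have same: "?R' x y \<Longrightarrow> a x y = a' x y" for x y
    proof -
      assume "?R' x y"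
      then have "(x, y) \<noteq> (v, u)" "(x, y) \<noteq> (u, v)" unfolding remove_edge_def by blast+
      then show "a x y = a' x y" unfolding a'_def by presburger
    qed
    have closed: "loop_sum a' P = g P" if "path P" for P
    proof -
      have P: "successively ?R' P" "hd P = u" "last P = v" using that by (auto simp: path_def)
      have "walk_sum a P = walk_sum a' P" using walk_sum_cong[OF P(1) same] .
      moreover have "a' v u = c" by (simp add: a'_def)
      ultimately show ?thesis using c[OF that] P(2,3) unfolding loop_sum_def
        by (metis add.commute diff_add_cancel)
    qed
    have "loop_sum a' w = g w" if w: "cycle_in R w" for w
    proof (cases "cycle_in ?R' w")
      case True
      then have "successively ?R' w" "?R' (last w) (hd w)" by (auto simp: cycle_in_def)
      then have "loop_sum a' w = loop_sum a w"
        unfolding loop_sum_def using walk_sum_cong[of ?R' w a a'] same by metis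
      then show ?thesis using a True by simp
    next
      case False
      obtain xs ys where d: "w = xs @ ys" "{last (ys @ xs), hd (ys @ xs)} = {u, v}"
        "successively ?R' (ys @ xs)"
        using cycle_through_edge[OF sym w False] by blast
      let ?P = "ys @ xs"
      have cP: "cycle_in R ?P" using w d cycle_in_rotate by blast
      have "loop_sum a' ?P = g ?P"
      proof (cases "last ?P = v")
        case True
        then have "path ?P" using d ne cP by (auto simp: path_def cycle_in_def doubleton_eq_iff)
        then show ?thesis by (rule closed)
      next
        case False
        then have e: "last ?P = u" "hd ?P = v" using d(2) ne by (auto simp: doubleton_eq_iff)
        have Pne: "?P \<noteq> []" using cP by (auto simp: cycle_in_def)
        have "path (rev ?P)" unfolding path_def
          using e d(3) cP successively_rev_sym[OF symp_remove_edge[OF sym]] Pne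
          by (metis cycle_in_def distinct_rev hd_rev last_rev rev_is_Nil_conv)
        then have "loop_sum a' (rev ?P) = g (rev ?P)" by (rule closed)
        then show ?thesis using loop_sum_rev[OF anti Pne] reverse[OF cP] by simp
      qed
      then show ?thesis using loop_sum_rotate[of a' xs ys] rotate w d(1) by metis
    qed
    then show ?thesis using anti by blast
  qed
qed

lemma rtranclp_distinct_path:
  assumes "R\<^sup>*\<^sup>* x y"
  shows "\<exists>P. P \<noteq> [] \<and> hd P = x \<and> last P = y \<and> distinct P \<and> successively R P"
  using assms
proof (induction rule: rtranclp_induct)
  case base
  then show ?case by (intro exI[of _ "[x]"]) simp
next
  case (step y z)
  then obtain P where P: "P \<noteq> []" "hd P = x" "last P = y" "distinct P" "successively R P"
    by blast
  show ?case
  proof (cases "z \<in> set P")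
    case True
    then obtain P1 P2 where d: "P = P1 @ z # P2" by (meson split_list)
    then have "successively R (P1 @ [z])" "hd (P1 @ [z]) = x" "distinct (P1 @ [z])"
      using P successively_split[of R P1 z P2] by (auto simp: hd_append)
    then show ?thesis by (intro exI[of _ "P1 @ [z]"]) simp
  next
    case False
    then show ?thesis using step.hyps P
      by (intro exI[of _ "P @ [z]"]) (simp add: successively_append_iff)
  qed
qed

text \<open>Induction on the number of edges again. Let \<open>f\<close> be a potential for the graph without the edge \<open>uv\<close>.
If a path joins \<open>u\<close> to \<open>v\<close>, the cycle that \<open>uv\<close> closes shows that \<open>f\<close> has the right difference on
\<open>uv\<close>. Otherwise \<open>f\<close> may be shifted by a constant on the component of \<open>u\<close>.\<close>

theorem zero_on_cycles_potential:
  assumes "symp R" "\<And>x. \<not> R x x" "finite {(x, y). R x y}" "antisymmetric a"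
    and "\<And>vs. cycle_in R vs \<Longrightarrow> loop_sum a vs = 0"
  shows "\<exists>f. \<forall>x y. R x y \<longrightarrow> a x y = f y - f x"
  using assms
proof (induction "card {(x, y). R x y}" arbitrary: R rule: less_induct)
  case less
  show ?case
  proof (cases "\<exists>u v. R u v")
    case False
    then show ?thesis by auto
  next
    case True
    then obtain u v where uv: "R u v" by blast
    then have ne: "u \<noteq> v" using less.prems(2) by metis
    let ?R' = "remove_edge R u v"
    have sub: "{(x, y). ?R' x y} \<subset> {(x, y). R x y}"
      using uv by (auto simp: remove_edge_def)
    have sym': "symp ?R'" by (rule symp_remove_edge[OF less.prems(1)])
    have "\<exists>f. \<forall>x y. ?R' x y \<longrightarrow> a x y = f y - f x"
    proof (rule less.hyps)
      show "card {(x, y). ?R' x y} < card {(x, y). R x y}" by (rule psubset_card_mono[OF less.prems(3) sub])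
      show "finite {(x, y). ?R' x y}" using sub less.prems(3) finite_subset by blast
      show "loop_sum a vs = 0" if "cycle_in ?R' vs" for vs
        using less.prems(5) cycle_in_mono[OF that, of R] by (simp add: remove_edge_def)
      show "\<not> ?R' x x" for x using less.prems(2) by (simp add: remove_edge_def)
    qed (fact sym' less.prems(4))+
    then obtain f where f: "\<And>x y. ?R' x y \<Longrightarrow> a x y = f y - f x" by blast
    have edge: "x = u \<and> y = v \<or> x = v \<and> y = u" if "R x y" "\<not> ?R' x y" for x y
      using that by (auto simp: remove_edge_def doubleton_eq_iff)
    have avu: "a v u = - a u v" using less.prems(4) by (metis antisymmetric_def)
    show ?thesis
    proof (cases "?R'\<^sup>*\<^sup>* u v")
      case True
      then obtain P where P: "P \<noteq> []" "hd P = u" "last P = v" "distinct P" "successively ?R' P"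
        using rtranclp_distinct_path by metis
      have "3 \<le> length P"
        using P ne by (intro long_path[of _ ?R']) (auto simp: remove_edge_def)
      then have "cycle_in R P" using P uv less.prems(1) unfolding cycle_in_def
        by (metis remove_edge_def successively_mono sympD)
      then have "loop_sum a P = 0" by (rule less.prems)
      moreover have "walk_sum a P = f v - f u"
        using walk_sum_cong[OF P(5), of a "\<lambda>x y. f y - f x"] f walk_sum_diff[OF P(1), of f] P by simp
      ultimately have "a u v = f v - f u" using P avu by (simp add: loop_sum_def)
      then have "\<forall>x y. R x y \<longrightarrow> a x y = f y - f x" using f edge avu by (metis minus_diff_eq)
      then show ?thesis by blast
    next
      case False
      define C where "C = {x. ?R'\<^sup>*\<^sup>* u x}"
      have C: "x \<in> C \<longleftrightarrow> y \<in> C" if "?R' x y" for x y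
        using that sym' unfolding C_def mem_Collect_eq by (meson rtranclp.rtrancl_into_rtrancl sympD)
      have uC: "u \<in> C" "v \<notin> C" using False by (auto simp: C_def)
      define f' where "f' x = (if x \<in> C then f x + (f v - f u - a u v) else f x)" for x
      have "a x y = f' y - f' x" if "R x y" for x y
      proof (cases "?R' x y")
        case True
        then show ?thesis using f C by (auto simp: f'_def)
      next
        case False
        then show ?thesis using edge[OF that] uC avu by (auto simp: f'_def)
      qed
      then show ?thesis by blast
    qed
  qed
qed

section \<open>Steps of vertex lists\<close>

definition steps :: "'v list \<Rightarrow> ('v \<times> 'v) set"
  where "steps vs = set (zip vs (tl vs))"

lemma steps_simps [simp]: "steps [] = {}" "steps [x] = {}" "steps (x # y # zs) = insert (x, y) (steps (y # zs))"
  by (simp_all add: steps_def)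

lemma steps_split: "steps (xs @ x # ys) = steps (xs @ [x]) \<union> steps (x # ys)"
  by (induction xs rule: induct_list012) auto

lemma steps_append: "xs \<noteq> [] \<Longrightarrow> ys \<noteq> [] \<Longrightarrow>
    steps (xs @ ys) = steps xs \<union> {(last xs, hd ys)} \<union> steps ys"
  by (induction xs rule: induct_list012) (auto simp: neq_Nil_conv)

lemma steps_rev: "steps (rev xs) = (steps xs)\<inverse>"
proof (induction xs rule: induct_list012)
  case (3 x y zs)
  then show ?case using steps_split[of "rev zs" y "[x]"] by auto
qed auto

lemma successively_steps: "successively R vs \<longleftrightarrow> (\<forall>(x, y)\<in>steps vs. R x y)"
  by (induction vs rule: induct_list012) auto

lemma steps_subset: "steps vs \<subseteq> set vs \<times> set vs"
  by (induction vs rule: induct_list012) auto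

lemma steps_nth: "steps vs = {(vs ! i, vs ! Suc i) |i. Suc i < length vs}"
  by (auto simp: steps_def set_zip nth_tl)

lemma cyclic_steps_eq:
  assumes "vs \<noteq> []"
  shows "cyclic_steps vs = insert (last vs, hd vs) (steps vs)"
proof -
  have last: "vs ! i = last vs \<and> vs ! (Suc i mod length vs) = hd vs" if "Suc i = length vs" for i
    using that assms by (simp add: last_conv_nth hd_conv_nth flip: that)
  show ?thesis
  proof (intro equalityI subsetI)
    fix e assume "e \<in> cyclic_steps vs"
    then obtain i where i: "i < length vs" "e = (vs ! i, vs ! (Suc i mod length vs))"
      by (auto simp: cyclic_steps_def)
    then show "e \<in> insert (last vs, hd vs) (steps vs)"
      using last[of i] by (cases "Suc i = length vs") (auto simp: steps_nth)
  next
    fix e assume "e \<in> insert (last vs, hd vs) (steps vs)"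
    then consider "e = (last vs, hd vs)" | i where "Suc i < length vs" "e = (vs ! i, vs ! Suc i)"
      by (auto simp: steps_nth)
    then show "e \<in> cyclic_steps vs"
    proof cases
      case 1
      then show ?thesis using last[of "length vs - 1"] assms unfolding cyclic_steps_def
        by (intro CollectI exI[of _ "length vs - 1"]) auto
    next
      case 2
      then show ?thesis unfolding cyclic_steps_def by (intro CollectI exI[of _ i]) auto
    qed
  qed
qed

lemma cyclic_steps_rotate: "cyclic_steps (xs @ ys) = cyclic_steps (ys @ xs)"
  by (cases "xs = [] \<or> ys = []") (auto simp: cyclic_steps_eq steps_append)

lemma cyclic_steps_rev: "cyclic_steps (rev vs) = (cyclic_steps vs)\<inverse>"
  by (cases "vs = []") (auto simp: cyclic_steps_eq steps_rev hd_rev last_rev cyclic_steps_def[of "[]"])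

lemma sum_steps:
  assumes "distinct vs" shows "(\<Sum>(x, y)\<in>steps vs. a x y) = walk_sum a vs"
  using assms
proof (induction vs rule: induct_list012)
  case (3 x y zs)
  have "(x, y) \<notin> steps (y # zs)" using 3(3) steps_subset[of "y # zs"] by auto
  moreover have "finite (steps (y # zs))" by (simp add: steps_def)
  ultimately show ?case using 3 by simp
qed auto

text \<open>Cycles have length at least 3, so the closing step differs from all others, and the sum over the
list is a sum over a set.\<close>

lemma sum_cyclic_steps:
  assumes "distinct vs" "3 \<le> length vs" shows "(\<Sum>(x, y)\<in>cyclic_steps vs. a x y) = loop_sum a vs"
proof -
  obtain x y z zs where vs: "vs = x # y # z # zs"
    using assms(2) by (auto simp: numeral_3_eq_3 Suc_le_length_iff)
  have "(last vs, hd vs) \<notin> steps vs"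
    using assms(1) vs steps_subset[of "y # z # zs"] last_in_set[of "z # zs"] by auto
  moreover have "finite (steps vs)" by (simp add: steps_def)
  ultimately have "(\<Sum>(x, y)\<in>insert (last vs, hd vs) (steps vs). a x y) = loop_sum a vs"
    by (simp add: loop_sum_def sum_steps[OF assms(1)] add.commute)
  then show ?thesis using vs cyclic_steps_eq[of vs] by simp
qed

section \<open>Walks in a drawn graph\<close>

definition adj :: "'v drawn_graph \<Rightarrow> 'v \<Rightarrow> 'v \<Rightarrow> bool"
  where "adj G x y \<longleftrightarrow> (x, y) \<in> edges G \<or> (y, x) \<in> edges G"

definition edge_path :: "'v drawn_graph \<Rightarrow> 'v \<Rightarrow> 'v \<Rightarrow> real \<Rightarrow> complex"
  where "edge_path G x y = (if (x, y) \<in> edges G then curve G (x, y) else reversepath (curve G (y, x)))"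

fun walk_path :: "'v drawn_graph \<Rightarrow> 'v list \<Rightarrow> real \<Rightarrow> complex" where
  "walk_path G [x, y] = edge_path G x y"
| "walk_path G (x # y # zs) = edge_path G x y +++ walk_path G (y # zs)"
| "walk_path G [x] = (\<lambda>_. pos G x)"
| "walk_path G [] = undefined"

text \<open>The image is defined from the steps alone and makes sense for every list; for walks it is the image
of \<open>walk_path\<close>, but it is empty for lists of length 1.\<close>

definition walk_image :: "'v drawn_graph \<Rightarrow> 'v list \<Rightarrow> complex set"
  where "walk_image G vs = (\<Union>(x, y)\<in>steps vs. path_image (edge_path G x y))"

locale plane_graph =
  fixes G :: "'v drawn_graph"
  assumes plane: "plane_bipartite_graph G"
begin

lemma finite_verts: "finite (whites G)" "finite (blacks G)" "finite (verts G)"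
  using plane by (auto simp: plane_bipartite_graph_def verts_def)

lemma disjoint_colours: "whites G \<inter> blacks G = {}"
  using plane by (auto simp: plane_bipartite_graph_def)

lemma edge_ends: "(b, w) \<in> edges G \<Longrightarrow> b \<in> blacks G \<and> w \<in> whites G"
  using plane by (auto simp: plane_bipartite_graph_def)

lemma edge_not_reversed: "(b, w) \<in> edges G \<Longrightarrow> (w, b) \<notin> edges G"
  using edge_ends disjoint_colours by blast

lemma finite_edges: "finite (edges G)"
  using plane finite_subset[of "edges G" "blacks G \<times> whites G"] by (auto simp: plane_bipartite_graph_def)

lemma symp_adj: "symp (adj G)"
  by (auto simp: symp_def adj_def)

lemma irrefl_adj: "\<not> adj G x x"
  using edge_ends disjoint_colours by (auto simp: adj_def)

lemma finite_adj: "finite {(x, y). adj G x y}"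
proof -
  have "{(x, y). adj G x y} = edges G \<union> (edges G)\<inverse>" by (auto simp: adj_def)
  then show ?thesis using finite_edges by simp
qed

lemma adj_colours: "adj G x y \<Longrightarrow> x \<in> whites G \<longleftrightarrow> y \<notin> whites G"
  using edge_ends disjoint_colours by (auto simp: adj_def)

lemma adj_verts: "adj G x y \<Longrightarrow> x \<in> verts G \<and> y \<in> verts G"
  using edge_ends by (auto simp: adj_def verts_def)

lemma pos_inj: "x \<in> verts G \<Longrightarrow> y \<in> verts G \<Longrightarrow> pos G x = pos G y \<longleftrightarrow> x = y"
  using plane by (auto simp: plane_bipartite_graph_def inj_on_def)

lemma curve_facts:
  assumes "e \<in> edges G"
  shows "arc (curve G e)" "pathstart (curve G e) = pos G (fst e)" "pathfinish (curve G e) = pos G (snd e)"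
    "path_image (curve G e) \<inter> pos G ` verts G = {pos G (fst e), pos G (snd e)}"
  using plane assms unfolding plane_bipartite_graph_def by blast+

lemma edge_path_facts:
  assumes "adj G x y"
  shows "arc (edge_path G x y)" "pathstart (edge_path G x y) = pos G x" "pathfinish (edge_path G x y) = pos G y"
    "path_image (edge_path G x y) \<inter> pos G ` verts G = {pos G x, pos G y}"
  using assms curve_facts[of "(x, y)"] curve_facts[of "(y, x)"]
  by (auto simp: adj_def edge_path_def arc_reversepath)

lemma edge_path_image_sym: "adj G x y \<Longrightarrow> path_image (edge_path G y x) = path_image (edge_path G x y)"
  using edge_not_reversed by (auto simp: edge_path_def adj_def)

lemma edge_paths_meet:
  assumes "adj G x y" "adj G x' y'" "{x, y} \<noteq> {x', y'}"
  shows "path_image (edge_path G x y) \<inter> path_image (edge_path G x' y') \<subseteq> pos G ` ({x, y} \<inter> {x', y'})"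
proof -
  define e e' where e: "e = (if (x, y) \<in> edges G then (x, y) else (y, x))"
    "e' = (if (x', y') \<in> edges G then (x', y') else (y', x'))"
  have "e \<in> edges G" "e' \<in> edges G" "e \<noteq> e'" using assms by (auto simp: e adj_def)
  then have "path_image (curve G e) \<inter> path_image (curve G e') \<subseteq> pos G ` ({fst e, snd e} \<inter> {fst e', snd e'})"
    using plane unfolding plane_bipartite_graph_def by blast
  moreover have "path_image (edge_path G x y) = path_image (curve G e)" "{fst e, snd e} = {x, y}"
    "path_image (edge_path G x' y') = path_image (curve G e')" "{fst e', snd e'} = {x', y'}"
    by (auto simp: e edge_path_def)
  ultimately show ?thesis by simp
qed

lemma walk_images_meet:
  assumes "successively (adj G) vs" "successively (adj G) ws"
    and "\<And>x y x' y'. (x, y) \<in> steps vs \<Longrightarrow> (x', y') \<in> steps ws \<Longrightarrow> {x, y} \<noteq> {x', y'}"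
  shows "walk_image G vs \<inter> walk_image G ws \<subseteq> pos G ` (set vs \<inter> set ws)"
proof
  fix z assume "z \<in> walk_image G vs \<inter> walk_image G ws"
  then obtain x y x' y' where s: "(x, y) \<in> steps vs" "(x', y') \<in> steps ws"
    "z \<in> path_image (edge_path G x y)" "z \<in> path_image (edge_path G x' y')"
    unfolding walk_image_def by blast
  have a: "adj G x y" "adj G x' y'" using s assms by (auto simp: successively_steps)
  have "z \<in> pos G ` ({x, y} \<inter> {x', y'})"
    using edge_paths_meet[OF a assms(3)[OF s(1,2)]] s(3,4) by (rule subsetD[OF _ IntI])
  then show "z \<in> pos G ` (set vs \<inter> set ws)"
    using subsetD[OF steps_subset s(1)] subsetD[OF steps_subset s(2)] by auto
qed

lemma walk_images_disjoint:
  assumes "successively (adj G) vs" "successively (adj G) ws" "set vs \<inter> set ws = {}"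
  shows "walk_image G vs \<inter> walk_image G ws = {}"
proof -
  have "{x, y} \<noteq> {x', y'}" if "(x, y) \<in> steps vs" "(x', y') \<in> steps ws" for x y x' y'
  proof -
    have "x \<in> set vs" using subsetD[OF steps_subset that(1)] by simp
    then have "x \<notin> set ws" using assms(3) by (meson disjoint_iff)
    moreover have "{x', y'} \<subseteq> set ws" using subsetD[OF steps_subset that(2)] by simp
    ultimately show ?thesis by (metis insertI1 subsetD)
  qed
  then have "walk_image G vs \<inter> walk_image G ws \<subseteq> pos G ` (set vs \<inter> set ws)"
    by (rule walk_images_meet[OF assms(1,2)])
  then show ?thesis using assms(3) by simp
qed

lemma walk_image_verts:
  assumes "successively (adj G) vs" "v \<in> verts G" "pos G v \<in> walk_image G vs"
  shows "v \<in> set vs"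
proof -
  obtain x y where s: "(x, y) \<in> steps vs" "pos G v \<in> path_image (edge_path G x y)"
    using assms(3) by (auto simp: walk_image_def)
  have a: "adj G x y" using s assms by (auto simp: successively_steps)
  have "pos G v \<in> {pos G x, pos G y}" using edge_path_facts(4)[OF a] s assms(2) by blast
  then have "v = x \<or> v = y" using adj_verts[OF a] assms(2) pos_inj by auto
  then show ?thesis using steps_subset[of vs] s by auto
qed

lemma walk_path_arc:
  assumes "successively (adj G) vs" "distinct vs" "2 \<le> length vs"
  shows "arc (walk_path G vs) \<and> pathstart (walk_path G vs) = pos G (hd vs) \<and>
    pathfinish (walk_path G vs) = pos G (last vs) \<and> path_image (walk_path G vs) = walk_image G vs"
  using assms
proof (induction vs rule: induct_list012)
  case (3 x y zs)
  have a: "adj G x y" using 3(3) by simp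
  show ?case
  proof (cases zs)
    case Nil
    then show ?thesis using edge_path_facts[OF a] by (simp add: walk_image_def)
  next
    case (Cons z zs')
    have IH: "arc (walk_path G (y # zs))" "pathstart (walk_path G (y # zs)) = pos G y"
      "pathfinish (walk_path G (y # zs)) = pos G (last zs)"
      "path_image (walk_path G (y # zs)) = walk_image G (y # zs)"
      using 3 Cons by auto
    have "walk_image G [x, y] \<inter> walk_image G (y # zs) \<subseteq> pos G ` (set [x, y] \<inter> set (y # zs))"
      using 3 steps_subset[of "y # zs"] by (intro walk_images_meet) (auto simp: doubleton_eq_iff)
    then have "path_image (edge_path G x y) \<inter> walk_image G (y # zs) \<subseteq> {pos G y}"
      using 3 by (auto simp: walk_image_def)
    then have "arc (edge_path G x y +++ walk_path G (y # zs))"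
      using IH edge_path_facts[OF a] by (intro arc_join) auto
    then show ?thesis
      using IH edge_path_facts[OF a] Cons by (auto simp: path_image_join walk_image_def)
  qed
qed auto

lemma walk_image_verts_eq:
  assumes "successively (adj G) vs" "2 \<le> length vs" "v \<in> set vs"
  shows "pos G v \<in> walk_image G vs"
  using assms
proof (induction vs rule: induct_list012)
  case (3 x y zs)
  have a: "adj G x y" using 3(3) by simp
  then have *: "pos G x \<in> path_image (edge_path G x y)" "pos G y \<in> path_image (edge_path G x y)"
    using edge_path_facts[OF a] by auto
  show ?case
  proof (cases "v = x \<or> v = y")
    case True
    then show ?thesis using * by (auto simp: walk_image_def)
  next
    case False
    then have "2 \<le> length (y # zs)" "v \<in> set (y # zs)" using 3 by (cases zs; auto)+
    then show ?thesis using 3 by (auto simp: walk_image_def)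
  qed
qed auto

lemma walk_verts:
  assumes "successively (adj G) vs" "2 \<le> length vs"
  shows "set vs \<subseteq> verts G"
  using assms
proof (induction vs rule: induct_list012)
  case (3 x y zs)
  then show ?case using adj_verts[of x y] by (cases zs) auto
qed auto

lemma walk_length_parity:
  assumes "successively (adj G) vs" "vs \<noteq> []"
  shows "odd (length vs) \<longleftrightarrow> (hd vs \<in> whites G \<longleftrightarrow> last vs \<in> whites G)"
  using assms
proof (induction vs rule: induct_list012)
  case (3 x y zs)
  then show ?case using adj_colours[of x y] by auto
qed auto

lemma is_cycle_iff: "is_cycle G vs \<longleftrightarrow> cycle_in (adj G) vs"
proof (cases "vs = []")
  case False
  have "cyclic_steps vs \<subseteq> edges G \<union> (edges G)\<inverse> \<longleftrightarrow> successively (adj G) vs \<and> adj G (last vs) (hd vs)"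
    unfolding cyclic_steps_eq[OF False] successively_steps by (auto simp: adj_def)
  then show ?thesis by (auto simp: is_cycle_def cycle_in_def)
qed (auto simp: is_cycle_def cycle_in_def)

lemma cycle_image_eq:
  assumes "cycle_in (adj G) vs"
  shows "cycle_image G vs = walk_image G vs \<union> path_image (edge_path G (last vs) (hd vs))"
proof -
  have ne: "vs \<noteq> []" using assms by (auto simp: cycle_in_def)
  have adj: "adj G x y" if "(x, y) \<in> cyclic_steps vs" for x y
    using that assms by (auto simp: cyclic_steps_eq[OF ne] cycle_in_def successively_steps)
  have "cycle_image G vs = (\<Union>(x, y)\<in>cyclic_steps vs. path_image (edge_path G x y))"
  proof (intro equalityI subsetI)
    fix z assume "z \<in> cycle_image G vs"
    then obtain b w where e: "(b, w) \<in> edges G" "(b, w) \<in> cyclic_steps vs \<or> (w, b) \<in> cyclic_steps vs"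
      "z \<in> path_image (curve G (b, w))" by (auto simp: cycle_image_def)
    then have "z \<in> path_image (edge_path G b w)" "z \<in> path_image (edge_path G w b)"
      using edge_not_reversed by (auto simp: edge_path_def)
    then show "z \<in> (\<Union>(x, y)\<in>cyclic_steps vs. path_image (edge_path G x y))" using e by blast
  next
    fix z assume "z \<in> (\<Union>(x, y)\<in>cyclic_steps vs. path_image (edge_path G x y))"
    then obtain x y where s: "(x, y) \<in> cyclic_steps vs" "z \<in> path_image (edge_path G x y)" by blast
    then show "z \<in> cycle_image G vs"
      using adj[OF s(1)] by (fastforce simp: cycle_image_def adj_def edge_path_def split: if_splits)
  qed
  then show ?thesis by (auto simp: cyclic_steps_eq[OF ne] walk_image_def)
qed

lemma walk_image_rev: "successively (adj G) vs \<Longrightarrow> walk_image G (rev vs) = walk_image G vs"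
  unfolding walk_image_def steps_rev successively_steps using edge_path_image_sym by fastforce

lemma walk_image_split: "walk_image G (xs @ x # ys) = walk_image G (xs @ [x]) \<union> walk_image G (x # ys)"
  unfolding walk_image_def steps_split[of xs x ys] by blast

text \<open>Count the pairs of a vertex and a cycle around it. A vertex off the theta graph is inside an even
number of the three cycles, by \<open>parity\<close>. A vertex in the interior of one of the paths lies on two of
the cycles, and all such vertices of one path are on the same side of the third cycle, the inner
side for exactly one of the three paths. Since the paths have the same ends in a bipartite graph, the
numbers of their interior vertices have the same parity, so it does not matter which path is the
inner one.\<close>

lemma theta_interior_parity:
  assumes dist: "distinct (x # y # p @ q @ r)"
    and walks: "successively (adj G) (x # p @ [y])" "successively (adj G) (x # q @ [y])"
      "successively (adj G) (x # r @ [y])"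
    and short: "p \<noteq> [] \<or> q \<noteq> []" "p \<noteq> [] \<or> r \<noteq> []" "q \<noteq> [] \<or> r \<noteq> []"
  shows "even (length p) \<longleftrightarrow> even (length q)" "even (length p) \<longleftrightarrow> even (length r)"
    and "even (interior_count G (x # p @ y # rev q) + interior_count G (x # q @ y # rev r) +
      interior_count G (x # p @ y # rev r)) \<longleftrightarrow> even (length p)"
proof -
  let ?c = "\<lambda>p. walk_path G (x # p @ [y])"
  let ?w = "\<lambda>p. walk_image G (x # p @ [y])"
  have arcp: "arc (?c p)" "pathstart (?c p) = pos G x" "pathfinish (?c p) = pos G y" "path_image (?c p) = ?w p"
    if "successively (adj G) (x # p @ [y])" "distinct (x # y # p)" for p
    using walk_path_arc[OF that(1)] that(2) by auto
  have xy: "x \<in> verts G" "y \<in> verts G" "x \<noteq> y"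
    using walk_verts[OF walks(1)] dist by auto
  \<comment> \<open>Only a path that consists of a single edge has a step that joins \<open>x\<close> and \<open>y\<close>.\<close>
  have no_xy: "p = []" if "(s, t) \<in> steps (x # p @ [y])" "{s, t} = {x, y}" "distinct (x # y # p)" for s t p
  proof (rule ccontr)
    assume "p \<noteq> []"
    then obtain u p' where p: "p = u # p'" by (cases p) auto
    have "steps (x # p @ [y]) = insert (x, u) (steps (p @ [y]))" by (simp add: p)
    moreover have "steps (p @ [y]) = steps p \<union> {(last p, y)}" using steps_append[of p "[y]"] \<open>p \<noteq> []\<close> by simp
    ultimately show False
      using that p steps_subset[of p] last_in_set[OF \<open>p \<noteq> []\<close>] by (auto simp: doubleton_eq_iff)
  qed
  have meet: "?w p \<inter> ?w q \<subseteq> {pos G x, pos G y}"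
    if "successively (adj G) (x # p @ [y])" "successively (adj G) (x # q @ [y])"
      "distinct (x # y # p @ q)" "p \<noteq> [] \<or> q \<noteq> []" for p q
  proof -
    have "?w p \<inter> ?w q \<subseteq> pos G ` (set (x # p @ [y]) \<inter> set (x # q @ [y]))"
    proof (rule walk_images_meet)
      fix s t s' t' assume st: "(s, t) \<in> steps (x # p @ [y])" "(s', t') \<in> steps (x # q @ [y])"
      show "{s, t} \<noteq> {s', t'}"
      proof
        assume eq: "{s, t} = {s', t'}"
        have "{s, t} \<subseteq> set (x # p @ [y])" "{s', t'} \<subseteq> set (x # q @ [y])"
          using subsetD[OF steps_subset st(1)] subsetD[OF steps_subset st(2)] by auto
        then have "{s, t} \<subseteq> set (x # p @ [y])" "{s, t} \<subseteq> set (x # q @ [y])"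
          unfolding eq by simp_all
        then have "{s, t} \<subseteq> {x, y}" using that(3) by auto
        moreover have "s \<noteq> t" using st(1) that(1) irrefl_adj by (auto simp: successively_steps)
        ultimately have "{s, t} = {x, y}" by auto
        then show False using no_xy[OF st(1)] no_xy[OF st(2)] eq that by auto
      qed
    qed (use that in auto)
    then show ?thesis using that(3) by auto
  qed
  have d: "distinct (x # y # p)" "distinct (x # y # q)" "distinct (x # y # r)"
    "distinct (x # y # p @ q)" "distinct (x # y # p @ r)" "distinct (x # y # q @ r)"
    using dist by auto
  note arc_p = arcp[OF walks(1) d(1)] and arc_q = arcp[OF walks(2) d(2)] and arc_r = arcp[OF walks(3) d(3)]
  note im = arc_p(4) arc_q(4) arc_r(4)
  interpret theta "?c p" "?c q" "?c r" "pos G x" "pos G y"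
    unfolding theta_def im using arc_p(1-3) arc_q(1-3) arc_r(1-3)
      meet[OF walks(1,2) d(4) short(1)] meet[OF walks(1,3) d(5) short(2)] meet[OF walks(2,3) d(6) short(3)]
    by blast
  have par: "even (length p) \<longleftrightarrow> (x \<in> whites G \<longleftrightarrow> y \<notin> whites G)"
    if "successively (adj G) (x # p @ [y])" for p
    using walk_length_parity[OF that] by auto
  show e1: "even (length p) \<longleftrightarrow> even (length q)" and e2: "even (length p) \<longleftrightarrow> even (length r)"
    using par[OF walks(1)] par[OF walks(2)] par[OF walks(3)] by simp_all
  define I where "I = (\<lambda>p q. inside (?w p \<union> ?w q))"
  have count: "interior_count G (x # p @ y # rev q) = (\<Sum>v\<in>verts G. of_bool (pos G v \<in> I p q))"
    if w: "successively (adj G) (x # p @ [y])" "successively (adj G) (x # q @ [y])"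
      and d: "distinct (x # y # p @ q)" "p \<noteq> [] \<or> q \<noteq> []" for p q
  proof -
    have cyc: "cycle_in (adj G) (x # p @ y # rev q)"
      using w d by (intro cycle_of_two_paths symp_adj)
    have "cycle_image G (x # p @ y # rev q) = walk_image G (x # p @ y # rev q) \<union> path_image (edge_path G (last (y # rev q)) x)"
      using cycle_image_eq[OF cyc] by simp
    also have "\<dots> = walk_image G ((x # p @ y # rev q) @ [x])"
    proof -
      have "steps ((x # p @ y # rev q) @ [x]) = insert (last (y # rev q), x) (steps (x # p @ y # rev q))"
        by (subst steps_append) simp_all
      then show ?thesis unfolding walk_image_def by auto
    qed
    also have "\<dots> = ?w p \<union> walk_image G (rev (x # q @ [y]))"
      using walk_image_split[of "x # p" y "rev q @ [x]"] by simp
    also have "\<dots> = ?w p \<union> ?w q" using walk_image_rev[OF w(2)] by simp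
    finally show ?thesis using finite_verts(3)
      by (simp add: interior_count_def I_def sum.inter_filter[symmetric] of_bool_def)
  qed
  \<comment> \<open>Points of the open arcs; they exist even for a path without interior vertices.\<close>
  obtain x1 x2 x3 where z: "x1 \<in> ?w p - {pos G x, pos G y}" "x2 \<in> ?w q - {pos G x, pos G y}"
    "x3 \<in> ?w r - {pos G x, pos G y}"
    using nonempty_simple_path_endless[of "?c p"] nonempty_simple_path_endless[of "?c q"]
      nonempty_simple_path_endless[of "?c r"] arcs starts finishes im
    by (auto simp: arc_imp_simple_path)
  have one: "z3 \<in> I p q \<longleftrightarrow> (z1 \<in> I q r \<longleftrightarrow> z2 \<in> I p r)"
    if "z1 \<in> ?w p - {pos G x, pos G y}" "z2 \<in> ?w q - {pos G x, pos G y}" "z3 \<in> ?w r - {pos G x, pos G y}"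
    for z1 z2 z3
    using exactly_one_inside[of z1 z2 z3] that unfolding im I_def by blast
  have on: "pos G v \<in> ?w p - {pos G x, pos G y}"
    if "v \<in> set p" "successively (adj G) (x # p @ [y])" "distinct (x # y # p)" for v p
  proof -
    have "pos G v \<in> ?w p" using walk_image_verts_eq[OF that(2)] that(1) by simp
    moreover have "v \<in> verts G" using walk_verts[OF that(2)] that(1) by auto
    ultimately show ?thesis using pos_inj xy that by auto
  qed
  note on_p = on[of _ p, OF _ walks(1) d(1)] and on_q = on[of _ q, OF _ walks(2) d(2)] and on_r = on[of _ r, OF _ walks(3) d(3)]
  have notin: "z \<notin> I p q" if "z \<in> ?w p \<or> z \<in> ?w q" for z p q
    using that inside_no_overlap[of "?w p \<union> ?w q"] unfolding I_def by blast
  define F :: "'v \<Rightarrow> nat" where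
    "F v = of_bool (pos G v \<in> I p q) + of_bool (pos G v \<in> I q r) + of_bool (pos G v \<in> I p r)" for v
  let ?T = "{x, y} \<union> set p \<union> set q \<union> set r"
  have T: "?T \<subseteq> verts G"
    using walk_verts[OF walks(1)] walk_verts[OF walks(2)] walk_verts[OF walks(3)] by auto
  have "interior_count G (x # p @ y # rev q) + interior_count G (x # q @ y # rev r) +
      interior_count G (x # p @ y # rev r) = sum F (verts G)"
    using count[OF walks(1,2) d(4) short(1)] count[OF walks(2,3) d(6) short(3)] count[OF walks(1,3) d(5) short(2)]
    by (simp add: F_def sum.distrib)
  also have "\<dots> = sum F (verts G - ?T) + sum F ?T"
    using T finite_verts(3) sum.subset_diff by blast
  also have "sum F ?T = sum F {x, y} + sum F (set p) + sum F (set q) + sum F (set r)"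
    using dist by (subst sum.union_disjoint, simp, simp, force)+ simp
  also have "sum F {x, y} = 0"
  proof -
    have "pos G x \<in> ?w p \<and> pos G y \<in> ?w p" if "successively (adj G) (x # p @ [y])" for p
      using walk_image_verts_eq[OF that] by simp
    then show ?thesis using notin walks by (auto simp: F_def)
  qed
  also have "sum F (set p) = length p * of_bool (x1 \<in> I q r)"
  proof -
    have "F v = of_bool (x1 \<in> I q r)" if "v \<in> set p" for v
      using on_p[OF that] one[OF on_p[OF that] z(2,3)] one[OF z] notin[of "pos G v" p q] notin[of "pos G v" p r]
      unfolding F_def by auto
    then show ?thesis using dist by (simp add: distinct_card)
  qed
  also have "sum F (set q) = length q * of_bool (x2 \<in> I p r)"
  proof -
    have "F v = of_bool (x2 \<in> I p r)" if "v \<in> set q" for v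
      using on_q[OF that] one[OF z(1) on_q[OF that] z(3)] one[OF z] notin[of "pos G v" p q] notin[of "pos G v" q r]
      unfolding F_def by auto
    then show ?thesis using dist by (simp add: distinct_card)
  qed
  also have "sum F (set r) = length r * of_bool (x3 \<in> I p q)"
  proof -
    have "F v = of_bool (x3 \<in> I p q)" if "v \<in> set r" for v
      using on_r[OF that] one[OF z(1,2) on_r[OF that]] one[OF z] notin[of "pos G v" p r] notin[of "pos G v" q r]
      unfolding F_def by auto
    then show ?thesis using dist by (simp add: distinct_card)
  qed
  finally have total: "interior_count G (x # p @ y # rev q) + interior_count G (x # q @ y # rev r) +
      interior_count G (x # p @ y # rev r) = sum F (verts G - ?T) + (0 + length p * of_bool (x1 \<in> I q r) +
      length q * of_bool (x2 \<in> I p r) + length r * of_bool (x3 \<in> I p q))" .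
  have "even (sum F (verts G - ?T))"
  proof (rule dvd_sum)
    fix v assume v: "v \<in> verts G - ?T"
    have "pos G v \<notin> ?w p" if "successively (adj G) (x # p @ [y])" "set p \<subseteq> ?T" for p
      using walk_image_verts[OF that(1), of v] v that(2) by auto
    then have "pos G v \<notin> ?w p" "pos G v \<notin> ?w q" "pos G v \<notin> ?w r" using walks by auto
    then show "even (F v)" using parity[of "pos G v"] unfolding im F_def I_def by simp
  qed
  then show "even (interior_count G (x # p @ y # rev q) + interior_count G (x # q @ y # rev r) +
      interior_count G (x # p @ y # rev r)) \<longleftrightarrow> even (length p)"
    unfolding total using one[OF z] e1 e2 by auto
qed

end

section \<open>Cohomology classes and cycles\<close>

lemma int_scale_simps [simp]: "int_scale 0 x = 0" "int_scale 1 x = x" "int_scale (- 1) x = - x"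
  by (simp_all add: int_scale_def)

lemma int_scale_add: "int_scale k (x + y) = int_scale k x + int_scale k y"
  by (simp add: int_scale_def sum.distrib algebra_simps)

lemma equiv_cohomologous:
  "equiv UNIV (cohomologous (G :: 'v drawn_graph) :: (('v, 'c::ab_group_add) cochain) rel)"
proof (rule equivI)
  let ?coh = "cohomologous G :: (('v, 'c) cochain) rel"
  show "?coh \<subseteq> UNIV \<times> UNIV" by simp
  show "refl ?coh"
    by (rule refl_onI) (auto simp: cohomologous_def intro: exI[of _ "\<lambda>_. 0"])
  show "sym ?coh"
  proof (rule symI)
    fix A B :: "('v, 'c) cochain" assume "(A, B) \<in> cohomologous G"
    then obtain f where f: "\<forall>(b, w)\<in>edges G. B (b, w) - A (b, w) = f w - f b"
      by (auto simp: cohomologous_def)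
    have "\<forall>(b, w)\<in>edges G. A (b, w) - B (b, w) = (- f w) - (- f b)"
      using f by (auto simp: algebra_simps)
    then show "(B, A) \<in> cohomologous G"
      by (auto simp: cohomologous_def intro!: exI[of _ "\<lambda>v. - f v"])
  qed
  show "trans ?coh"
  proof (rule transI)
    fix A B C :: "('v, 'c) cochain" assume "(A, B) \<in> cohomologous G" "(B, C) \<in> cohomologous G"
    then obtain f g where f: "\<forall>(b, w)\<in>edges G. B (b, w) - A (b, w) = f w - f b"
      and g: "\<forall>(b, w)\<in>edges G. C (b, w) - B (b, w) = g w - g b"
      by (auto simp: cohomologous_def)
    have "\<forall>(b, w)\<in>edges G. C (b, w) - A (b, w) = (f w + g w) - (f b + g b)"
    proof clarify
      fix b w assume e: "(b, w) \<in> edges G"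
      have "C (b, w) - A (b, w) = (B (b, w) - A (b, w)) + (C (b, w) - B (b, w))" by simp
      also have "\<dots> = (f w - f b) + (g w - g b)" using bspec[OF f e] bspec[OF g e] by simp
      finally show "C (b, w) - A (b, w) = (f w + g w) - (f b + g b)" by (simp add: algebra_simps)
    qed
    then show "(A, C) \<in> cohomologous G"
      by (auto simp: cohomologous_def intro!: exI[of _ "\<lambda>v. f v + g v"])
  qed
qed

abbreviation cohomology_class :: "'v drawn_graph \<Rightarrow> ('v, 'c::ab_group_add) cochain \<Rightarrow> ('v, 'c) cochain set"
  where "cohomology_class G A \<equiv> cohomologous G `` {A}"

lemma class_eq_iff: "cohomology_class G A = cohomology_class G B \<longleftrightarrow> (A, B) \<in> cohomologous G"
  using eq_equiv_class_iff[OF equiv_cohomologous] by blast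

lemma class_self: "A \<in> cohomology_class G A"
  using equiv_class_self[OF equiv_cohomologous] by blast

text \<open>The images of classes in \<open>H1_restrict\<close>, \<open>H1_half\<close> and \<open>matrix_class\<close> all arise from sets of
cochains that are pairwise cohomologous, hence are the class of any one of them.\<close>

lemma image_class: "cohomologous H `` X = cohomology_class H A"
  if "A \<in> X" "\<And>B. B \<in> X \<Longrightarrow> (A, B) \<in> cohomologous H"
proof -
  have "sym (cohomologous H)" "trans (cohomologous H)"
    using equiv_cohomologous unfolding equiv_def by blast+
  then show ?thesis using that by (auto dest: symD transD)
qed

text \<open>The evaluation of a cochain on a chain, before passing to classes.\<close>

definition pairing :: "'v drawn_graph \<Rightarrow> 'v chain \<Rightarrow> ('v, 'c::ab_group_add) cochain \<Rightarrow> 'c"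
  where "pairing G z A = (\<Sum>e\<in>edges G. int_scale (z e) (A e))"

lemma H1_eval_class:
  fixes A :: "('v, 'c::ab_group_add) cochain"
  assumes closed: "\<And>f. pairing G z (\<lambda>(b, w). f w - f b) = (0 :: 'c)"
  shows "H1_eval G (cohomology_class G A) z = pairing G z A"
proof -
  have "pairing G z B = pairing G z A" if "B \<in> cohomology_class G A" for B
  proof -
    obtain f where f: "\<forall>(b, w)\<in>edges G. B (b, w) - A (b, w) = f w - f b"
      using \<open>B \<in> _\<close> by (auto simp: cohomologous_def)
    have "pairing G z B = (\<Sum>e\<in>edges G. int_scale (z e) (A e) + int_scale (z e) (case e of (b, w) \<Rightarrow> f w - f b))"
      unfolding pairing_def
    proof (rule sum.cong[OF refl])
      fix e assume "e \<in> edges G"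
      then have "B e = A e + (case e of (b, w) \<Rightarrow> f w - f b)"
        using f by (cases e) (auto simp: algebra_simps)
      then show "int_scale (z e) (B e) = int_scale (z e) (A e) + int_scale (z e) (case e of (b, w) \<Rightarrow> f w - f b)"
        by (simp add: int_scale_add)
    qed
    also have "\<dots> = pairing G z A + pairing G z (\<lambda>(b, w). f w - f b)"
      by (simp add: pairing_def sum.distrib)
    finally show ?thesis using closed by simp
  qed
  then show ?thesis
    unfolding H1_eval_def pairing_def[symmetric] using class_self
    by (intro the_equality) auto
qed

text \<open>A cochain is given on edges oriented from black to white; this is its antisymmetric extension to
steps in both directions.\<close>

definition oriented :: "'v drawn_graph \<Rightarrow> ('v, 'c::ab_group_add) cochain \<Rightarrow> 'v \<Rightarrow> 'v \<Rightarrow> 'c"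
  where "oriented G A x y =
    (if (x, y) \<in> edges G then A (x, y) else if (y, x) \<in> edges G then - A (y, x) else 0)"

lemma loop_sum_coboundary: "vs \<noteq> [] \<Longrightarrow> loop_sum (\<lambda>x y. f y - f x) vs = 0"
  by (simp add: loop_sum_def walk_sum_diff)

lemma loop_sum_cong:
  assumes "cycle_in R vs" "\<And>x y. R x y \<Longrightarrow> a x y = b x y"
  shows "loop_sum a vs = loop_sum b vs"
proof -
  have "walk_sum a vs = walk_sum b vs" using assms by (auto simp: cycle_in_def intro: walk_sum_cong)
  moreover have "a (last vs) (hd vs) = b (last vs) (hd vs)" using assms by (auto simp: cycle_in_def)
  ultimately show ?thesis by (simp add: loop_sum_def)
qed

lemma walk_sum_minus: "walk_sum (\<lambda>x y. a x y - b x y) vs = walk_sum a vs - walk_sum b vs"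
  by (induction a vs rule: walk_sum.induct) (auto simp: algebra_simps)

lemma loop_sum_minus: "loop_sum (\<lambda>x y. a x y - b x y) vs = loop_sum a vs - loop_sum b vs"
  by (simp add: loop_sum_def walk_sum_minus algebra_simps)

section \<open>The Kasteleyn class\<close>

definition kasteleyn_value :: "'v drawn_graph \<Rightarrow> 'v list \<Rightarrow> bit"
  where "kasteleyn_value G vs = of_nat (interior_count G vs + length vs div 2 + 1)"

text \<open>Representatives of the Kasteleyn class.\<close>

definition kasteleyn_cochain :: "'v drawn_graph \<Rightarrow> ('v, bit) cochain \<Rightarrow> bool"
  where "kasteleyn_cochain G A \<longleftrightarrow>
    (\<forall>vs. cycle_in (adj G) vs \<longrightarrow> loop_sum (oriented G A) vs = kasteleyn_value G vs)"

lemma of_nat_bit: "(of_nat n :: bit) = of_bool (odd n)"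
  by (induction n) auto

context plane_graph
begin

lemma antisymmetric_oriented: "antisymmetric (oriented G A)"
  using edge_not_reversed by (auto simp: antisymmetric_def oriented_def)

lemma oriented_coboundary: "adj G x y \<Longrightarrow> oriented G (\<lambda>(b, w). f w - f b) x y = f y - f x"
  by (auto simp: oriented_def adj_def)

lemma pairing_cycle:
  assumes "cycle_in (adj G) vs"
  shows "pairing G (cycle_chain vs) A = loop_sum (oriented G A) vs"
proof -
  let ?C = "cyclic_steps vs"
  have vs: "distinct vs" "3 \<le> length vs" using assms by (auto simp: cycle_in_def)
  have ne: "vs \<noteq> []" using vs by auto
  have C: "?C \<subseteq> edges G \<union> (edges G)\<inverse>" using assms is_cycle_iff is_cycle_def by metis
  have finC: "finite ?C" by (simp add: cyclic_steps_eq[OF ne] steps_def)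
  have "loop_sum (oriented G A) vs = (\<Sum>(x, y)\<in>?C. oriented G A x y)"
    using sum_cyclic_steps[OF vs, of "oriented G A"] by simp
  also have "?C = (?C \<inter> edges G) \<union> (?C \<inter> (edges G)\<inverse>)" using C by auto
  also have "(\<Sum>(x, y)\<in>\<dots>. oriented G A x y) =
      (\<Sum>(x, y)\<in>?C \<inter> edges G. oriented G A x y) + (\<Sum>(x, y)\<in>?C \<inter> (edges G)\<inverse>. oriented G A x y)"
    using finC edge_not_reversed by (intro sum.union_disjoint) auto
  also have "(\<Sum>(x, y)\<in>?C \<inter> edges G. oriented G A x y) = (\<Sum>e\<in>edges G \<inter> ?C. A e)"
    by (intro sum.cong) (auto simp: oriented_def)
  also have "\<dots> = (\<Sum>e\<in>edges G. if e \<in> ?C then A e else 0)"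
    using sum.inter_restrict[OF finite_edges] by blast
  also have "(\<Sum>(x, y)\<in>?C \<inter> (edges G)\<inverse>. oriented G A x y) = (\<Sum>e\<in>edges G \<inter> ?C\<inverse>. - A e)"
    using edge_not_reversed
    by (intro sum.reindex_bij_witness[of _ prod.swap prod.swap]) (auto simp: oriented_def)
  also have "\<dots> = (\<Sum>e\<in>edges G. if e \<in> ?C\<inverse> then - A e else 0)"
    using sum.inter_restrict[OF finite_edges] by blast
  also have "(\<Sum>e\<in>edges G. if e \<in> ?C then A e else 0) + (\<Sum>e\<in>edges G. if e \<in> ?C\<inverse> then - A e else 0)
      = (\<Sum>e\<in>edges G. int_scale (cycle_chain vs e) (A e))"
    unfolding sum.distrib[symmetric]
  proof (intro sum.cong refl)
    fix e assume "e \<in> edges G"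
    show "(if e \<in> ?C then A e else 0) + (if e \<in> ?C\<inverse> then - A e else 0) = int_scale (cycle_chain vs e) (A e)"
      by (cases e; cases "e \<in> ?C"; cases "e \<in> ?C\<inverse>") (simp_all add: cycle_chain_def)
  qed
  finally show ?thesis by (simp add: pairing_def)
qed

lemma H1_eval_cycle:
  fixes A :: "('v, 'c::ab_group_add) cochain"
  assumes "cycle_in (adj G) vs"
  shows "H1_eval G (cohomology_class G A) (cycle_chain vs) = loop_sum (oriented G A) vs"
proof -
  have ne: "vs \<noteq> []" using assms by (auto simp: cycle_in_def)
  have "pairing G (cycle_chain vs) (\<lambda>(b, w). f w - f b) = 0" for f :: "'v \<Rightarrow> 'c"
  proof -
    have "pairing G (cycle_chain vs) (\<lambda>(b, w). f w - f b) = loop_sum (\<lambda>x y. f y - f x) vs"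
      unfolding pairing_cycle[OF assms] by (rule loop_sum_cong[OF assms oriented_coboundary])
    then show ?thesis using loop_sum_coboundary[OF ne] by simp
  qed
  then show ?thesis using H1_eval_class pairing_cycle[OF assms] by metis
qed

text \<open>In a theta graph whose paths have \<open>p\<close>, \<open>q\<close> and \<open>r\<close> interior vertices, the half lengths of the three
cycles add up to \<open>p + q + r + 3\<close>, where \<open>p\<close>, \<open>q\<close> and \<open>r\<close> have the same parity. With the three
summands 1 and the interior vertices, whose number has the parity of \<open>p\<close>, the total is even.\<close>

lemma cycle_function_kasteleyn: "cycle_function (adj G) (kasteleyn_value G)"
proof
  show "symp (adj G)" by (rule symp_adj)
  show "\<not> adj G x x" for x by (rule irrefl_adj)
next
  fix xs ys :: "'v list"
  show "kasteleyn_value G (xs @ ys) = kasteleyn_value G (ys @ xs)"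
    by (simp only: kasteleyn_value_def interior_count_def cycle_image_def cyclic_steps_rotate[of xs ys]
        length_append add.commute)
next
  fix vs :: "'v list"
  have "cyclic_steps (rev vs) \<union> (cyclic_steps (rev vs))\<inverse> = cyclic_steps vs \<union> (cyclic_steps vs)\<inverse>"
    by (auto simp: cyclic_steps_rev)
  then have "interior_count G (rev vs) = interior_count G vs"
    by (simp only: interior_count_def cycle_image_def)
  then show "kasteleyn_value G (rev vs) = - kasteleyn_value G vs"
    by (simp add: kasteleyn_value_def)
next
  fix x y and p q r :: "'v list"
  assume "distinct (x # y # p @ q @ r)" "successively (adj G) (x # p @ [y])"
    "successively (adj G) (x # q @ [y])" "successively (adj G) (x # r @ [y])"
    "p \<noteq> [] \<or> q \<noteq> []" "p \<noteq> [] \<or> r \<noteq> []" "q \<noteq> [] \<or> r \<noteq> []"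
  note parity = theta_interior_parity[OF this]
  define i j k where ijk: "i = interior_count G (x # p @ y # rev q)" "j = interior_count G (x # q @ y # rev r)"
    "k = interior_count G (x # p @ y # rev r)"
  have sum: "even (i + j + k) \<longleftrightarrow> even (length p)" unfolding ijk by (rule parity(3))
  have half: "2 * ((length p + length q + 2) div 2) = length p + length q + 2"
    "2 * ((length q + length r + 2) div 2) = length q + length r + 2"
    "2 * ((length p + length r + 2) div 2) = length p + length r + 2"
    using parity(1,2) by auto
  define l m n where lmn: "l = (length p + length q + 2) div 2" "m = (length q + length r + 2) div 2"
    "n = (length p + length r + 2) div 2"
  have "l + m + n = length p + length q + length r + 3" using half unfolding lmn by linarith
  then have "even ((i + l + 1) + (j + m + 1) + (k + n + 1))"
    using sum parity(1,2) by presburger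
  then have "(of_nat (i + l + 1) + of_nat (j + m + 1) :: bit) = of_nat (k + n + 1)"
    unfolding of_nat_bit by auto
  then show "kasteleyn_value G (x # p @ y # rev q) + kasteleyn_value G (x # q @ y # rev r) =
      kasteleyn_value G (x # p @ y # rev r)"
    by (simp only: kasteleyn_value_def ijk lmn list.size length_append length_rev add_Suc_right add_Suc
        add_0_right add_0 numeral_2_eq_2)
qed

theorem kasteleyn_cochain_exists: "\<exists>A. kasteleyn_cochain G A"
proof -
  obtain a where a: "antisymmetric a" "\<And>vs. cycle_in (adj G) vs \<Longrightarrow> loop_sum a vs = kasteleyn_value G vs"
    using cycle_function_cochain[OF cycle_function_kasteleyn finite_adj] by blast
  have "oriented G (\<lambda>(b, w). a b w) x y = a x y" if "adj G x y" for x y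
  proof -
    have "a x y = - a y x" using a(1) unfolding antisymmetric_def by blast
    then show ?thesis using that unfolding adj_def oriented_def by auto
  qed
  then have "kasteleyn_cochain G (\<lambda>(b, w). a b w)"
    unfolding kasteleyn_cochain_def using a(2) loop_sum_cong by metis
  then show ?thesis by blast
qed

theorem kasteleyn_cochain_unique:
  assumes "kasteleyn_cochain G A" "kasteleyn_cochain G B"
  shows "(A, B) \<in> cohomologous G"
proof -
  let ?D = "\<lambda>e. B e - A e"
  have "loop_sum (oriented G ?D) vs = 0" if c: "cycle_in (adj G) vs" for vs
  proof -
    have "loop_sum (oriented G ?D) vs = loop_sum (\<lambda>x y. oriented G B x y - oriented G A x y) vs"
      by (rule loop_sum_cong[OF c]) (simp add: oriented_def)
    then show ?thesis using assms c unfolding kasteleyn_cochain_def loop_sum_minus by simp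
  qed
  then obtain f where f: "\<And>x y. adj G x y \<Longrightarrow> oriented G ?D x y = f y - f x"
    using zero_on_cycles_potential[OF symp_adj irrefl_adj finite_adj antisymmetric_oriented, of ?D] by blast
  have "B (b, w) - A (b, w) = f w - f b" if "(b, w) \<in> edges G" for b w
    using f[of b w] that by (simp add: adj_def oriented_def)
  then show ?thesis unfolding cohomologous_def by blast
qed

theorem kasteleyn_class_eq:
  assumes "kasteleyn_cochain G A"
  shows "kasteleyn_class G = cohomology_class G A"
  unfolding kasteleyn_class_def
proof (rule the_equality)
  show "cohomology_class G A \<in> H1 G \<and> (\<forall>vs. is_cycle G vs \<longrightarrow> H1_eval G (cohomology_class G A) (cycle_chain vs) =
      of_nat (interior_count G vs + length vs div 2 + 1))"
  proof
    show "cohomology_class G A \<in> H1 G" unfolding H1_def by (rule quotientI) simp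
    show "\<forall>vs. is_cycle G vs \<longrightarrow> H1_eval G (cohomology_class G A) (cycle_chain vs) =
        of_nat (interior_count G vs + length vs div 2 + 1)"
      using assms H1_eval_cycle unfolding kasteleyn_cochain_def kasteleyn_value_def is_cycle_iff by metis
  qed
next
  fix k :: "('v, bit) cochain set"
  assume k: "k \<in> H1 G \<and> (\<forall>vs. is_cycle G vs \<longrightarrow> H1_eval G k (cycle_chain vs) =
      of_nat (interior_count G vs + length vs div 2 + 1))"
  then obtain B where B: "k = cohomology_class G B" by (auto simp: H1_def quotient_def)
  have "kasteleyn_cochain G B"
    using k H1_eval_cycle unfolding B kasteleyn_cochain_def kasteleyn_value_def is_cycle_iff by metis
  then have "(B, A) \<in> cohomologous G" using kasteleyn_cochain_unique assms by blast
  then show "k = cohomology_class G A" unfolding B by (simp add: class_eq_iff)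
qed

end

section \<open>Signs of pairs of matchings\<close>

definition bit_sign :: "bit \<Rightarrow> int"
  where "bit_sign b = (if b = 0 then 1 else - 1)"

lemma bit_sign_add: "bit_sign (a + b) = bit_sign a * bit_sign b"
  by (cases a; cases b) (simp_all add: bit_sign_def)

lemma bit_sign_0 [simp]: "bit_sign 0 = 1"
  by (simp add: bit_sign_def)

lemma bit_sign_sum: "bit_sign (sum h S) = (\<Prod>x\<in>S. bit_sign (h x))"
  by (induction S rule: infinite_finite_induct) (simp_all add: bit_sign_add del: add_bit_eq_xor)

lemma bit_sign_of_nat: "bit_sign (of_nat n) = (- 1) ^ n"
  by (induction n) (simp_all add: bit_sign_add bit_sign_def[of 1] del: add_bit_eq_xor)

lemma sign_cycle_of_list: "distinct cs \<Longrightarrow> sign (cycle_of_list cs) = (- 1) ^ (length cs - 1)"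
proof (induction cs rule: cycle_of_list.induct)
  case (1 i j cs)
  have "sign (cycle_of_list (i # j # cs)) = sign (Transposition.transpose i j) * sign (cycle_of_list (j # cs))"
    unfolding cycle_of_list.simps(1) by (rule sign_compose[OF permutation_swap_id permutation_of_cycle])
  also have "\<dots> = - ((- 1) ^ (length (j # cs) - 1))" using 1 by (simp add: sign_swap_id)
  also have "\<dots> = (- 1) ^ (length (i # j # cs) - 1)" by simp
  finally show ?case .
qed auto

text \<open>For a cycle \<open>cs\<close> of the permutation that relates two matchings, where \<open>f\<close> is the first matching, this
is the corresponding alternating cycle of the graph.\<close>

definition interleave :: "('v \<Rightarrow> 'v) \<Rightarrow> 'v list \<Rightarrow> 'v list"
  where "interleave f cs = concat (map (\<lambda>v. [v, f v]) cs)"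

lemma interleave_simps [simp]: "interleave f [] = []" "interleave f (c # cs) = c # f c # interleave f cs"
  by (simp_all add: interleave_def)

lemma interleave_facts:
  "length (interleave f cs) = 2 * length cs" "set (interleave f cs) = set cs \<union> f ` set cs"
  by (induction cs) auto

lemma interleave_ends: "cs \<noteq> [] \<Longrightarrow> hd (interleave f cs) = hd cs \<and> last (interleave f cs) = f (last cs)"
proof (induction cs rule: induct_list012)
  case (3 x y zs)
  then show ?case by simp
qed auto

lemma distinct_interleave:
  "distinct cs \<Longrightarrow> inj_on f (set cs) \<Longrightarrow> set cs \<inter> f ` set cs = {} \<Longrightarrow> distinct (interleave f cs)"
  by (induction cs) (auto simp: interleave_facts)

text \<open>The variable \<open>z\<close> stands for the vertex after the last one. Leaving it general makes the induction
work; the closing step of the cycle is obtained with \<open>z = hd cs\<close>.\<close>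

lemma interleave_walk_sum:
  "cs \<noteq> [] \<Longrightarrow> walk_sum a (interleave f cs) + a (f (last cs)) z =
    (\<Sum>(v, w)\<leftarrow>zip cs (tl cs @ [z]). a v (f v) + a (f v) w)"
proof (induction cs rule: induct_list012)
  case (3 x y zs)
  then show ?case by (simp add: algebra_simps)
qed auto

lemma interleave_successively:
  "cs \<noteq> [] \<Longrightarrow> successively R (interleave f cs) \<and> R (f (last cs)) z \<longleftrightarrow>
    (\<forall>(v, w)\<in>set (zip cs (tl cs @ [z])). R v (f v) \<and> R (f v) w)"
proof (induction cs rule: induct_list012)
  case (3 x y zs)
  then show ?case by auto
qed auto

lemma zip_rotate_cycle:
  assumes "distinct cs" "cs \<noteq> []"
  shows "zip cs (tl cs @ [hd cs]) = map (\<lambda>v. (v, cycle_of_list cs v)) cs"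
proof -
  have "tl cs @ [hd cs] = map (cycle_of_list cs) cs"
    using cyclic_rotation[OF assms(1), of 1] rotate1_hd_tl[OF assms(2)] by simp
  then show ?thesis by (simp add: zip_map2 zip_same_conv_map)
qed

context plane_graph
begin

text \<open>The matching \<open>f\<close> pairs the vertices of the cycle with each other, hence also the remaining ones. The
edge of a remaining pair is drawn in the complement of the cycle, so both of its ends are inside or
both are outside.\<close>

lemma interior_count_even:
  assumes f: "bij_betw f (whites G) (blacks G)" "\<And>v. v \<in> whites G \<Longrightarrow> (f v, v) \<in> edges G"
    and c: "cycle_in (adj G) vs" and vs: "set vs = C \<union> f ` C" "C \<subseteq> whites G"
  shows "even (interior_count G vs)"
proof -
  let ?I = "inside (cycle_image G vs)"
  have im: "cycle_image G vs = walk_image G vs \<union> walk_image G [last vs, hd vs]"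
    using cycle_image_eq[OF c] by (simp add: walk_image_def)
  have succ: "successively (adj G) vs" "successively (adj G) [last vs, hd vs]" and ne: "vs \<noteq> []"
    and len: "2 \<le> length vs"
    using c by (auto simp: cycle_in_def)
  have on: "pos G v \<in> cycle_image G vs" if "v \<in> set vs" for v
    using walk_image_verts_eq[OF succ(1) len that] im by blast
  have inj: "inj_on f (whites G)" using f(1) by (rule bij_betw_imp_inj_on)
  have same: "pos G (f v) \<in> ?I \<longleftrightarrow> pos G v \<in> ?I" if v: "v \<in> whites G" for v
  proof (cases "v \<in> C")
    case True
    then have "v \<in> set vs" "f v \<in> set vs" using vs by auto
    then show ?thesis using on inside_no_overlap[of "cycle_image G vs"] by blast
  next
    case False
    have e: "(f v, v) \<in> edges G" by (rule f(2)[OF v])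
    have fv: "f v \<notin> f ` C" using False inj v vs(2) by (auto simp: inj_on_def)
    have "f v \<in> blacks G" using edge_ends[OF e] by simp
    then have out: "v \<notin> set vs" "f v \<notin> set vs"
    proof -
      have "f ` C \<subseteq> blacks G" using f(1) vs(2) by (auto simp: bij_betw_def)
      then show "v \<notin> set vs" "f v \<notin> set vs"
        using False fv \<open>f v \<in> blacks G\<close> vs v disjoint_colours by blast+
    qed
    have lh: "last vs \<in> set vs" "hd vs \<in> set vs" using ne by auto
    have w: "successively (adj G) [f v, v]" using e by (simp add: adj_def)
    have "walk_image G [f v, v] \<inter> walk_image G vs = {}"
      using out by (intro walk_images_disjoint w succ) simp
    moreover have "walk_image G [f v, v] \<inter> walk_image G [last vs, hd vs] = {}"
      using out lh by (intro walk_images_disjoint w succ) auto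
    ultimately have disj: "walk_image G [f v, v] \<inter> cycle_image G vs = {}"
      unfolding im by blast
    have a: "adj G (f v) v" using e by (simp add: adj_def)
    note ep = edge_path_facts[OF a]
    have "walk_image G [f v, v] = path_image (edge_path G (f v) v)" by (simp add: walk_image_def)
    then have "path_image (edge_path G (f v) v) \<subseteq> - cycle_image G vs" using disj by blast
    moreover have "connected (path_image (edge_path G (f v) v))"
      using ep(1) by (intro connected_path_image arc_imp_path)
    moreover have "pos G (f v) \<in> path_image (edge_path G (f v) v)" "pos G v \<in> path_image (edge_path G (f v) v)"
      using ep(4) by auto
    ultimately have cc: "connected_component (- cycle_image G vs) (pos G (f v)) (pos G v)"
      unfolding connected_component_def by blast
    then show ?thesis
      using inside_same_component[OF cc] inside_same_component[OF cc[THEN connected_component_sym]] by blast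
  qed
  let ?W = "{v \<in> whites G. pos G v \<in> ?I}"
  have "blacks G = f ` whites G" using f(1) by (simp add: bij_betw_def)
  then have "{v \<in> verts G. pos G v \<in> ?I} = ?W \<union> {u \<in> f ` whites G. pos G u \<in> ?I}"
    unfolding verts_def by blast
  also have "{u \<in> f ` whites G. pos G u \<in> ?I} = f ` ?W"
    using same by fast
  finally have "{v \<in> verts G. pos G v \<in> ?I} = ?W \<union> f ` ?W" .
  moreover have "?W \<inter> f ` ?W = {}" using disjoint_colours f(1) by (auto simp: bij_betw_def)
  moreover have "card (f ` ?W) = card ?W" by (intro card_image inj_on_subset[OF inj]) auto
  ultimately have "interior_count G vs = 2 * card ?W"
    using finite_verts(1) by (simp add: interior_count_def card_Un_disjoint)
  then show ?thesis by simp
qed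

lemma cycle_sign:
  assumes K: "kasteleyn_cochain G A"
    and f: "bij_betw f (whites G) (blacks G)" "\<And>v. v \<in> whites G \<Longrightarrow> (f v, v) \<in> edges G"
    and cs: "distinct cs" "set cs \<subseteq> whites G" "\<And>v. v \<in> set cs \<Longrightarrow> (f v, cycle_of_list cs v) \<in> edges G"
  shows "sign (cycle_of_list cs) = bit_sign (\<Sum>v\<in>set cs. A (f v, v) + A (f v, cycle_of_list cs v))"
proof (cases "length cs < 2")
  case True
  then consider "cs = []" | c where "cs = [c]" by (cases cs rule: remdups_adj.cases) auto
  then show ?thesis by cases auto
next
  case False
  then have ne: "cs \<noteq> []" by auto
  let ?vs = "interleave f cs" and ?p = "cycle_of_list cs"
  have inj: "inj_on f (set cs)" using f(1) cs(2) by (meson bij_betw_imp_inj_on inj_on_subset)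
  have "f ` set cs \<subseteq> blacks G" using f(1) cs(2) by (auto simp: bij_betw_def)
  then have dist: "distinct ?vs" using cs inj disjoint_colours by (intro distinct_interleave) auto
  have "\<forall>(v, w)\<in>set (zip cs (tl cs @ [hd cs])). adj G v (f v) \<and> adj G (f v) w"
    unfolding zip_rotate_cycle[OF cs(1) ne] using cs f(2) by (auto simp: adj_def)
  then have cyc: "cycle_in (adj G) ?vs"
    using interleave_successively[OF ne, of "adj G" f "hd cs"] dist False interleave_ends[OF ne, of f]
    by (auto simp: cycle_in_def interleave_facts)
  have "(\<Sum>v\<in>set cs. A (f v, v) + A (f v, ?p v)) = (\<Sum>v\<leftarrow>cs. A (f v, v) + A (f v, ?p v))"
    using cs(1) by (simp add: sum_list_distinct_conv_sum_set)
  also have "\<dots> = (\<Sum>v\<leftarrow>cs. oriented G A v (f v) + oriented G A (f v) (?p v))"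
  proof -
    have "oriented G A v (f v) = A (f v, v) \<and> oriented G A (f v) (?p v) = A (f v, ?p v)" if "v \<in> set cs" for v
      using that f(2)[of v] cs edge_not_reversed[of "f v" v] by (auto simp: oriented_def)
    then show ?thesis by (intro arg_cong[of _ _ sum_list] map_cong refl) simp
  qed
  also have "\<dots> = loop_sum (oriented G A) ?vs"
    using interleave_walk_sum[OF ne, of "oriented G A" f "hd cs"] interleave_ends[OF ne, of f]
    unfolding zip_rotate_cycle[OF cs(1) ne] loop_sum_def by (simp add: comp_def del: add_bit_eq_xor)
  also have "\<dots> = of_nat (interior_count G ?vs + length cs + 1)"
    using K cyc by (simp add: kasteleyn_cochain_def kasteleyn_value_def interleave_facts)
  finally have "bit_sign (\<Sum>v\<in>set cs. A (f v, v) + A (f v, ?p v)) = (- 1) ^ (interior_count G ?vs + length cs + 1)"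
    using bit_sign_of_nat by metis
  also have "\<dots> = (- 1) ^ (length cs - 1)"
    using interior_count_even[OF f cyc interleave_facts(2) cs(2)] ne by (simp add: minus_one_power_iff)
  also have "\<dots> = sign ?p" using sign_cycle_of_list[OF cs(1)] by simp
  finally show ?thesis by simp
qed

text \<open>Both sides are multiplicative over the cycles of \<open>p\<close>, for which the claim is \<open>cycle_sign\<close>: by
\<open>interior_count_even\<close> a cycle of length \<open>l\<close> contributes \<open>(-1)\<^bsup>l+1\<^esup>\<close> on the right, which is its sign.
A fixed point of \<open>p\<close> is an edge shared by the two matchings and contributes 1.\<close>

theorem matchings_sign:
  assumes K: "kasteleyn_cochain G A"
    and f: "bij_betw f (whites G) (blacks G)" "\<And>v. v \<in> whites G \<Longrightarrow> (f v, v) \<in> edges G"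
    and p: "p permutes whites G" "\<And>v. v \<in> whites G \<Longrightarrow> (f v, p v) \<in> edges G"
  shows "sign p = bit_sign (\<Sum>v\<in>whites G. A (f v, v) + A (f v, p v))"
proof -
  have "p permutes I \<and> finite I \<and> (I \<subseteq> whites G \<longrightarrow> (\<forall>v\<in>I. (f v, p v) \<in> edges G) \<longrightarrow>
      sign p = bit_sign (\<Sum>v\<in>I. A (f v, v) + A (f v, p v)))" if "cycle_decomp I p" for I p
    using that
  proof (induction rule: cycle_decomp.induct)
    case empty
    have "id permutes ({} :: 'v set)" by (rule permutes_id)
    then show ?case by (simp only: finite.emptyI sum.empty bit_sign_0 sign_id simp_thms)
  next
    case (comp I p cs)
    let ?c = "cycle_of_list cs"
    have perm: "p permutes I" "finite I" using comp.IH by auto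
    have "p permutes (set cs \<union> I)" "?c permutes (set cs \<union> I)"
      by (rule permutes_subset[OF perm(1) Un_upper2], rule permutes_subset[OF cycle_permutes Un_upper1])
    then have 1: "(?c \<circ> p) permutes (set cs \<union> I)" by (rule permutes_compose)
    have onI: "(?c \<circ> p) v = p v" if "v \<in> I" for v
    proof -
      have "p v \<in> I" using perm(1) that by (simp add: permutes_in_image)
      then have "p v \<notin> set cs" using comp.hyps by auto
      then show ?thesis by (simp add: id_outside_supp)
    qed
    have onc: "(?c \<circ> p) v = ?c v" if "v \<in> set cs" for v
    proof -
      have "v \<notin> I" using that comp.hyps by auto
      then show ?thesis using perm(1) by (simp add: permutes_not_in)
    qed
    show ?case
    proof (intro conjI impI 1)
      show "finite (set cs \<union> I)" using perm by simp
      assume sub: "set cs \<union> I \<subseteq> whites G" and e: "\<forall>v\<in>set cs \<union> I. (f v, (?c \<circ> p) v) \<in> edges G"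
      have "\<forall>v\<in>I. (f v, p v) \<in> edges G" using e onI by (metis UnCI)
      then have sp: "sign p = bit_sign (\<Sum>v\<in>I. A (f v, v) + A (f v, p v))"
        using comp.IH sub by blast
      have "(f v, ?c v) \<in> edges G" if "v \<in> set cs" for v using e onc that by (metis UnCI)
      then have sc: "sign ?c = bit_sign (\<Sum>v\<in>set cs. A (f v, v) + A (f v, ?c v))"
        using cycle_sign[OF K f comp.hyps(2)] sub by blast
      have "(\<Sum>v\<in>set cs \<union> I. A (f v, v) + A (f v, (?c \<circ> p) v)) =
          (\<Sum>v\<in>set cs. A (f v, v) + A (f v, (?c \<circ> p) v)) + (\<Sum>v\<in>I. A (f v, v) + A (f v, (?c \<circ> p) v))"
        using perm comp.hyps by (intro sum.union_disjoint) auto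
      also have "\<dots> = (\<Sum>v\<in>set cs. A (f v, v) + A (f v, ?c v)) + (\<Sum>v\<in>I. A (f v, v) + A (f v, p v))"
        by (intro arg_cong2[where f="(+)"] sum.cong refl) (simp_all only: onI onc)
      finally have sum: "(\<Sum>v\<in>set cs \<union> I. A (f v, v) + A (f v, (?c \<circ> p) v)) = \<dots>" .
      have "permutation p" using perm permutation_permutes by blast
      then have "sign (?c \<circ> p) = sign ?c * sign p"
        by (rule sign_compose[OF permutation_of_cycle])
      then show "sign (?c \<circ> p) = bit_sign (\<Sum>v\<in>set cs \<union> I. A (f v, v) + A (f v, (?c \<circ> p) v))"
        unfolding sum bit_sign_add sp sc .
    qed
  qed
  then show ?thesis using cycle_decomposition[OF p(1) finite_verts(1)] p(2) by blast
qed

end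

section \<open>Principal minors\<close>

text \<open>In the Leibniz expansion of \<open>det(t I - A)\<close> every factor is \<open>t [i = p i] - A\<^sub>i\<^sub>,\<^sub>p\<^sub>i\<close>. Let \<open>S\<close> be the set
of rows where the second summand is chosen; the term is nonzero only if \<open>p\<close> fixes all other rows,
that is, if \<open>p\<close> permutes \<open>S\<close>, and its degree in \<open>t\<close> is \<open>n - |S|\<close>.\<close>

lemma char_poly_coeff_nat:
  fixes A :: "'a::comm_ring_1 mat"
  assumes A: "A \<in> carrier_mat n n" and "m \<le> n"
  shows "coeff (char_poly A) (n - m) =
    (- 1) ^ m * (\<Sum>S | S \<subseteq> {0..<n} \<and> card S = m. \<Sum>p | p permutes S. of_int (sign p) * (\<Prod>i\<in>S. A $$ (i, p i)))"
proof -
  let ?N = "{0..<n}"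
  let ?P = "{p. p permutes ?N}"
  let ?d = "\<lambda>p i. if p i = i then [:0, 1:] else (0 :: 'a poly)"
  have fin: "finite ?P" by (simp add: finite_permutations)
  have summand: "coeff (of_int (sign p) * ((\<Prod>i\<in>S. [:- (A $$ (i, p i)):]) * (\<Prod>i\<in>?N - S. ?d p i))) (n - m)
      = (if card S = m \<and> p permutes S then (- 1) ^ m * (of_int (sign p) * (\<Prod>i\<in>S. A $$ (i, p i))) else 0)"
    if S: "S \<subseteq> ?N" and p: "p permutes ?N" for S p
  proof -
    have finS: "finite S" using S finite_subset by blast
    have const: "(\<Prod>i\<in>S. [:- (A $$ (i, p i)):]) = [:(- 1) ^ card S * (\<Prod>i\<in>S. A $$ (i, p i)):]"
      using finS by (induction S rule: finite_induct) (auto simp: one_pCons algebra_simps)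
    have card: "card (?N - S) = n - card S" "card S \<le> n"
      using S finS card_mono[OF _ S] by (simp_all add: card_Diff_subset)
    show ?thesis
    proof (cases "p permutes S")
      case True
      then have "(\<Prod>i\<in>?N - S. ?d p i) = (\<Prod>i\<in>?N - S. [:0, 1:])"
        by (intro prod.cong) (auto simp: permutes_def)
      also have "\<dots> = monom 1 (n - card S)"
        by (simp add: card monom_altdef)
      finally have d: "(\<Prod>i\<in>?N - S. ?d p i) = monom 1 (n - card S)" .
      have sgn: "of_int (sign p) * q = (if evenperm p then q else - q)" for q :: "'a poly"
        by (simp add: sign_def)
      show ?thesis unfolding const d using True card \<open>m \<le> n\<close>
        by (auto simp: sgn sign_def)
    next
      case False
      then obtain i where i: "i \<in> ?N - S" "p i \<noteq> i"
        using permutes_superset[OF p, of S] by blast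
      then have "(\<Prod>i\<in>?N - S. ?d p i) = 0" by (intro prod_zero) auto
      then show ?thesis using False by simp
    qed
  qed
  have "char_poly A = (\<Sum>p\<in>?P. of_int (sign p) * (\<Prod>i\<in>?N. [:- (A $$ (i, p i)):] + ?d p i))"
    unfolding char_poly_def det_def'[OF char_poly_matrix_closed[OF A]]
  proof (intro sum.cong refl arg_cong2[where f="(*)"] prod.cong)
    fix p i assume "p \<in> ?P" "i \<in> ?N"
    then have "p i < n" "i < n" using permutes_in_image[of p ?N i] by auto
    then show "char_poly_matrix A $$ (i, p i) = [:- (A $$ (i, p i)):] + ?d p i"
      using A by (auto simp: char_poly_matrix_def)
  qed
  also have "\<dots> = (\<Sum>p\<in>?P. \<Sum>S\<in>Pow ?N. of_int (sign p) * ((\<Prod>i\<in>S. [:- (A $$ (i, p i)):]) * (\<Prod>i\<in>?N - S. ?d p i)))"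
    by (subst prod_add) (simp_all add: sum_distrib_left)
  finally have "coeff (char_poly A) (n - m) = (\<Sum>p\<in>?P. \<Sum>S\<in>Pow ?N.
      (if card S = m \<and> p permutes S then (- 1) ^ m * (of_int (sign p) * (\<Prod>i\<in>S. A $$ (i, p i))) else 0))"
    using summand by (simp add: coeff_sum)
  also have "\<dots> = (\<Sum>S\<in>Pow ?N. \<Sum>p\<in>?P.
      (if card S = m \<and> p permutes S then (- 1) ^ m * (of_int (sign p) * (\<Prod>i\<in>S. A $$ (i, p i))) else 0))"
    by (rule sum.swap)
  also have "\<dots> = (\<Sum>S\<in>Pow ?N. if card S = m then (- 1) ^ m * (\<Sum>p | p permutes S. of_int (sign p) * (\<Prod>i\<in>S. A $$ (i, p i))) else 0)"
  proof (intro sum.cong refl)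
    fix S assume S: "S \<in> Pow ?N"
    have "?P \<inter> {p. p permutes S} = {p. p permutes S}"
      using S permutes_subset by blast
    then show "(\<Sum>p\<in>?P. if card S = m \<and> p permutes S then (- 1) ^ m * (of_int (sign p) * (\<Prod>i\<in>S. A $$ (i, p i))) else 0)
      = (if card S = m then (- 1) ^ m * (\<Sum>p | p permutes S. of_int (sign p) * (\<Prod>i\<in>S. A $$ (i, p i))) else 0)"
      using sum.inter_restrict[OF fin, of "\<lambda>p. (- 1) ^ m * (of_int (sign p) * (\<Prod>i\<in>S. A $$ (i, p i)))" "{p. p permutes S}"]
      by (auto simp: sum_distrib_left)
  qed
  also have "\<dots> = (\<Sum>S\<in>Pow ?N \<inter> {S. card S = m}. (- 1) ^ m * (\<Sum>p | p permutes S. of_int (sign p) * (\<Prod>i\<in>S. A $$ (i, p i))))"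
    using sum.inter_restrict[of "Pow ?N" "\<lambda>S. (- 1) ^ m * (\<Sum>p | p permutes S. of_int (sign p) * (\<Prod>i\<in>S. A $$ (i, p i)))" "{S. card S = m}"]
    by simp
  also have "Pow ?N \<inter> {S. card S = m} = {S. S \<subseteq> ?N \<and> card S = m}" by auto
  finally show ?thesis by (simp add: sum_distrib_left)
qed

text \<open>A matrix indexed by vertices makes the principal minors independent of the numbering.\<close>

definition principal_minor :: "('v \<Rightarrow> 'v \<Rightarrow> 'a::comm_ring_1) \<Rightarrow> 'v set \<Rightarrow> 'a"
  where "principal_minor h S = (\<Sum>p | p permutes S. of_int (sign p) * (\<Prod>v\<in>S. h v (p v)))"

lemma principal_minor_image:
  assumes "inj_on \<phi> S" "finite S"
  shows "principal_minor h (\<phi> ` S) = principal_minor (\<lambda>i j. h (\<phi> i) (\<phi> j)) S"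
proof -
  have bij: "bij_betw \<phi> S (\<phi> ` S)" using assms by (simp add: bij_betw_def)
  have "bij_betw (map_permutation S \<phi>) {p. p permutes S} {p. p permutes (\<phi> ` S)}"
  proof -
    have "bij_betw (\<lambda>\<pi> x. if x \<in> \<phi> ` S then \<phi> (\<pi> (inv_into S \<phi> x)) else x) {p. p permutes S} {p. p permutes (\<phi> ` S)}"
      by (rule bij_betw_permutations[OF bij])
    moreover have "(\<lambda>\<pi> x. if x \<in> \<phi> ` S then \<phi> (\<pi> (inv_into S \<phi> x)) else x) = map_permutation S \<phi>"
      by (auto simp: fun_eq_iff map_permutation_def restrict_id_def)
    ultimately show ?thesis by simp
  qed
  then have "principal_minor h (\<phi> ` S) = (\<Sum>p | p permutes S. of_int (sign (map_permutation S \<phi> p)) *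
      (\<Prod>v\<in>\<phi> ` S. h v (map_permutation S \<phi> p v)))"
    unfolding principal_minor_def by (simp add: sum.reindex_bij_betw[symmetric])
  also have "\<dots> = principal_minor (\<lambda>i j. h (\<phi> i) (\<phi> j)) S"
    unfolding principal_minor_def
    by (intro sum.cong refl) (simp add: sign_map_permutation[OF assms(1) _ assms(2)] prod.reindex[OF assms(1)]
        map_permutation_apply[OF assms(1)])
  finally show ?thesis .
qed

lemma char_poly_coeff:
  fixes h :: "'v \<Rightarrow> 'v \<Rightarrow> 'a::comm_ring_1"
  assumes A: "A \<in> carrier_mat n n" and "m \<le> n"
    and vs: "distinct vs" "length vs = n"
    and h: "\<And>i j. i < n \<Longrightarrow> j < n \<Longrightarrow> A $$ (i, j) = h (vs ! i) (vs ! j)"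
  shows "coeff (char_poly A) (n - m) = (- 1) ^ m * (\<Sum>S | S \<subseteq> set vs \<and> card S = m. principal_minor h S)"
proof -
  have inj: "inj_on ((!) vs) {0..<n}" and img: "(!) vs ` {0..<n} = set vs"
    using vs by (auto simp: inj_on_nth set_conv_nth)
  have "bij_betw ((`) ((!) vs)) {S. S \<subseteq> {0..<n} \<and> card S = m} {S. S \<subseteq> set vs \<and> card S = m}"
  proof (rule bij_betwI')
    fix X Y assume "X \<in> {S. S \<subseteq> {0..<n} \<and> card S = m}" "Y \<in> {S. S \<subseteq> {0..<n} \<and> card S = m}"
    then show "((!) vs ` X = (!) vs ` Y) = (X = Y)" using inj inj_on_image_eq_iff by blast
  next
    fix X assume "X \<in> {S. S \<subseteq> {0..<n} \<and> card S = m}"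
    then show "(!) vs ` X \<in> {S. S \<subseteq> set vs \<and> card S = m}"
      using img card_image[OF inj_on_subset[OF inj, of X]] by auto
  next
    fix Y assume Y: "Y \<in> {S. S \<subseteq> set vs \<and> card S = m}"
    then obtain X where "X \<subseteq> {0..<n}" "Y = (!) vs ` X" using img subset_imageE[of Y "(!) vs" "{0..<n}"] by blast
    then show "\<exists>X\<in>{S. S \<subseteq> {0..<n} \<and> card S = m}. Y = (!) vs ` X"
      using Y card_image[OF inj_on_subset[OF inj, of X]] by auto
  qed
  then have "(\<Sum>S | S \<subseteq> set vs \<and> card S = m. principal_minor h S)
      = (\<Sum>S | S \<subseteq> {0..<n} \<and> card S = m. principal_minor h ((!) vs ` S))"
    by (rule sum.reindex_bij_betw[symmetric])
  also have "\<dots> = (\<Sum>S | S \<subseteq> {0..<n} \<and> card S = m. \<Sum>p | p permutes S. of_int (sign p) * (\<Prod>i\<in>S. A $$ (i, p i)))"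
  proof (intro sum.cong refl)
    fix S assume "S \<in> {S. S \<subseteq> {0..<n} \<and> card S = m}"
    then have S: "S \<subseteq> {0..<n}" by simp
    have "principal_minor h ((!) vs ` S) = principal_minor (\<lambda>i j. h (vs ! i) (vs ! j)) S"
      using principal_minor_image[OF inj_on_subset[OF inj S]] S finite_subset by blast
    also have "\<dots> = (\<Sum>p | p permutes S. of_int (sign p) * (\<Prod>i\<in>S. A $$ (i, p i)))"
      unfolding principal_minor_def
    proof (intro sum.cong prod.cong refl arg_cong2[where f="(*)"])
      fix p i assume "p \<in> {p. p permutes S}" "i \<in> S"
      then have "i < n" "p i < n" using S permutes_in_image[of p S i] by auto
      then show "h (vs ! i) (vs ! p i) = A $$ (i, p i)" by (simp add: h)
    qed
    finally show "principal_minor h ((!) vs ` S) = (\<Sum>p | p permutes S. of_int (sign p) * (\<Prod>i\<in>S. A $$ (i, p i)))" .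
  qed
  finally show ?thesis using char_poly_coeff_nat[OF A \<open>m \<le> n\<close>] by simp
qed

text \<open>If \<open>f\<close> takes the same value at \<open>x\<close> and \<open>y\<close>, composing \<open>p\<close> with the transposition of \<open>x\<close> and \<open>y\<close>
reverses the sign of the term: the determinant has two equal columns.\<close>

lemma alternating_sum_non_injective:
  fixes c :: "'v \<Rightarrow> 'u \<Rightarrow> complex"
  assumes "finite S" "\<not> inj_on f S"
  shows "(\<Sum>p | p permutes S. of_int (sign p) * (\<Prod>v\<in>S. c (p v) (f v))) = 0"
proof -
  obtain x y where xy: "x \<in> S" "y \<in> S" "x \<noteq> y" "f x = f y"
    using assms(2) by (auto simp: inj_on_def)
  let ?t = "Transposition.transpose x y"
  let ?F = "\<lambda>p. of_int (sign p) * (\<Prod>v\<in>S. c (p v) (f v))"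
  have t: "?t permutes S" using xy by (simp add: permutes_swap_id)
  have "?F (p \<circ> ?t) = - ?F p" if p: "p permutes S" for p
  proof -
    have perm: "permutation p" "permutation ?t"
      using p t assms(1) permutation_permutes by auto
    have "(\<Prod>v\<in>S. c (p v) (f v)) = (\<Prod>v\<in>S. c (p (?t v)) (f (?t v)))"
      by (rule prod.permute[OF t, of "\<lambda>v. c (p v) (f v)", unfolded o_def])
    also have "\<dots> = (\<Prod>v\<in>S. c ((p \<circ> ?t) v) (f v))"
      using xy by (intro prod.cong) (auto simp: Transposition.transpose_def)
    finally show ?thesis
      using perm xy by (simp add: sign_compose sign_swap_id)
  qed
  then have "sum ?F {p. p permutes S} = - sum ?F {p. p permutes S}"
    using sum_permutations_compose_right[OF t, of ?F] by (simp add: sum_negf)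
  then show ?thesis by simp
qed

text \<open>The Cauchy--Binet expansion, with the summands left in the form that is needed here: grouping the
injections \<open>f\<close> by their image would give the squared moduli of the minors of \<open>B\<close>.\<close>

lemma gram_principal_minor:
  fixes B :: "'v \<Rightarrow> 'u \<Rightarrow> complex"
  assumes "finite S" "finite T"
  shows "principal_minor (\<lambda>v w. \<Sum>u\<in>T. B v u * cnj (B w u)) S =
    (\<Sum>f | f \<in> S \<rightarrow>\<^sub>E T \<and> inj_on f S. \<Sum>p | p permutes S.
      of_int (sign p) * (\<Prod>v\<in>S. B v (f v) * cnj (B (p v) (f v))))"
proof -
  have fin: "finite (S \<rightarrow>\<^sub>E T)" using assms by (simp add: finite_PiE)
  let ?F = "\<lambda>f. \<Sum>p | p permutes S. of_int (sign p) * (\<Prod>v\<in>S. B v (f v) * cnj (B (p v) (f v)))"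
  have "principal_minor (\<lambda>v w. \<Sum>u\<in>T. B v u * cnj (B w u)) S = 
    (\<Sum>p | p permutes S. \<Sum>f\<in>S \<rightarrow>\<^sub>E T. of_int (sign p) * (\<Prod>v\<in>S. B v (f v) * cnj (B (p v) (f v))))"
    unfolding principal_minor_def using assms
    by (simp add: prod_sum_PiE sum_distrib_left)
  also have "\<dots> = sum ?F (S \<rightarrow>\<^sub>E T)"
    by (rule sum.swap)
  also have "\<dots> = sum ?F {f. f \<in> S \<rightarrow>\<^sub>E T \<and> inj_on f S}"
  proof (rule sum.mono_neutral_right[OF fin])
    show "\<forall>f\<in>(S \<rightarrow>\<^sub>E T) - {f. f \<in> S \<rightarrow>\<^sub>E T \<and> inj_on f S}. ?F f = 0"
    proof
      fix f assume f: "f \<in> (S \<rightarrow>\<^sub>E T) - {f. f \<in> S \<rightarrow>\<^sub>E T \<and> inj_on f S}"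
      have "?F f = (\<Prod>v\<in>S. B v (f v)) * (\<Sum>p | p permutes S. of_int (sign p) * (\<Prod>v\<in>S. cnj (B (p v) (f v))))"
        by (simp add: prod.distrib sum_distrib_left algebra_simps)
      also have "\<dots> = 0"
        using alternating_sum_non_injective[OF assms(1), of f "\<lambda>w u. cnj (B w u)"] f by simp
      finally show "?F f = 0" .
    qed
  qed auto
  finally show ?thesis .
qed

section \<open>Induced subgraphs, the character and representatives of classes\<close>

lemma induced_simps [simp]:
  "whites (induced G S) = whites G \<inter> S" "blacks (induced G S) = blacks G \<inter> S"
  "edges (induced G S) = edges G \<inter> S \<times> S" "verts (induced G S) = verts G \<inter> S"
  "pos (induced G S) = pos G" "curve (induced G S) = curve G"
  by (auto simp: induced_def verts_def)

lemma (in plane_graph) plane_induced: "plane_graph (induced G S)"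
proof
  have image: "path_image (curve G e) \<inter> pos G ` (verts G \<inter> S) = {pos G (fst e), pos G (snd e)}"
    if "e \<in> edges G" "e \<in> S \<times> S" for e
  proof -
    have "fst e \<in> verts G \<inter> S" "snd e \<in> verts G \<inter> S"
      using that edge_ends[of "fst e" "snd e"] by (auto simp: verts_def)
    then show ?thesis using curve_facts(4)[OF that(1)] by blast
  qed
  have meet: "path_image (curve G e) \<inter> path_image (curve G e') \<subseteq> pos G ` ({fst e, snd e} \<inter> {fst e', snd e'})"
    if "e \<in> edges G" "e' \<in> edges G" "e \<noteq> e'" for e e'
    using plane that unfolding plane_bipartite_graph_def by blast
  have sub: "edges G \<inter> S \<times> S \<subseteq> (blacks G \<inter> S) \<times> (whites G \<inter> S)"
    using edge_ends by auto
  have inj: "inj_on (pos G) (verts G \<inter> S)"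
    using pos_inj by (auto simp: inj_on_def)
  have fin: "finite (whites G \<inter> S)" "finite (blacks G \<inter> S)" and disj: "(whites G \<inter> S) \<inter> (blacks G \<inter> S) = {}"
    using finite_verts disjoint_colours by auto
  show "plane_bipartite_graph (induced G S)"
    unfolding plane_bipartite_graph_def induced_simps
    by (intro conjI ballI impI fin disj sub inj; elim IntE; intro image meet curve_facts)
qed

lemma eta_0 [simp]: "eta 0 = 1"
  by transfer simp

lemma eta_add: "eta (x + y) = eta x * eta y"
  by transfer (simp add: algebra_simps exp_add)

lemma eta_minus: "eta (- x) = cnj (eta x)"
  by transfer (simp add: exp_cnj)

lemma eta_diff: "eta (x - y) = eta x * cnj (eta y)"
  using eta_add[of x "- y"] by (simp add: eta_minus)

lemma eta_cnj: "eta x * cnj (eta x) = 1"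
  using eta_diff[of x x] by simp

lemma norm_eta: "cmod (eta x) = 1"
  using eta_cnj[of x] by (metis complex_mod_mult_cnj norm_one power2_eq_1_iff norm_ge_zero le_minus_one_simps(3))

lemma eta_sum: "eta (sum h S) = (\<Prod>x\<in>S. eta (h x))"
  by (induction S rule: infinite_finite_induct) (simp_all add: eta_add)

lemma eta_inj: "eta x = eta y \<Longrightarrow> x = y"
proof transfer
  fix x y :: real
  assume "exp (2 * of_real pi * \<i> * of_real x) = exp (2 * of_real pi * \<i> * of_real y)"
  then obtain n :: int where "2 * of_real pi * \<i> * of_real x = 2 * of_real pi * \<i> * of_real y + of_real (real_of_int (2 * n) * pi) * \<i>"
    unfolding exp_eq by blast
  then have "Im (2 * of_real pi * \<i> * of_real x) = Im (2 * of_real pi * \<i> * of_real y + of_real (real_of_int (2 * n) * pi) * \<i>)"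
    by (rule arg_cong)
  then have "2 * pi * x = 2 * pi * (y + of_int n)"
    by (simp add: algebra_simps)
  then have "x = y + of_int n" by simp
  then show "x - y \<in> \<int>" by simp
qed

lemma half_add: "half (a + b) = half a + half b"
  by (cases a; cases b; transfer) auto

lemma half_0 [simp]: "half 0 = 0"
  by transfer simp

lemma half_diff: "half (a - b) = half a - half b"
  using half_add[of "a - b" b] by (simp add: algebra_simps del: minus_bit_def add_bit_eq_xor)

lemma eta_half: "eta (half b) = of_int (bit_sign b)"
  by (cases b; simp add: bit_sign_def; transfer) (simp add: exp_pi_i')

lemma restrict_class:
  assumes "edges H \<subseteq> edges G"
  shows "H1_restrict H (cohomology_class G A) = cohomology_class H A"
  unfolding H1_restrict_def
proof (rule image_class[OF class_self])
  fix B assume "B \<in> cohomology_class G A"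
  then obtain f where "\<forall>(b, w)\<in>edges G. B (b, w) - A (b, w) = f w - f b" by (auto simp: cohomologous_def)
  then have "\<forall>(b, w)\<in>edges H. B (b, w) - A (b, w) = f w - f b" using assms by blast
  then show "(A, B) \<in> cohomologous H" unfolding cohomologous_def by blast
qed

text \<open>Every representative of the class of \<open>A - B\<close> is a difference of representatives, obtained by adding
\<open>B\<close> back.\<close>

lemma diff_class:
  "H1_diff (cohomology_class H A) (cohomology_class H B) = cohomology_class H (\<lambda>e. A e - B e)"
proof (intro equalityI subsetI)
  fix Z assume "Z \<in> H1_diff (cohomology_class H A) (cohomology_class H B)"
  then obtain X Y where Z: "Z = (\<lambda>e. X e - Y e)" and "(A, X) \<in> cohomologous H" "(B, Y) \<in> cohomologous H"
    by (auto simp: H1_diff_def)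
  then obtain f g where f: "\<forall>(b, w)\<in>edges H. X (b, w) - A (b, w) = f w - f b"
    and g: "\<forall>(b, w)\<in>edges H. Y (b, w) - B (b, w) = g w - g b"
    by (auto simp: cohomologous_def)
  have "Z (b, w) - (A (b, w) - B (b, w)) = (f w - g w) - (f b - g b)" if e: "(b, w) \<in> edges H" for b w
  proof -
    have "Z (b, w) - (A (b, w) - B (b, w)) = (X (b, w) - A (b, w)) - (Y (b, w) - B (b, w))"
      by (simp add: Z)
    also have "\<dots> = (f w - f b) - (g w - g b)" using bspec[OF f e] bspec[OF g e] by simp
    finally show ?thesis by simp
  qed
  then show "Z \<in> cohomology_class H (\<lambda>e. A e - B e)"
    by (auto simp: cohomologous_def intro!: exI[of _ "\<lambda>v. f v - g v"])
next
  fix Z assume "Z \<in> cohomology_class H (\<lambda>e. A e - B e)"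
  then obtain f where f: "\<forall>(b, w)\<in>edges H. Z (b, w) - (A (b, w) - B (b, w)) = f w - f b"
    by (auto simp: cohomologous_def)
  have "(A, \<lambda>e. Z e + B e) \<in> cohomologous H"
    using f by (auto simp: cohomologous_def algebra_simps intro!: exI[of _ f])
  then have "(\<lambda>e. Z e + B e) \<in> cohomology_class H A" by simp
  moreover have "Z = (\<lambda>e. (Z e + B e) - B e)" by simp
  ultimately show "Z \<in> H1_diff (cohomology_class H A) (cohomology_class H B)"
    unfolding H1_diff_def mem_Collect_eq using class_self by (intro exI conjI)
qed

lemma half_class: "H1_half H (cohomology_class H A) = cohomology_class H (\<lambda>e. half (A e))"
  unfolding H1_half_def
proof (rule image_class)
  show "(\<lambda>e. half (A e)) \<in> (\<lambda>A. half \<circ> A) ` cohomology_class H A"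
    using class_self[of A H] by (auto simp: comp_def)
next
  fix X assume "X \<in> (\<lambda>A. half \<circ> A) ` cohomology_class H A"
  then obtain B where X: "X = half \<circ> B" and "(A, B) \<in> cohomologous H" by auto
  then obtain f where f: "\<forall>(b, w)\<in>edges H. B (b, w) - A (b, w) = f w - f b" by (auto simp: cohomologous_def)
  have "X (b, w) - half (A (b, w)) = half (f w) - half (f b)" if e: "(b, w) \<in> edges H" for b w
    using bspec[OF f e] unfolding X comp_def half_diff[symmetric] by simp
  then show "(\<lambda>e. half (A e), X) \<in> cohomologous H"
    unfolding cohomologous_def by (auto intro!: exI[of _ "\<lambda>v. half (f v)"])
qed

section \<open>The sum over pairs of matchings\<close>

context plane_graph
begin

text \<open>A matching viewed as the function from white vertices to their black partners; it is undefined off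
the white vertices, so that the matching determines the function.\<close>

definition matching_maps :: "('v \<Rightarrow> 'v) set"
  where "matching_maps = {f. f \<in> whites G \<rightarrow>\<^sub>E blacks G \<and> bij_betw f (whites G) (blacks G) \<and>
    (\<forall>v\<in>whites G. (f v, v) \<in> edges G)}"

lemma matching_of_map:
  assumes f: "bij_betw f (whites G) (blacks G)" and p: "p permutes whites G"
    and e: "\<forall>v\<in>whites G. (f v, p v) \<in> edges G"
  shows "(\<lambda>v. (f v, p v)) ` whites G \<in> matchings G"
proof -
  let ?M = "(\<lambda>v. (f v, p v)) ` whites G"
  have inj: "inj_on f (whites G)" and img: "f ` whites G = blacks G" using f by (auto simp: bij_betw_def)
  have "\<exists>!d. d \<in> ?M \<and> (u = fst d \<or> u = snd d)" if u: "u \<in> verts G" for u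
  proof (cases "u \<in> whites G")
    case True
    then obtain v where v: "v \<in> whites G" "p v = u" using permutes_image[OF p] by (metis imageE)
    show ?thesis
    proof (rule ex1I[of _ "(f v, p v)"])
      show "(f v, p v) \<in> ?M \<and> (u = fst (f v, p v) \<or> u = snd (f v, p v))"
        using imageI[OF v(1), of "\<lambda>v. (f v, p v)"] v(2) by auto
      fix d assume d: "d \<in> ?M \<and> (u = fst d \<or> u = snd d)"
      then obtain w where w: "w \<in> whites G" "d = (f w, p w)" by blast
      then have "f w \<in> blacks G" using img by blast
      then have "u = p w" using d w True disjoint_colours by auto
      then have "w = v" using v permutes_inj[OF p] by (metis injD)
      then show "d = (f v, p v)" using w by simp
    qed
  next
    case False
    then have "u \<in> f ` whites G" using u img by (simp add: verts_def)
    then obtain v where v: "v \<in> whites G" "f v = u" by (elim imageE) simp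
    show ?thesis
    proof (rule ex1I[of _ "(f v, p v)"])
      show "(f v, p v) \<in> ?M \<and> (u = fst (f v, p v) \<or> u = snd (f v, p v))"
        using imageI[OF v(1), of "\<lambda>v. (f v, p v)"] v(2) by auto
      fix d assume d: "d \<in> ?M \<and> (u = fst d \<or> u = snd d)"
      then obtain w where w: "w \<in> whites G" "d = (f w, p w)" by blast
      then have "p w \<in> whites G" using permutes_in_image[OF p] by simp
      then have "u = f w" using d w False by auto
      then have "w = v" using v w inj by (auto simp: inj_on_def)
      then show "d = (f v, p v)" using w by simp
    qed
  qed
  then show ?thesis using e unfolding matchings_def by blast
qed

lemma map_of_matching:
  assumes M: "M \<in> matchings G"
  obtains f where "f \<in> matching_maps" "M = (\<lambda>v. (f v, v)) ` whites G"
proof -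
  have sub: "M \<subseteq> edges G" and ex1: "\<And>u. u \<in> verts G \<Longrightarrow> \<exists>!d. d \<in> M \<and> (u = fst d \<or> u = snd d)"
    using M by (auto simp: matchings_def)
  have uniq: "d = d'" if "u \<in> verts G" "d \<in> M" "d' \<in> M" "u = fst d \<or> u = snd d" "u = fst d' \<or> u = snd d'" for u d d'
    using ex1[OF that(1)] that by blast
  have "\<exists>b. (b, v) \<in> M" if v: "v \<in> whites G" for v
  proof -
    obtain d where d: "d \<in> M" "v = fst d \<or> v = snd d" using ex1[of v] v by (auto simp: verts_def)
    then have "(fst d, snd d) \<in> edges G" using sub by auto
    then have "fst d \<in> blacks G" using edge_ends by blast
    then have "v = snd d" using d v disjoint_colours by auto
    then show ?thesis using d by (metis prod.collapse)
  qed
  then obtain f0 where f0: "\<And>v. v \<in> whites G \<Longrightarrow> (f0 v, v) \<in> M" by metis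
  define f where "f = restrict f0 (whites G)"
  have f: "(f v, v) \<in> M" if "v \<in> whites G" for v using f0[OF that] that by (simp add: f_def)
  have fe: "(f v, v) \<in> edges G" if "v \<in> whites G" for v using f[OF that] sub by blast
  have fb: "f v \<in> blacks G" if "v \<in> whites G" for v using fe[OF that] edge_ends by blast
  have inj: "inj_on f (whites G)"
  proof (rule inj_onI)
    fix v w assume vw: "v \<in> whites G" "w \<in> whites G" "f v = f w"
    then show "v = w"
      using uniq[of "f v" "(f v, v)" "(f w, w)"] f[OF vw(1)] f[OF vw(2)] fb[OF vw(1)] by (simp add: verts_def)
  qed
  have all: "d = (f (snd d), snd d) \<and> snd d \<in> whites G" if d: "d \<in> M" for d
  proof -
    have "(fst d, snd d) \<in> edges G" using d sub by auto
    then have w: "snd d \<in> whites G" using edge_ends by blast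
    have "d = (f (snd d), snd d)"
      by (rule uniq[of "snd d"]) (use w d f in \<open>auto simp: verts_def\<close>)
    then show ?thesis using w by blast
  qed
  have img: "f ` whites G = blacks G"
  proof (intro equalityI subsetI)
    fix b assume b: "b \<in> blacks G"
    then obtain d where d: "d \<in> M" "b = fst d \<or> b = snd d" using ex1[of b] by (auto simp: verts_def)
    have "b \<noteq> snd d" using all[OF d(1)] b disjoint_colours by auto
    then have "b = fst d" using d by blast
    then have "b = f (snd d)" using all[OF d(1)] by (metis fst_conv)
    then show "b \<in> f ` whites G" using all[OF d(1)] by blast
  qed (use fb in auto)
  have "f \<in> matching_maps"
    unfolding matching_maps_def using inj img fe fb by (auto simp: bij_betw_def f_def)
  moreover have "M = (\<lambda>v. (f v, v)) ` whites G"
    using all f by (auto simp: image_iff)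
  ultimately show thesis by (rule that)
qed

lemma bij_matching_maps: "bij_betw (\<lambda>f. (\<lambda>v. (f v, v)) ` whites G) matching_maps (matchings G)"
proof (rule bij_betwI')
  fix f g assume fg: "f \<in> matching_maps" "g \<in> matching_maps"
  show "((\<lambda>v. (f v, v)) ` whites G = (\<lambda>v. (g v, v)) ` whites G) = (f = g)"
  proof
    assume eq: "(\<lambda>v. (f v, v)) ` whites G = (\<lambda>v. (g v, v)) ` whites G"
    have "f v = g v" if "v \<in> whites G" for v
    proof -
      have "(f v, v) \<in> (\<lambda>v. (g v, v)) ` whites G" using eq that by blast
      then show ?thesis by auto
    qed
    moreover have "f \<in> extensional (whites G)" "g \<in> extensional (whites G)"
      using fg by (auto simp: matching_maps_def PiE_def)
    ultimately show "f = g" by (metis extensionalityI)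
  qed simp
next
  fix f assume f: "f \<in> matching_maps"
  show "(\<lambda>v. (f v, v)) ` whites G \<in> matchings G"
    using matching_of_map[of f id] f by (simp add: matching_maps_def permutes_id)
next
  fix M assume "M \<in> matchings G"
  then show "\<exists>f\<in>matching_maps. M = (\<lambda>v. (f v, v)) ` whites G" using map_of_matching by metis
qed

text \<open>Once a first matching \<open>f\<close> is fixed, any second matching \<open>g\<close> is described by the permutation
\<open>p = g\<^bsup>-1\<^esup> f\<close> of the white vertices.\<close>

lemma bij_matching_permutations:
  assumes f: "f \<in> matching_maps"
  shows "bij_betw (\<lambda>p. (\<lambda>v. (f v, p v)) ` whites G)
    {p. p permutes whites G \<and> (\<forall>v\<in>whites G. (f v, p v) \<in> edges G)} (matchings G)"
proof (rule bij_betwI')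
  have bij: "bij_betw f (whites G) (blacks G)" using f by (simp add: matching_maps_def)
  then have inj: "inj_on f (whites G)" by (rule bij_betw_imp_inj_on)
  {
    fix p q assume p: "p \<in> {p. p permutes whites G \<and> (\<forall>v\<in>whites G. (f v, p v) \<in> edges G)}"
      and q: "q \<in> {p. p permutes whites G \<and> (\<forall>v\<in>whites G. (f v, p v) \<in> edges G)}"
    show "((\<lambda>v. (f v, p v)) ` whites G = (\<lambda>v. (f v, q v)) ` whites G) = (p = q)"
    proof
      assume eq: "(\<lambda>v. (f v, p v)) ` whites G = (\<lambda>v. (f v, q v)) ` whites G"
      show "p = q"
      proof
        fix v show "p v = q v"
        proof (cases "v \<in> whites G")
          case True
          then have "(f v, p v) \<in> (\<lambda>v. (f v, q v)) ` whites G" using eq by blast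
          then obtain w where "w \<in> whites G" "f v = f w" "p v = q w" by auto
          then show ?thesis using inj_onD[OF inj _ True] by metis
        next
          case False
          then show ?thesis
            using p q permutes_not_in[of p "whites G" v] permutes_not_in[of q "whites G" v] by auto
        qed
      qed
    qed simp
  next
    fix p assume "p \<in> {p. p permutes whites G \<and> (\<forall>v\<in>whites G. (f v, p v) \<in> edges G)}"
    then show "(\<lambda>v. (f v, p v)) ` whites G \<in> matchings G" using matching_of_map[OF bij] by blast
  next
    fix M assume "M \<in> matchings G"
    then obtain g where g: "g \<in> matching_maps" and M: "M = (\<lambda>v. (g v, v)) ` whites G"
      using map_of_matching by metis
    have bg: "bij_betw g (whites G) (blacks G)" using g by (simp add: matching_maps_def)
    define p where "p v = (if v \<in> whites G then inv_into (whites G) g (f v) else v)" for v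
    have "bij_betw (inv_into (whites G) g \<circ> f) (whites G) (whites G)"
      by (rule bij_betw_trans[OF bij bij_betw_inv_into[OF bg]])
    then have bp: "bij_betw p (whites G) (whites G)"
      by (rule bij_betw_cong[THEN iffD1, rotated]) (simp add: p_def)
    then have p: "p permutes whites G"
      by (rule bij_imp_permutes) (simp add: p_def)
    have gp: "g (p v) = f v" if "v \<in> whites G" for v
      using that bij bg by (simp add: p_def bij_betw_inv_into_right bij_betwE)
    have "(\<lambda>v. (f v, p v)) ` whites G = (\<lambda>v. (g (p v), p v)) ` whites G"
      using gp by (intro image_cong) auto
    also have "\<dots> = (\<lambda>v. (g v, v)) ` p ` whites G" by (simp add: image_image)
    also have "\<dots> = M" using bp M by (simp add: bij_betw_def)
    finally have eq: "M = (\<lambda>v. (f v, p v)) ` whites G" by simp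
    have "(f v, p v) \<in> edges G" if v: "v \<in> whites G" for v
    proof -
      have "p v \<in> whites G" using bp v by (rule bij_betwE[THEN bspec])
      then have "(g (p v), p v) \<in> edges G" using g by (simp add: matching_maps_def)
      then show ?thesis using gp[OF v] by simp
    qed
    then have pin: "p \<in> {p. p permutes whites G \<and> (\<forall>v\<in>whites G. (f v, p v) \<in> edges G)}"
      using p by simp
    show "\<exists>p\<in>{p. p permutes whites G \<and> (\<forall>v\<in>whites G. (f v, p v) \<in> edges G)}.
        M = (\<lambda>v. (f v, p v)) ` whites G"
      by (intro bexI[of _ p] eq pin)
  }
qed

lemma pairing_matchings:
  assumes "M1 \<subseteq> edges G" "M2 \<subseteq> edges G"
  shows "pairing G (\<lambda>e. matching_chain M1 e - matching_chain M2 e) Z = sum Z M1 - sum Z M2"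
proof -
  have "pairing G (\<lambda>e. matching_chain M1 e - matching_chain M2 e) Z =
      (\<Sum>e\<in>edges G. (if e \<in> M1 then Z e else 0) - (if e \<in> M2 then Z e else 0))"
    unfolding pairing_def by (intro sum.cong refl) (auto simp: matching_chain_def)
  also have "\<dots> = (\<Sum>e\<in>edges G \<inter> M1. Z e) - (\<Sum>e\<in>edges G \<inter> M2. Z e)"
    using sum.inter_restrict[OF finite_edges, of Z M1] sum.inter_restrict[OF finite_edges, of Z M2]
    by (simp add: sum_subtractf)
  finally show ?thesis using assms by (simp add: Int_absorb1)
qed

text \<open>The boundary of a matching is the sum of all white vertices minus that of all black ones. It is the
same for all matchings, which makes the difference of two matchings closed.\<close>

lemma matching_coboundary:
  assumes M: "M \<in> matchings G"
  shows "(\<Sum>(b, w)\<in>M. g w - g b) = sum g (whites G) - (sum g (blacks G) :: 'c::ab_group_add)"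
proof -
  obtain f where f: "f \<in> matching_maps" and eq: "M = (\<lambda>v. (f v, v)) ` whites G"
    using map_of_matching[OF M] by metis
  have "(\<Sum>(b, w)\<in>M. g w - g b) = (\<Sum>v\<in>whites G. g v - g (f v))"
    unfolding eq by (subst sum.reindex) (auto simp: inj_on_def)
  also have "\<dots> = sum g (whites G) - (\<Sum>v\<in>whites G. g (f v))" by (rule sum_subtractf)
  also have "(\<Sum>v\<in>whites G. g (f v)) = sum g (blacks G)"
    using f by (intro sum.reindex_bij_betw) (simp add: matching_maps_def)
  finally show ?thesis .
qed

lemma H1_eval_matchings:
  fixes Z :: "('v, 'c::ab_group_add) cochain"
  assumes M: "M1 \<in> matchings G" "M2 \<in> matchings G"
  shows "H1_eval G (cohomology_class G Z) (\<lambda>e. matching_chain M1 e - matching_chain M2 e) = sum Z M1 - sum Z M2"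
proof -
  have sub: "M1 \<subseteq> edges G" "M2 \<subseteq> edges G" using M by (auto simp: matchings_def)
  have "pairing G (\<lambda>e. matching_chain M1 e - matching_chain M2 e) (\<lambda>(b, w). g w - g b) = (0 :: 'c)" for g
    unfolding pairing_matchings[OF sub] using matching_coboundary[OF M(1), of g] matching_coboundary[OF M(2), of g]
    by simp
  then show ?thesis using H1_eval_class pairing_matchings[OF sub] by metis
qed

text \<open>On classes that come from Z/2, subtracting the second matching is the same as adding it.\<close>

lemma delta_eq:
  "delta (cohomology_class G (\<lambda>e. half (D e))) G = (\<Sum>f\<in>matching_maps.
    \<Sum>p | p permutes whites G \<and> (\<forall>v\<in>whites G. (f v, p v) \<in> edges G).
      of_int (\<Prod>v\<in>whites G. bit_sign (D (f v, v) + D (f v, p v))))"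
proof -
  let ?Z = "\<lambda>e. half (D e)"
  let ?P = "\<lambda>f. {p. p permutes whites G \<and> (\<forall>v\<in>whites G. (f v, p v) \<in> edges G)}"
  let ?E = "\<lambda>M1 M2. eta (H1_eval G (cohomology_class G ?Z) (\<lambda>e. matching_chain M1 e - matching_chain M2 e))"
  let ?M = "\<lambda>f p. (\<lambda>v. (f v, p v)) ` whites G"
  have "delta (cohomology_class G ?Z) G = (\<Sum>f\<in>matching_maps. \<Sum>M2\<in>matchings G. ?E ((\<lambda>v. (f v, v)) ` whites G) M2)"
    unfolding delta_def by (rule sum.reindex_bij_betw[OF bij_matching_maps, symmetric])
  also have "\<dots> = (\<Sum>f\<in>matching_maps. \<Sum>p\<in>?P f. ?E ((\<lambda>v. (f v, v)) ` whites G) (?M f p))"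
    by (intro sum.cong refl sum.reindex_bij_betw[OF bij_matching_permutations, symmetric])
  also have "\<dots> = (\<Sum>f\<in>matching_maps. \<Sum>p\<in>?P f. of_int (\<Prod>v\<in>whites G. bit_sign (D (f v, v) + D (f v, p v))))"
  proof (intro sum.cong refl)
    fix f p assume f: "f \<in> matching_maps" and p: "p \<in> ?P f"
    have M: "(\<lambda>v. (f v, v)) ` whites G \<in> matchings G" "?M f p \<in> matchings G"
      using bij_betwE[OF bij_matching_maps] bij_betwE[OF bij_matching_permutations[OF f]] f p by blast+
    have inj: "inj_on f (whites G)" using f by (auto simp: matching_maps_def bij_betw_def)
    have "sum ?Z ((\<lambda>v. (f v, v)) ` whites G) = (\<Sum>v\<in>whites G. half (D (f v, v)))"
      by (subst sum.reindex) (auto simp: inj_on_def)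
    moreover have "sum ?Z (?M f p) = (\<Sum>v\<in>whites G. half (D (f v, p v)))"
      using inj by (subst sum.reindex) (auto simp: inj_on_def)
    ultimately have "?E ((\<lambda>v. (f v, v)) ` whites G) (?M f p) =
        (\<Prod>v\<in>whites G. eta (half (D (f v, v)))) * cnj (\<Prod>v\<in>whites G. eta (half (D (f v, p v))))"
      by (simp add: H1_eval_matchings[OF M] eta_diff eta_sum)
    also have "\<dots> = of_int (\<Prod>v\<in>whites G. bit_sign (D (f v, v) + D (f v, p v)))"
      by (simp add: eta_half bit_sign_add prod.distrib del: add_bit_eq_xor)
    finally show "?E ((\<lambda>v. (f v, v)) ` whites G) (?M f p) =
        of_int (\<Prod>v\<in>whites G. bit_sign (D (f v, v) + D (f v, p v)))" .
  qed
  finally show ?thesis .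
qed

section \<open>Coefficients of the singular polynomial\<close>

text \<open>The general form of the entries of a Kasteleyn matrix: the cochain \<open>A\<close> represents the Kasteleyn class,
and \<open>F\<close> is the gauge freedom within the class.\<close>

definition kasteleyn_entry :: "('v, bit) cochain \<Rightarrow> ('v \<Rightarrow> circle) \<Rightarrow> 'v \<Rightarrow> 'v \<Rightarrow> complex"
  where "kasteleyn_entry A F v u =
    (if (u, v) \<in> edges G then of_int (bit_sign (A (u, v))) * eta (F v) * cnj (eta (F u)) else 0)"

lemma p_class_eq:
  assumes "kasteleyn_cochain G A" and "plane_graph H" "kasteleyn_cochain H C" "edges H \<subseteq> edges G"
  shows "H1_half H (p_class G H) = cohomology_class H (\<lambda>e. half (A e - C e))"
  unfolding p_class_def kasteleyn_class_eq[OF assms(1)] plane_graph.kasteleyn_class_eq[OF assms(2,3)]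
    restrict_class[OF assms(4)] diff_class half_class ..

text \<open>Every vertex of \<open>S \<union> T\<close> is covered once by each matching, so its gauge factor occurs once as it is and
once conjugated.\<close>

lemma kasteleyn_entry_product:
  assumes S: "finite S" and f: "bij_betw f S T" and p: "p permutes S"
    and e: "\<And>v. v \<in> S \<Longrightarrow> (f v, v) \<in> edges G" "\<And>v. v \<in> S \<Longrightarrow> (f v, p v) \<in> edges G"
  shows "(\<Prod>v\<in>S. kasteleyn_entry A F v (f v) * cnj (kasteleyn_entry A F (p v) (f v))) =
    of_int (\<Prod>v\<in>S. bit_sign (A (f v, v) + A (f v, p v)))"
proof -
  have "(\<Prod>v\<in>S. kasteleyn_entry A F v (f v) * cnj (kasteleyn_entry A F (p v) (f v))) =
      (\<Prod>v\<in>S. of_int (bit_sign (A (f v, v) + A (f v, p v))) * (eta (F v) * cnj (eta (F (p v)))))"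
  proof (intro prod.cong refl)
    fix v assume v: "v \<in> S"
    let ?a = "of_int (bit_sign (A (f v, v))) :: complex" and ?b = "of_int (bit_sign (A (f v, p v))) :: complex"
    have "kasteleyn_entry A F v (f v) * cnj (kasteleyn_entry A F (p v) (f v)) =
        ?a * eta (F v) * cnj (eta (F (f v))) * (?b * cnj (eta (F (p v))) * eta (F (f v)))"
      using e[OF v] by (simp add: kasteleyn_entry_def)
    also have "\<dots> = ?a * ?b * (eta (F v) * cnj (eta (F (p v)))) * (eta (F (f v)) * cnj (eta (F (f v))))"
      by (simp only: mult_ac)
    also have "\<dots> = of_int (bit_sign (A (f v, v) + A (f v, p v))) * (eta (F v) * cnj (eta (F (p v))))"
      by (simp only: eta_cnj bit_sign_add of_int_mult mult_1_right)
    finally show "kasteleyn_entry A F v (f v) * cnj (kasteleyn_entry A F (p v) (f v)) =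
        of_int (bit_sign (A (f v, v) + A (f v, p v))) * (eta (F v) * cnj (eta (F (p v))))" .
  qed
  also have "\<dots> = of_int (\<Prod>v\<in>S. bit_sign (A (f v, v) + A (f v, p v))) *
      ((\<Prod>v\<in>S. eta (F v)) * (\<Prod>v\<in>S. cnj (eta (F (p v)))))"
    by (simp only: prod.distrib of_int_prod)
  also have "(\<Prod>v\<in>S. cnj (eta (F (p v)))) = (\<Prod>v\<in>S. cnj (eta (F v)))"
    using prod.permute[OF p, of "\<lambda>v. cnj (eta (F v))"] by (simp add: comp_def)
  also have "(\<Prod>v\<in>S. eta (F v)) * (\<Prod>v\<in>S. cnj (eta (F v))) = 1"
    by (simp only: prod.distrib[symmetric] eta_cnj prod.neutral_const)
  finally show ?thesis by simp
qed

text \<open>The class \<open>p\<^sub>G\<^sub>,\<^sub>H\<close> is represented by \<open>A - C\<close>, where \<open>A\<close> and \<open>C\<close> represent the Kasteleyn classes of \<open>G\<close>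
and \<open>H\<close>. By \<open>matchings_sign\<close> the contribution of \<open>C\<close> is \<open>sign p\<close>, and by \<open>kasteleyn_entry_product\<close>
that of \<open>A\<close> is the product of matrix entries.\<close>

lemma delta_p_class:
  assumes A: "kasteleyn_cochain G A"
  shows "delta (H1_half (induced G S) (p_class G (induced G S))) (induced G S) =
    (\<Sum>f | f \<in> (whites G \<inter> S) \<rightarrow>\<^sub>E (blacks G \<inter> S) \<and> bij_betw f (whites G \<inter> S) (blacks G \<inter> S).
      \<Sum>p | p permutes (whites G \<inter> S). of_int (sign p) *
        (\<Prod>v\<in>whites G \<inter> S. kasteleyn_entry A F v (f v) * cnj (kasteleyn_entry A F (p v) (f v))))"
proof -
  let ?H = "induced G S" and ?W = "whites G \<inter> S" and ?B = "blacks G \<inter> S"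
  let ?K = "kasteleyn_entry A F"
  let ?T = "\<lambda>f p. of_int (sign p) * (\<Prod>v\<in>?W. ?K v (f v) * cnj (?K (p v) (f v)))"
  let ?F = "{f. f \<in> ?W \<rightarrow>\<^sub>E ?B \<and> bij_betw f ?W ?B}"
  let ?P = "\<lambda>f. {p. p permutes ?W \<and> (\<forall>v\<in>?W. (f v, p v) \<in> edges ?H)}"
  interpret H: plane_graph ?H by (rule plane_induced)
  have finW: "finite ?W" using finite_verts by simp
  obtain C where C: "kasteleyn_cochain ?H C" using H.kasteleyn_cochain_exists by blast
  have edge: "(f v, p v) \<in> edges ?H"
    if "f \<in> ?F" "p permutes ?W" "v \<in> ?W" "(f v, p v) \<in> edges G" for f p v
  proof -
    have "f v \<in> ?B" using that(1,3) by (auto simp: PiE_def)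
    moreover have "p v \<in> ?W" using that(2,3) permutes_in_image[OF that(2)] by simp
    ultimately show ?thesis using that(4) by simp
  qed
  have maps: "H.matching_maps = {f \<in> ?F. \<forall>v\<in>?W. (f v, v) \<in> edges ?H}"
    by (auto simp: H.matching_maps_def)
  have "delta (H1_half ?H (p_class G ?H)) ?H = (\<Sum>f\<in>H.matching_maps. \<Sum>p\<in>?P f.
      of_int (\<Prod>v\<in>?W. bit_sign ((A (f v, v) - C (f v, v)) + (A (f v, p v) - C (f v, p v)))))"
    using p_class_eq[OF A H.plane_graph_axioms C] H.delta_eq[of "\<lambda>e. A e - C e"] by simp
  also have "\<dots> = (\<Sum>f\<in>H.matching_maps. \<Sum>p\<in>?P f. ?T f p)"
  proof (intro sum.cong refl)
    fix f p assume f: "f \<in> H.matching_maps" and p: "p \<in> ?P f"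
    have bij: "bij_betw f (whites ?H) (blacks ?H)" and fe: "\<And>v. v \<in> whites ?H \<Longrightarrow> (f v, v) \<in> edges ?H"
      using f by (auto simp: H.matching_maps_def)
    have pp: "p permutes whites ?H" and pe: "\<And>v. v \<in> whites ?H \<Longrightarrow> (f v, p v) \<in> edges ?H"
      using p by auto
    have s: "sign p = (\<Prod>v\<in>?W. bit_sign (C (f v, v) + C (f v, p v)))"
      using H.matchings_sign[OF C bij fe pp pe] by (simp only: bit_sign_sum induced_simps)
    have t: "(\<Prod>v\<in>?W. ?K v (f v) * cnj (?K (p v) (f v))) = of_int (\<Prod>v\<in>?W. bit_sign (A (f v, v) + A (f v, p v)))"
      using bij pp fe pe by (intro kasteleyn_entry_product[OF finW]) auto
    \<comment> \<open>In characteristic 2, subtraction is addition.\<close>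
    have minus: "(x - y) + (z - w) = (y + w) + (x + z)" for x y z w :: bit
      by (cases x; cases y; cases z; cases w) simp_all
    show "of_int (\<Prod>v\<in>?W. bit_sign ((A (f v, v) - C (f v, v)) + (A (f v, p v) - C (f v, p v)))) = ?T f p"
      unfolding s t minus by (simp only: bit_sign_add prod.distrib of_int_mult mult_ac)
  qed
  \<comment> \<open>Permutations and bijections that use a pair of nonadjacent vertices contribute 0.\<close>
  also have "\<dots> = (\<Sum>f\<in>H.matching_maps. \<Sum>p | p permutes ?W. ?T f p)"
  proof (rule sum.cong[OF refl], rule sum.mono_neutral_left)
    fix f assume "f \<in> H.matching_maps"
    then have f: "f \<in> ?F" by (simp add: maps)
    show "finite {p. p permutes ?W}" using finW by (rule finite_permutations)
    show "?P f \<subseteq> {p. p permutes ?W}" by blast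
    show "\<forall>p\<in>{p. p permutes ?W} - ?P f. ?T f p = 0"
    proof
      fix p assume p: "p \<in> {p. p permutes ?W} - ?P f"
      then obtain v where v: "v \<in> ?W" "(f v, p v) \<notin> edges ?H" by auto
      then have "(f v, p v) \<notin> edges G" using edge[OF f _ v(1)] p by blast
      then have "?K v (f v) * cnj (?K (p v) (f v)) = 0" by (simp add: kasteleyn_entry_def)
      then show "?T f p = 0" using v(1) finW prod_zero[OF finW] by (metis (no_types, lifting) mult_zero_right)
    qed
  qed
  also have "\<dots> = (\<Sum>f\<in>?F. \<Sum>p | p permutes ?W. ?T f p)"
  proof (rule sum.mono_neutral_left)
    have "finite (?W \<rightarrow>\<^sub>E ?B)" using finite_verts by (intro finite_PiE) auto
    then show "finite ?F" by (rule rev_finite_subset) blast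
    show "H.matching_maps \<subseteq> ?F" unfolding maps by blast
    show "\<forall>f\<in>?F - H.matching_maps. (\<Sum>p | p permutes ?W. ?T f p) = 0"
    proof
      fix f assume f: "f \<in> ?F - H.matching_maps"
      then obtain v where v: "v \<in> ?W" "(f v, v) \<notin> edges ?H" unfolding maps by blast
      have fF: "f \<in> ?F" using f by blast
      have "(f v, v) \<notin> edges G"
        using edge[OF fF permutes_id v(1)] v(2) by (metis id_apply)
      then have "?K v (f v) * cnj (?K (p v) (f v)) = 0" for p by (simp add: kasteleyn_entry_def)
      then have "?T f p = 0" for p using v(1) finW prod_zero[OF finW] by (metis (no_types, lifting) mult_zero_right)
      then show "(\<Sum>p | p permutes ?W. ?T f p) = 0" by (intro sum.neutral ballI)
    qed
  qed
  finally show ?thesis .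
qed

text \<open>A set \<open>S\<close> of \<open>m\<close> white vertices with an injection \<open>f\<close> into the black ones is the same as the balanced
set \<open>S \<union> f ` S\<close> with a bijection between its two colours.\<close>

lemma sum_over_balanced_subsets:
  fixes T :: "'v set \<Rightarrow> ('v \<Rightarrow> 'v) \<Rightarrow> 'a::comm_monoid_add"
  shows "(\<Sum>S | S \<subseteq> whites G \<and> card S = m. \<Sum>f | f \<in> S \<rightarrow>\<^sub>E blacks G \<and> inj_on f S. T S f) =
    (\<Sum>S | S \<subseteq> verts G \<and> card S = 2 * m \<and> card (whites G \<inter> S) = card (blacks G \<inter> S).
      \<Sum>f | f \<in> (whites G \<inter> S) \<rightarrow>\<^sub>E (blacks G \<inter> S) \<and> bij_betw f (whites G \<inter> S) (blacks G \<inter> S).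
        T (whites G \<inter> S) f)" (is "?L = ?R")
proof -
  let ?W = "whites G" and ?B = "blacks G"
  let ?X = "{S. S \<subseteq> ?W \<and> card S = m}"
  let ?Y = "{S. S \<subseteq> verts G \<and> card S = 2 * m \<and> card (?W \<inter> S) = card (?B \<inter> S)}"
  let ?F = "\<lambda>S. {f. f \<in> S \<rightarrow>\<^sub>E ?B \<and> inj_on f S}"
  let ?G = "\<lambda>S. {f. f \<in> (?W \<inter> S) \<rightarrow>\<^sub>E (?B \<inter> S) \<and> bij_betw f (?W \<inter> S) (?B \<inter> S)}"
  have finX: "finite ?X" "finite ?Y" using finite_verts by auto
  have finF: "finite (?F S)" if "S \<in> ?X" for S
  proof -
    have "finite S" using that finite_verts(1) finite_subset by blast
    then have "finite (S \<rightarrow>\<^sub>E ?B)" using finite_verts(2) by (intro finite_PiE)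
    then show ?thesis by (rule rev_finite_subset) blast
  qed
  have finG: "finite (?G S)" for S
  proof -
    have "finite ((?W \<inter> S) \<rightarrow>\<^sub>E (?B \<inter> S))" using finite_verts by (intro finite_PiE) auto
    then show ?thesis by (rule rev_finite_subset) blast
  qed
  have "?L = (\<Sum>(S, f)\<in>Sigma ?X ?F. T S f)"
    by (rule sum.Sigma) (use finX finF in auto)
  also have "\<dots> = (\<Sum>(S, f)\<in>Sigma ?Y ?G. T (?W \<inter> S) f)"
  proof (rule sum.reindex_bij_witness[where i = "\<lambda>(S, f). (?W \<inter> S, f)" and j = "\<lambda>(S, f). (S \<union> f ` S, f)"])
    fix a assume "a \<in> Sigma ?X ?F"
    then obtain S f where a: "a = (S, f)" and S: "S \<subseteq> ?W" "card S = m" and f: "f \<in> S \<rightarrow>\<^sub>E ?B" "inj_on f S"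
      by auto
    have fS: "f ` S \<subseteq> ?B" using f(1) by (auto simp: PiE_def)
    have W: "?W \<inter> (S \<union> f ` S) = S" using S fS disjoint_colours by blast
    have B: "?B \<inter> (S \<union> f ` S) = f ` S" using S fS disjoint_colours by blast
    have finS: "finite S" using S finite_verts(1) finite_subset by blast
    have "card (S \<union> f ` S) = card S + card (f ` S)"
      using finS fS S disjoint_colours by (intro card_Un_disjoint) auto
    then have card: "card (S \<union> f ` S) = 2 * m" using card_image[OF f(2)] S by simp
    have "f \<in> S \<rightarrow>\<^sub>E f ` S" using f(1) by (auto simp: PiE_def)
    moreover have "bij_betw f S (f ` S)" using f(2) by (simp add: bij_betw_def)
    ultimately have "(S \<union> f ` S, f) \<in> Sigma ?Y ?G"
      using W B card card_image[OF f(2)] S fS by (simp add: verts_def) blast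
    then show "(case a of (S, f) \<Rightarrow> (S \<union> f ` S, f)) \<in> Sigma ?Y ?G" unfolding a by simp
    show "(case (case a of (S, f) \<Rightarrow> (S \<union> f ` S, f)) of (S, f) \<Rightarrow> (?W \<inter> S, f)) = a"
      unfolding a by (simp add: W)
    show "(case (case a of (S, f) \<Rightarrow> (S \<union> f ` S, f)) of (S, f) \<Rightarrow> T (?W \<inter> S) f) = (case a of (S, f) \<Rightarrow> T S f)"
      unfolding a by (simp add: W)
  next
    fix b assume "b \<in> Sigma ?Y ?G"
    then obtain S f where b: "b = (S, f)" and S: "S \<subseteq> verts G" "card S = 2 * m" "card (?W \<inter> S) = card (?B \<inter> S)"
      and f: "f \<in> (?W \<inter> S) \<rightarrow>\<^sub>E (?B \<inter> S)" "bij_betw f (?W \<inter> S) (?B \<inter> S)"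
      by auto
    have img: "f ` (?W \<inter> S) = ?B \<inter> S" using f(2) by (simp add: bij_betw_def)
    have split: "(?W \<inter> S) \<union> (?B \<inter> S) = S" using S(1) by (auto simp: verts_def)
    have "card ((?W \<inter> S) \<union> (?B \<inter> S)) = card (?W \<inter> S) + card (?B \<inter> S)"
      using finite_verts disjoint_colours by (intro card_Un_disjoint) auto
    then have card: "card (?W \<inter> S) = m" using S split by simp
    have "f \<in> (?W \<inter> S) \<rightarrow>\<^sub>E ?B" using f(1) by (auto simp: PiE_def)
    then show "(case b of (S, f) \<Rightarrow> (?W \<inter> S, f)) \<in> Sigma ?X ?F"
      unfolding b using card f(2) by (simp add: bij_betw_def)
    show "(case (case b of (S, f) \<Rightarrow> (?W \<inter> S, f)) of (S, f) \<Rightarrow> (S \<union> f ` S, f)) = b"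
      unfolding b by (simp add: img split)
  qed
  also have "\<dots> = ?R"
    by (rule sum.Sigma[symmetric]) (use finX finG in auto)
  finally show ?thesis .
qed

text \<open>The class of \<open>K\<close> contains \<open>half \<circ> A\<close>, so the arguments of the entries of \<open>K\<close> differ from \<open>half \<circ> A\<close> by
a coboundary.\<close>

lemma kasteleyn_matrix_entries:
  assumes "numbering ws (whites G)" "numbering bs (blacks G)" "kasteleyn_matrix G ws bs K"
    and A: "kasteleyn_cochain G A"
  obtains F where "\<And>i j. i < length ws \<Longrightarrow> j < length bs \<Longrightarrow> K $$ (i, j) = kasteleyn_entry A F (ws ! i) (bs ! j)"
proof -
  have K: "gen_kasteleyn_matrix G ws bs K"
    and cls: "matrix_class G ws bs K = cohomology_class G (\<lambda>e. half (A e))"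
    using assms(3) unfolding kasteleyn_matrix_def kasteleyn_class_eq[OF A] half_class by auto
  then have "(\<lambda>e. half (A e)) \<in> matrix_class G ws bs K" using class_self by blast
  then obtain a where a: "\<forall>i<length ws. \<forall>j<length bs. (bs ! j, ws ! i) \<in> edges G \<longrightarrow> K $$ (i, j) = eta (a (bs ! j, ws ! i))"
    and "(a, \<lambda>e. half (A e)) \<in> cohomologous G"
    by (auto simp: matrix_class_def)
  then obtain f where f: "\<forall>(b, w)\<in>edges G. half (A (b, w)) - a (b, w) = f w - f b"
    by (auto simp: cohomologous_def)
  have "K $$ (i, j) = kasteleyn_entry A (\<lambda>v. - f v) (ws ! i) (bs ! j)" if ij: "i < length ws" "j < length bs" for i j
  proof (cases "(bs ! j, ws ! i) \<in> edges G")
    case True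
    have "half (A (bs ! j, ws ! i)) - a (bs ! j, ws ! i) = f (ws ! i) - f (bs ! j)"
      using bspec[OF f True] by simp
    then have "a (bs ! j, ws ! i) = half (A (bs ! j, ws ! i)) + (- f (ws ! i)) - (- f (bs ! j))"
      by (simp add: algebra_simps)
    then have "eta (a (bs ! j, ws ! i)) = of_int (bit_sign (A (bs ! j, ws ! i))) * eta (- f (ws ! i)) * cnj (eta (- f (bs ! j)))"
      by (simp only: eta_add eta_diff eta_half)
    then show ?thesis using a ij True by (simp add: kasteleyn_entry_def)
  next
    case False
    then show ?thesis using K ij by (simp add: gen_kasteleyn_matrix_def kasteleyn_entry_def)
  qed
  then show thesis by (rule that)
qed

lemma char_poly_kasteleyn:
  assumes ws: "numbering ws (whites G)" and bs: "numbering bs (blacks G)" and K: "kasteleyn_matrix G ws bs K"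
    and n: "card (whites G) = n"
  shows "monic (char_poly (K * mat_adjoint K))" "degree (char_poly (K * mat_adjoint K)) = n"
    and "m \<le> n \<Longrightarrow> coeff (char_poly (K * mat_adjoint K)) (n - m) = (- 1) ^ m *
      (\<Sum>H \<in> {induced G S | S. S \<subseteq> verts G \<and> card S = 2 * m \<and> balanced (induced G S)}.
        delta (H1_half H (p_class G H)) H)"
proof -
  obtain A where A: "kasteleyn_cochain G A" using kasteleyn_cochain_exists by blast
  obtain F where F: "\<And>i j. i < length ws \<Longrightarrow> j < length bs \<Longrightarrow> K $$ (i, j) = kasteleyn_entry A F (ws ! i) (bs ! j)"
    using kasteleyn_matrix_entries[OF ws bs K A] by blast
  let ?K = "kasteleyn_entry A F" and ?M = "K * mat_adjoint K"
  have len: "length ws = n" "distinct ws" "set ws = whites G" "distinct bs" "set bs = blacks G"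
    using ws bs n distinct_card[of ws] by (auto simp: numbering_def)
  have Kc: "K \<in> carrier_mat n (length bs)"
    using K len by (simp add: kasteleyn_matrix_def gen_kasteleyn_matrix_def)
  have adj: "mat_adjoint K \<in> carrier_mat (length bs) n"
    using Kc by (auto simp: mat_adjoint_def mat_of_rows_def)
  have Mc: "?M \<in> carrier_mat n n" using Kc adj by simp
  show "monic (char_poly ?M)" "degree (char_poly ?M) = n"
    using degree_monic_char_poly[OF Mc] by auto
  have entry: "?M $$ (i, j) = (\<Sum>u\<in>blacks G. ?K (ws ! i) u * cnj (?K (ws ! j) u))" if ij: "i < n" "j < n" for i j
  proof -
    have "?M $$ (i, j) = (\<Sum>k = 0..<length bs. K $$ (i, k) * cnj (K $$ (j, k)))"
      using Kc adj ij by (auto simp: scalar_prod_def mat_adjoint_def mat_of_rows_def intro!: sum.cong)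
    also have "\<dots> = (\<Sum>k = 0..<length bs. ?K (ws ! i) (bs ! k) * cnj (?K (ws ! j) (bs ! k)))"
      using ij len F by (intro sum.cong) auto
    also have "\<dots> = (\<Sum>u\<in>blacks G. ?K (ws ! i) u * cnj (?K (ws ! j) u))"
      using bij_betw_nth[OF len(4), of "{..<length bs}" "blacks G"] len(5)
      by (intro sum.reindex_bij_betw) (simp add: atLeast0LessThan)
    finally show ?thesis .
  qed
  assume m: "m \<le> n"
  let ?T = "\<lambda>S f. \<Sum>p | p permutes S. of_int (sign p) * (\<Prod>v\<in>S. ?K v (f v) * cnj (?K (p v) (f v)))"
  let ?Y = "{S. S \<subseteq> verts G \<and> card S = 2 * m \<and> card (whites G \<inter> S) = card (blacks G \<inter> S)}"
  have "coeff (char_poly ?M) (n - m) = (- 1) ^ m *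
      (\<Sum>S | S \<subseteq> set ws \<and> card S = m. principal_minor (\<lambda>v w. \<Sum>u\<in>blacks G. ?K v u * cnj (?K w u)) S)"
    by (rule char_poly_coeff[OF Mc m len(2,1) entry])
  also have "(\<Sum>S | S \<subseteq> set ws \<and> card S = m. principal_minor (\<lambda>v w. \<Sum>u\<in>blacks G. ?K v u * cnj (?K w u)) S) =
      (\<Sum>S | S \<subseteq> whites G \<and> card S = m. \<Sum>f | f \<in> S \<rightarrow>\<^sub>E blacks G \<and> inj_on f S. ?T S f)"
    unfolding len(3)
  proof (intro sum.cong refl gram_principal_minor)
    fix S assume "S \<in> {S. S \<subseteq> whites G \<and> card S = m}"
    then show "finite S" using finite_verts(1) finite_subset by blast
  qed (rule finite_verts(2))
  also have "\<dots> = (\<Sum>S\<in>?Y. delta (H1_half (induced G S) (p_class G (induced G S))) (induced G S))"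
    unfolding sum_over_balanced_subsets delta_p_class[OF A, of _ F] ..
  also have "\<dots> = (\<Sum>H\<in>induced G ` ?Y. delta (H1_half H (p_class G H)) H)"
  proof (rule sum.reindex[symmetric, unfolded comp_def])
    show "inj_on (induced G) ?Y"
    proof (rule inj_onI)
      fix S S' assume "S \<in> ?Y" "S' \<in> ?Y" "induced G S = induced G S'"
      then have "verts G \<inter> S = verts G \<inter> S'" "S \<subseteq> verts G" "S' \<subseteq> verts G"
        by (auto simp flip: induced_simps(4))
      then show "S = S'" by blast
    qed
  qed
  also have "induced G ` ?Y = {induced G S | S. S \<subseteq> verts G \<and> card S = 2 * m \<and> balanced (induced G S)}"
    by (auto simp: balanced_def)
  finally show "coeff (char_poly ?M) (n - m) = (- 1) ^ m *
      (\<Sum>H \<in> {induced G S | S. S \<subseteq> verts G \<and> card S = 2 * m \<and> balanced (induced G S)}.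
        delta (H1_half H (p_class G H)) H)" .
qed

lemma kasteleyn_matrix_exists:
  "\<exists>ws bs K. numbering ws (whites G) \<and> numbering bs (blacks G) \<and> kasteleyn_matrix G ws bs K"
proof -
  obtain A where A: "kasteleyn_cochain G A" using kasteleyn_cochain_exists by blast
  obtain ws where ws: "set ws = whites G" "distinct ws" using finite_distinct_list[OF finite_verts(1)] by blast
  obtain bs where bs: "set bs = blacks G" "distinct bs" using finite_distinct_list[OF finite_verts(2)] by blast
  define K where "K = mat (length ws) (length bs) (\<lambda>(i, j).
    if (bs ! j, ws ! i) \<in> edges G then eta (half (A (bs ! j, ws ! i))) else 0)"
  let ?X = "{a. \<forall>i<length ws. \<forall>j<length bs. (bs ! j, ws ! i) \<in> edges G \<longrightarrow> K $$ (i, j) = eta (a (bs ! j, ws ! i))}"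
  have "cohomologous G `` ?X = cohomology_class G (\<lambda>e. half (A e))"
  proof (rule image_class)
    show "(\<lambda>e. half (A e)) \<in> ?X" by (simp add: K_def)
    fix a assume a: "a \<in> ?X"
    have "a (b, w) = half (A (b, w))" if e: "(b, w) \<in> edges G" for b w
    proof -
      have "b \<in> set bs" "w \<in> set ws" using edge_ends[OF e] ws bs by auto
      then obtain i j where ij: "i < length ws" "j < length bs" "ws ! i = w" "bs ! j = b"
        by (metis in_set_conv_nth)
      then have "K $$ (i, j) = eta (half (A (b, w)))" using e by (simp add: K_def)
      moreover have "K $$ (i, j) = eta (a (b, w))" using a ij e by auto
      ultimately show ?thesis using eta_inj by metis
    qed
    then show "(\<lambda>e. half (A e), a) \<in> cohomologous G"
      by (auto simp: cohomologous_def intro!: exI[of _ "\<lambda>_. 0"])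
  qed
  then have "kasteleyn_matrix G ws bs K"
    unfolding kasteleyn_matrix_def matrix_class_def gen_kasteleyn_matrix_def kasteleyn_class_eq[OF A] half_class
    by (auto simp: K_def norm_eta)
  then show ?thesis using ws bs unfolding numbering_def by blast
qed

end

text \<open>By \<open>char_poly_kasteleyn\<close> the coefficients of the characteristic polynomial are the same for all
Kasteleyn matrices and all numberings, so the singular polynomial is well defined.\<close>

theorem theorem3p3:
  fixes G :: "'v drawn_graph" and n :: nat
  assumes "plane_bipartite_graph G"
    and "card (whites G) = n"
  shows "monic (singular_polynomial G) \<and> degree (singular_polynomial G) = n \<and>
    (\<forall>m\<in>{1..n}. coeff (singular_polynomial G) (n - m) =
      (- 1) ^ m *
        (\<Sum>H \<in> {induced G S | S. S \<subseteq> verts G \<and> card S = 2 * m \<and> balanced (induced G S)}.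
          delta (H1_half H (p_class G H)) H))"
proof -
  interpret plane_graph G by unfold_locales (rule assms(1))
  obtain ws bs K where K: "numbering ws (whites G)" "numbering bs (blacks G)" "kasteleyn_matrix G ws bs K"
    using kasteleyn_matrix_exists by blast
  let ?P = "char_poly (K * mat_adjoint K)"
  note P = char_poly_kasteleyn[OF K assms(2)]
  have "singular_polynomial G = ?P"
    unfolding singular_polynomial_def
  proof (rule the_equality)
    show "\<exists>ws bs K. numbering ws (whites G) \<and> numbering bs (blacks G) \<and> kasteleyn_matrix G ws bs K \<and>
        ?P = char_poly (K * mat_adjoint K)"
      using K by blast
  next
    fix Q assume "\<exists>ws bs K. numbering ws (whites G) \<and> numbering bs (blacks G) \<and> kasteleyn_matrix G ws bs K \<and>
        Q = char_poly (K * mat_adjoint K)"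
    then obtain ws' bs' K' where K': "numbering ws' (whites G)" "numbering bs' (blacks G)" "kasteleyn_matrix G ws' bs' K'"
      and Q: "Q = char_poly (K' * mat_adjoint K')" by blast
    note P' = char_poly_kasteleyn[OF K' assms(2), folded Q]
    show "Q = ?P"
    proof (rule poly_eqI)
      fix i
      show "coeff Q i = coeff ?P i"
      proof (cases "i \<le> n")
        case True
        then show ?thesis using P(3)[of "n - i"] P'(3)[of "n - i"] by simp
      next
        case False
        then show ?thesis using P(2) P'(2) by (simp add: coeff_eq_0)
      qed
    qed
  qed
  then show ?thesis using P by auto
qed

end
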